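(* Let $k$ be an even integer and let $N\in\{2,3\}$. Let $f$ be a cuspidal Hecke eigenform of weight $k$ for $\mathrm{SL}_2(\mathbb{Z})$, let $r_f^{\mathrm{ev},0}(x,y)=\sum_{(m_1,m_2)\in\mathbf{oo}(k)}a_{m_1,m_2}x^{m_2-1}y^{m_1-1}$ be its restricted even period polynomial, and let $v_f=(a_{m_1,m_2})_{(m_1,m_2)\in\mathbf{oo}(k)}$ be the associated row vector. Then $v_f$ is a left eigenvector of the matrix $\mathcal{C}_{k,2}^{N}$, i.e. $v_f\,\mathcal{C}_{k,2}^{N}=\mu_N\, v_f$, with eigenvalue $$\mu_2=\frac{\lambda_2-(1+2^{k-1})}{2^{k-2}}\quad (N=2),\qquad \mu_3=\frac{\lambda_3-(1+3^{k-1})}{4\cdot 3^{k-2}}\quad (N=3),$$ where $\lambda_2$ (respectively $\lambda_3$) is the eigenvalue of the Hecke operator $T_2$ (respectively $T_3$) on $f$.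
   Context: **Index sets.** For even $k$, $\mathbf{oo}(k)$ is the ordered set $\{(k-3,3),(k-5,5),\dots,(3,k-3)\}$ of pairs of odd integers $\ge 3$ with sum $k$ (empty if $k<6$), and $\mathbf{oo}'(k)$ is the same set in the reverse order $\{(3,k-3),\dots,(k-3,3)\}$. A matrix with rows indexed by $\mathbf{oo}(k)$ and columns indexed by $\mathbf{oo}'(k)$ is regarded as an ordinary $d\times d$ matrix, $d=|\mathbf{oo}(k)|$, by listing rows and columns in these orders; a vector indexed by $\mathbf{oo}(k)$ is regarded as a row vector in $\mathbb{C}^d$ listed in the order of $\mathbf{oo}(k)$. The equation $v\mathcal C=\mu v$ is the equation for row vectors in $\mathbb{C}^d$ (entries compared by position). **Period polynomials.** For a cusp form $f$ of weight $k$, $r_f(x,y)=\int_0^{i\infty}f(z)(zy-x)^{k-2}\,dz$. The restricted even period polynomial $r_f^{\mathrm{ev},0}(x,y)$ is obtained from $r_f$ by keeping only the monomials $x^iy^j$ with $i,j$ even and then deleting the $x^{k-2}$ and $y^{k-2}$ terms. It is written $\sum_{(m_1,m_2)\in\mathbf{oo}(k)}a_{m_1,m_2}x^{m_2-1}y^{m_1-1}$. **Hecke operators.** $T_p f(z)=p^{k-1}f(pz)+\frac1p\sum_{j=0}^{p-1}f\left(\frac{z+j}{p}\right)$ for $p$ prime. **Motivic multiple zeta values relative to $\mu_N$.** The multiple zeta values relative to the group $\mu_N$ of $N$th roots of unity are $\zeta\binom{n_1,\dots,n_r}{\varepsilon_1,\dots,\varepsilon_r}=\sum_{0<k_1<\cdots<k_r}\frac{\varepsilon_1^{k_1}\cdots\varepsilon_r^{k_r}}{k_1^{n_1}\cdots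 k_r^{n_r}}$, with $n_i\ge1$, $\varepsilon_i\in\mu_N$, $(n_r,\varepsilon_r)\ne(1,1)$; the weight is $n_1+\cdots+n_r$ and the depth is $r$. Let $\mathcal H^N$ be the $\mathbb{Q}$-algebra of their motivic versions $\zeta^{\mathfrak m}\binom{n_1,\dots,n_r}{\varepsilon_1,\dots,\varepsilon_r}$, with its weight grading and depth filtration $\mathfrak D$ (associated graded $\mathrm{gr}^{\mathfrak D}_\bullet$). Let $\mathcal{MT}'_N$ be the Tannakian category generated by the motivic fundamental groupoid of $\mathbb P^1\setminus\{0,\mu_N,\infty\}$, with Galois group $\mathbb G_m\ltimes\mathcal U_N$, let $\mathcal A^N=\mathcal O(\mathcal U_N)$ and let $\mathcal L^N=\mathcal A^N_{>0}/(\mathcal A^N_{>0}\cdot\mathcal A^N_{>0})$ be the Lie coalgebra of indecomposables; $\zeta^{\mathfrak l}$ denotes the image of $\zeta^{\mathfrak m}$ in $\mathcal L^N$. The operator $D_p:\mathcal H^N\to\mathcal L^N_p\otimes\mathcal H^N$ is the (Goncharov–Brown) motivic coaction $\mathcal H^N\to\mathcal A^N\otimes\mathcal H^N$ followed by projection of the left factor to the weight $p$ part of $\mathcal L^N$; it induces $D_p:\mathrm{gr}^{\mathfrak D}_r\mathcal H^N\to\mathrm{gr}_1^{\mathfrak D}\mathcal L^N_p\otimes\mathrm{gr}^{\mathfrak D}_{r-1}\mathcal H^N$. Explicitly (known formula of Glanois), $D_p\zeta^{\mathfrak m}\binom{n}{\varepsilon}=\delta_{p=n}\zeta^{\mathfrak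 l}\binom{p}{\varepsilon}\otimes 1$, and for $\varepsilon\in\mu_N$ and $p\le n_1+n_2-2$, $$D_p\zeta^{\mathfrak m}\binom{n_1,n_2}{\varepsilon,\varepsilon^{-1}}=\delta_{p=n_1}\zeta^{\mathfrak l}\binom{p}{\varepsilon}\otimes\zeta^{\mathfrak m}\binom{n_2}{\varepsilon^{-1}}+\Big[(-1)^{n_1}\binom{p-1}{p-n_1}+(-1)^{p-n_2}\binom{p-1}{p-n_2}\Big]\zeta^{\mathfrak l}\binom{p}{\varepsilon^{-1}}\otimes\zeta^{\mathfrak m}\binom{n_1+n_2-p}{1},$$ with $\binom rs=0$ for $s<0$. **Derivations.** Let $N\in\{2,3\}$ and $p\ge3$ odd. In $\mathrm{gr}^{\mathfrak D}_1\mathcal L^N_p$, which is spanned by $\zeta^{\mathfrak l}\binom p1$, one has (Deligne–Goncharov) $\zeta^{\mathfrak l}\binom p\varepsilon=c_{1,\varepsilon,p}\,\zeta^{\mathfrak l}\binom p1$ for $\varepsilon\in\mu_N$, where $c_{1,1,p}=1$; $c_{1,-1,p}=2^{-p+1}-1$ for $N=2$; and $c_{1,\varepsilon,p}=\frac{3^{-p+1}-1}{2}$ for both primitive cube roots of unity $\varepsilon$ when $N=3$. Define $\partial_p:\mathrm{gr}^{\mathfrak D}_r\mathcal H^N\to\mathrm{gr}^{\mathfrak D}_{r-1}\mathcal H^N$ as $D_p$ followed by $\zeta^{\mathfrak l}\binom p\varepsilon\otimes X\mapsto c_{1,\varepsilon,p}X$. **The matrix $\mathcal C^N_{k,2}$.**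 Let $\varepsilon_N=e^{2\pi\sqrt{-1}/N}$. The entry of $\mathcal C^N_{k,2}$ in row $(m_1,m_2)\in\mathbf{oo}(k)$ and column $(n_1,n_2)\in\mathbf{oo}'(k)$ is $\partial_{m_2}\partial_{m_1}\zeta^{\mathfrak m}\binom{n_1,n_2}{\varepsilon_N,\varepsilon_N^{-1}}\in\mathbb Q$. *)

theory Defs
  imports
    "HOL-Complex_Analysis.Complex_Analysis"
    "HOL-Library.Function_Algebras"
    "Jordan_Normal_Form.Char_Poly"
begin

section \<open>Index sets\<close>

text \<open>\<open>odd_pairs k\<close> is \<open>oo(k) = (k-3,3), (k-5,5), \<dots>, (3,k-3)\<close>, and \<open>odd_pairs_rev k\<close> is \<open>oo'(k)\<close>.\<close>

definition odd_pairs :: "int \<Rightarrow> (nat \<times> nat) list" where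
  "odd_pairs k = map (\<lambda>i. (nat k - (2 * i + 3), 2 * i + 3)) [0..<nat k div 2 - 2]"

definition odd_pairs_rev :: "int \<Rightarrow> (nat \<times> nat) list" where
  "odd_pairs_rev k = rev (odd_pairs k)"


section \<open>Cusp forms, Hecke operators and period polynomials\<close>

text \<open>Modular forms are functions on \<^typ>\<open>complex\<close> of which only the values on the upper half
  plane matter.\<close>

definition cusp_form :: "int \<Rightarrow> (complex \<Rightarrow> complex) \<Rightarrow> bool" where
  "cusp_form k f \<longleftrightarrow>
     f holomorphic_on {z. Im z > 0} \<and>
     (\<forall>a b c d :: int. a * d - b * c = 1 \<longrightarrow>
        (\<forall>z. Im z > 0 \<longrightarrow>
           f ((of_int a * z + of_int b) / (of_int c * z + of_int d)) =
             (of_int c * z + of_int d) powi k * f z)) \<and>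
     (f \<longlongrightarrow> 0) (filtercomap Im at_top)"

definition hecke :: "int \<Rightarrow> nat \<Rightarrow> (complex \<Rightarrow> complex) \<Rightarrow> complex \<Rightarrow> complex" where
  "hecke k p f z =
     of_nat p powi (k - 1) * f (of_nat p * z) +
     1 / of_nat p * (\<Sum>j<p. f ((z + of_nat j) / of_nat p))"

definition hecke_eigenvalue :: "int \<Rightarrow> nat \<Rightarrow> (complex \<Rightarrow> complex) \<Rightarrow> complex \<Rightarrow> bool" where
  "hecke_eigenvalue k p f l \<longleftrightarrow> (\<forall>z. Im z > 0 \<longrightarrow> hecke k p f z = l * f z)"

definition cuspidal_hecke_eigenform :: "int \<Rightarrow> (complex \<Rightarrow> complex) \<Rightarrow> bool" where
  "cuspidal_hecke_eigenform k f \<longleftrightarrow>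
     cusp_form k f \<and> (\<exists>z. Im z > 0 \<and> f z \<noteq> 0) \<and>
     (\<forall>p. prime p \<longrightarrow> (\<exists>l. hecke_eigenvalue k p f l))"

text \<open>The path from \<open>0\<close> to \<open>i\<infinity>\<close> is parametrised by \<open>z = it\<close>.\<close>

definition period_fun :: "int \<Rightarrow> (complex \<Rightarrow> complex) \<Rightarrow> complex \<Rightarrow> complex \<Rightarrow> complex" where
  "period_fun k f x y =
     integral {0<..} (\<lambda>t :: real. f (\<i> * of_real t) * (\<i> * of_real t * y - x) ^ nat (k - 2) * \<i>)"

text \<open>Polynomials in \<open>x, y\<close> are polynomials in \<open>y\<close> over polynomials in \<open>x\<close>: the coefficient of
  \<open>x^i y^j\<close> in \<open>P\<close> is \<open>coeff (coeff P j) i\<close>.\<close>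

definition period_poly :: "int \<Rightarrow> (complex \<Rightarrow> complex) \<Rightarrow> complex poly poly" where
  "period_poly k f = (THE P. \<forall>x y. poly (poly P [:y:]) x = period_fun k f x y)"

definition restrict_even :: "nat \<Rightarrow> complex poly poly \<Rightarrow> complex poly poly" where
  "restrict_even w P =
     (\<Sum>i\<le>w. \<Sum>j\<le>w.
        if even i \<and> even j \<and> (i, j) \<noteq> (w, 0) \<and> (i, j) \<noteq> (0, w)
        then monom (monom (coeff (coeff P j) i) i) j else 0)"

definition restricted_even_period_poly :: "int \<Rightarrow> (complex \<Rightarrow> complex) \<Rightarrow> complex poly poly" where
  "restricted_even_period_poly k f = restrict_even (nat (k - 2)) (period_poly k f)"

definition period_vector :: "int \<Rightarrow> (complex \<Rightarrow> complex) \<Rightarrow> complex Matrix.vec" where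
  "period_vector k f =
     Matrix.vec (length (odd_pairs k)) (\<lambda>i. case odd_pairs k ! i of (m1, m2) \<Rightarrow>
       coeff (coeff (restricted_even_period_poly k f) (m1 - 1)) (m2 - 1))"


section \<open>Tensor products of rational vector spaces\<close>

text \<open>Over a field, the tensor product of two vector spaces embeds into the linear dual of the
  space of bilinear forms on them; \<open>a \<otimes> h\<close> is evaluation of bilinear forms at \<open>(a, h)\<close>.\<close>

type_synonym ('a, 'h) tensor = "('a \<Rightarrow> 'h \<Rightarrow> rat) \<Rightarrow> rat"

definition bilinear_form ::
    "(rat \<Rightarrow> 'a \<Rightarrow> 'a) \<Rightarrow> (rat \<Rightarrow> 'h \<Rightarrow> 'h) \<Rightarrow> ('a::ab_group_add \<Rightarrow> 'h::ab_group_add \<Rightarrow> rat) \<Rightarrow> bool" where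
  "bilinear_form s1 s2 \<beta> \<longleftrightarrow>
     (\<forall>h. Vector_Spaces.linear s1 (*) (\<lambda>a. \<beta> a h)) \<and> (\<forall>a. Vector_Spaces.linear s2 (*) (\<beta> a))"

definition tens ::
    "(rat \<Rightarrow> 'a \<Rightarrow> 'a) \<Rightarrow> (rat \<Rightarrow> 'h \<Rightarrow> 'h) \<Rightarrow> 'a::ab_group_add \<Rightarrow> 'h::ab_group_add \<Rightarrow> ('a, 'h) tensor" where
  "tens s1 s2 a h = (\<lambda>\<beta>. if bilinear_form s1 s2 \<beta> then \<beta> a h else 0)"

definition tscale :: "rat \<Rightarrow> ('a, 'h) tensor \<Rightarrow> ('a, 'h) tensor" where
  "tscale q t = (\<lambda>\<beta>. q * t \<beta>)"

definition tspan :: "('a, 'h) tensor set \<Rightarrow> ('a, 'h) tensor set" where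
  "tspan = Modules.module.span tscale"

text \<open>For a linear functional \<open>\<psi>\<close> on the left factor, the linear map \<open>a \<otimes> h \<mapsto> \<psi>(a) h\<close>.\<close>

definition contract ::
    "(rat \<Rightarrow> 'h \<Rightarrow> 'h) \<Rightarrow> ('a \<Rightarrow> rat) \<Rightarrow> ('a, 'h::ab_group_add) tensor \<Rightarrow> 'h" where
  "contract s2 \<psi> t =
     (THE h. \<forall>\<phi>. Vector_Spaces.linear s2 (*) \<phi> \<longrightarrow> \<phi> h = t (\<lambda>a x. \<psi> a * \<phi> x))"


section \<open>Multiple zeta values relative to roots of unity\<close>

text \<open>Symbols \<open>(n\<^sub>1,\<dots>,n\<^sub>r; \<epsilon>\<^sub>1,\<dots>,\<epsilon>\<^sub>r)\<close> with a convergent series; \<open>r = 0\<close> is allowed.\<close>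

definition admissible :: "nat \<Rightarrow> nat list \<Rightarrow> complex list \<Rightarrow> bool" where
  "admissible N ns es \<longleftrightarrow>
     length ns = length es \<and> (\<forall>n\<in>set ns. n \<ge> 1) \<and> (\<forall>e\<in>set es. e ^ N = 1) \<and>
     (ns \<noteq> [] \<longrightarrow> (last ns, last es) \<noteq> (1, 1))"

text \<open>The series need not converge absolutely; it is summed by increasing bound on \<open>k\<^sub>r\<close>.\<close>

definition mzv :: "nat list \<Rightarrow> complex list \<Rightarrow> complex" where
  "mzv ns es =
     lim (\<lambda>K. \<Sum>ks | length ks = length ns \<and> sorted_wrt (<) ks \<and> set ks \<subseteq> {1..K}.
       \<Prod>i<length ns. (es ! i) ^ (ks ! i) / of_nat (ks ! i) ^ (ns ! i))"


section \<open>The motivic setting\<close>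

text \<open>The underlying data of the algebras \<open>\<A>\<^sup>N\<close> (type \<open>'a\<close>) and \<open>\<H>\<^sup>N\<close> (type \<open>'h\<close>): their
  rational vector space structures and weight gradings, the projection \<open>\<H>\<^sup>N \<rightarrow> \<A>\<^sup>N\<close>, the
  coaction \<open>\<H>\<^sup>N \<rightarrow> \<A>\<^sup>N \<otimes> \<H>\<^sup>N\<close>, the motivic multiple zeta values, and the period map.\<close>

record ('a, 'h) motivic_data =
  scaleA :: "rat \<Rightarrow> 'a \<Rightarrow> 'a"
  scaleH :: "rat \<Rightarrow> 'h \<Rightarrow> 'h"
  weightA :: "nat \<Rightarrow> 'a set"
  weightH :: "nat \<Rightarrow> 'h set"
  projA :: "'h \<Rightarrow> 'a"
  coact :: "'h \<Rightarrow> ('a, 'h) tensor"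
  zm :: "nat list \<Rightarrow> complex list \<Rightarrow> 'h"
  per :: "'h \<Rightarrow> complex"

definition tensM ::
    "('a::comm_ring_1, 'h::comm_ring_1) motivic_data \<Rightarrow> 'a \<Rightarrow> 'h \<Rightarrow> ('a, 'h) tensor" where
  "tensM M = tens (scaleA M) (scaleH M)"

text \<open>\<open>depth_lt M N r\<close> is the step \<open>\<D>\<^sub>r\<^sub>-\<^sub>1\<close> of the depth filtration on \<open>\<H>\<^sup>N\<close>; in particular it is
  \<open>0\<close> for \<open>r = 0\<close>. An element of \<open>gr\<^sub>r\<close> is a coset \<open>depth_class M N r x\<close> with
  \<open>x \<in> depth_lt M N (r + 1)\<close>.\<close>

definition depth_lt ::
    "('a::comm_ring_1, 'h::comm_ring_1) motivic_data \<Rightarrow> nat \<Rightarrow> nat \<Rightarrow> 'h set" where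
  "depth_lt M N r =
     Modules.module.span (scaleH M) {zm M ns es | ns es. admissible N ns es \<and> length ns < r}"

definition depth_class ::
    "('a::comm_ring_1, 'h::comm_ring_1) motivic_data \<Rightarrow> nat \<Rightarrow> nat \<Rightarrow> 'h \<Rightarrow> 'h set" where
  "depth_class M N r x = {y. y - x \<in> depth_lt M N r}"

text \<open>The kernel of the projection of \<open>\<A>\<^sup>N\<close> onto the weight \<open>p\<close> part \<open>\<L>\<^sup>N\<^sub>p\<close> (with \<open>p > 0\<close>) of its
  indecomposables. Thus \<open>\<zeta>\<^sup>l(p; \<epsilon>)\<close> is represented by \<open>projA M (zm M [p] [\<epsilon>])\<close> modulo \<open>lie_ker M p\<close>.
  As \<open>\<D>\<^sub>0\<close> has weight \<open>0\<close>, \<open>gr\<^sub>1 \<L>\<^sup>N\<^sub>p\<close> is the subspace of depth at most \<open>1\<close> of \<open>\<L>\<^sup>N\<^sub>p\<close>.\<close>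

definition lie_ker :: "('a::comm_ring_1, 'h) motivic_data \<Rightarrow> nat \<Rightarrow> 'a set" where
  "lie_ker M p = Modules.module.span (scaleA M)
     ((\<Union>q\<in>-{p}. weightA M q) \<union>
      {a * b | a b i j. i > 0 \<and> j > 0 \<and> a \<in> weightA M i \<and> b \<in> weightA M j})"

text \<open>The class of a tensor in \<open>\<L>\<^sup>N\<^sub>p \<otimes> (\<H>\<^sup>N / \<D>\<^sub>r\<^sub>-\<^sub>1)\<close>, which contains
  \<open>gr\<^sub>1 \<L>\<^sup>N\<^sub>p \<otimes> gr\<^sub>r \<H>\<^sup>N\<close>.\<close>

definition tensor_class ::
    "('a::comm_ring_1, 'h::comm_ring_1) motivic_data \<Rightarrow> nat \<Rightarrow> nat \<Rightarrow> nat \<Rightarrow> ('a, 'h) tensor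
       \<Rightarrow> ('a, 'h) tensor set" where
  "tensor_class M N p r t =
     {t'. t' - t \<in> tspan {tensM M a h | a h. a \<in> lie_ker M p \<or> h \<in> depth_lt M N r}}"

text \<open>\<open>D\<^sub>p : gr\<^sub>r \<H>\<^sup>N \<rightarrow> gr\<^sub>1 \<L>\<^sup>N\<^sub>p \<otimes> gr\<^sub>r\<^sub>-\<^sub>1 \<H>\<^sup>N\<close> on cosets. All members of the union coincide when the
  coaction respects the depth filtration.\<close>

definition D_gr ::
    "('a::comm_ring_1, 'h::comm_ring_1) motivic_data \<Rightarrow> nat \<Rightarrow> nat \<Rightarrow> nat \<Rightarrow> 'h set
       \<Rightarrow> ('a, 'h) tensor set" where
  "D_gr M N p r X = (\<Union>x\<in>X. tensor_class M N p (r - 1) (coact M x))"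

definition lie_const :: "nat \<Rightarrow> complex \<Rightarrow> nat \<Rightarrow> rat" where
  "lie_const N \<epsilon> p =
     (if \<epsilon> = 1 then 1 else if N = 2 then 1 / 2 ^ (p - 1) - 1 else (1 / 3 ^ (p - 1) - 1) / 2)"

text \<open>Linear functionals on \<open>\<L>\<^sup>N\<^sub>p\<close> with \<open>\<zeta>\<^sup>l(p; \<epsilon>) \<mapsto> c\<^sub>1\<^sub>,\<^sub>\<epsilon>\<^sub>,\<^sub>p\<close>. They all agree on \<open>gr\<^sub>1 \<L>\<^sup>N\<^sub>p\<close>; outside it
  the choice is immaterial, as it changes the result by terms of lower depth.\<close>

definition lie_coord ::
    "('a::comm_ring_1, 'h) motivic_data \<Rightarrow> nat \<Rightarrow> nat \<Rightarrow> ('a \<Rightarrow> rat) \<Rightarrow> bool" where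
  "lie_coord M N p \<psi> \<longleftrightarrow>
     Vector_Spaces.linear (scaleA M) (*) \<psi> \<and> (\<forall>a\<in>lie_ker M p. \<psi> a = 0) \<and>
     (\<forall>\<epsilon>. \<epsilon> ^ N = 1 \<longrightarrow> \<psi> (projA M (zm M [p] [\<epsilon>])) = lie_const N \<epsilon> p)"

text \<open>\<open>\<partial>\<^sub>p : gr\<^sub>r \<H>\<^sup>N \<rightarrow> gr\<^sub>r\<^sub>-\<^sub>1 \<H>\<^sup>N\<close> on cosets, i.e. \<open>D\<^sub>p\<close> followed by
  \<open>\<zeta>\<^sup>l(p; \<epsilon>) \<otimes> X \<mapsto> c\<^sub>1\<^sub>,\<^sub>\<epsilon>\<^sub>,\<^sub>p X\<close>.\<close>

definition deriv_gr ::
    "('a::comm_ring_1, 'h::comm_ring_1) motivic_data \<Rightarrow> nat \<Rightarrow> nat \<Rightarrow> nat \<Rightarrow> 'h set \<Rightarrow> 'h set" where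
  "deriv_gr M N p r X =
     (\<Union>\<psi>\<in>{\<psi>. lie_coord M N p \<psi>}. \<Union>t\<in>D_gr M N p r X.
        depth_class M N (r - 1) (contract (scaleH M) \<psi> t))"

definition graded_Q_algebra :: "(rat \<Rightarrow> 'a \<Rightarrow> 'a) \<Rightarrow> (nat \<Rightarrow> 'a::comm_ring_1 set) \<Rightarrow> bool" where
  "graded_Q_algebra s W \<longleftrightarrow>
     vector_space s \<and> (\<forall>q a b. s q a * b = s q (a * b)) \<and>
     (\<forall>n. Modules.module.subspace s (W n)) \<and>
     (\<forall>m n. \<forall>a\<in>W m. \<forall>b\<in>W n. a * b \<in> W (m + n)) \<and>
     (\<forall>a. \<exists>!c. (\<forall>n. c n \<in> W n) \<and> finite {n. c n \<noteq> 0} \<and> a = (\<Sum>n | c n \<noteq> 0. c n)) \<and>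
     W 0 = range (\<lambda>q. s q 1)"

text \<open>Mixed Tate motives are not available, so the motivic objects are given through properties
  that they are known to have: the gradings, the projection, the period map and the coaction (the
  coproduct of \<open>\<A>\<^sup>N\<close> is not needed for \<open>D\<^sub>p\<close>), its compatibility with the depth filtration, the
  formulas for \<open>D\<^sub>p\<close> in depths one and two (Glanois), and the relations in \<open>gr\<^sub>1 \<L>\<^sup>N\<^sub>p\<close> for
  \<open>N = 2, 3\<close> (Deligne--Goncharov).\<close>

locale motivic_mzv =
  fixes N :: nat and M :: "('a::comm_ring_1, 'h::comm_ring_1) motivic_data"
  assumes algA: "graded_Q_algebra (scaleA M) (weightA M)"
    and algH: "graded_Q_algebra (scaleH M) (weightH M)"
    and projA_linear: "Vector_Spaces.linear (scaleH M) (scaleA M) (projA M)"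
    and projA_mult: "projA M (x * y) = projA M x * projA M y"
    and projA_one: "projA M 1 = 1"
    and projA_weight: "x \<in> weightH M n \<Longrightarrow> projA M x \<in> weightA M n"
    and projA_surj: "surj (projA M)"
    and zm_empty: "zm M [] [] = 1"
    and zm_weight: "admissible N ns es \<Longrightarrow> zm M ns es \<in> weightH M (sum_list ns)"
    and zm_span: "(\<Union>r. depth_lt M N r) = UNIV"
    and per_add: "per M (x + y) = per M x + per M y"
    and per_mult: "per M (x * y) = per M x * per M y"
    and per_scale: "per M (scaleH M q x) = of_rat q * per M x"
    and per_zm: "admissible N ns es \<Longrightarrow> per M (zm M ns es) = mzv ns es"
    and coact_linear: "Vector_Spaces.linear (scaleH M) tscale (coact M)"
    and coact_one: "coact M 1 = tensM M 1 1"
    and coact_mult: "coact M x = (\<Sum>(a, h)\<leftarrow>xs. tensM M a h) \<Longrightarrow>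
          coact M y = (\<Sum>(b, g)\<leftarrow>ys. tensM M b g) \<Longrightarrow>
          coact M (x * y) = (\<Sum>(a, h)\<leftarrow>xs. \<Sum>(b, g)\<leftarrow>ys. tensM M (a * b) (h * g))"
    and coact_weight: "x \<in> weightH M n \<Longrightarrow>
          coact M x \<in> tspan {tensM M a h | a h i j. i + j = n \<and> a \<in> weightA M i \<and> h \<in> weightH M j}"
    and coact_depth: "x \<in> depth_lt M N (r + 1) \<Longrightarrow>
          coact M x \<in> tspan {tensM M (projA M u) h | u h i j.
            i + j = r \<and> u \<in> depth_lt M N (i + 1) \<and> h \<in> depth_lt M N (j + 1)}"
    and D_depth1: "odd p \<Longrightarrow> p \<ge> 3 \<Longrightarrow> admissible N [n] [\<epsilon>] \<Longrightarrow>
          D_gr M N p 1 (depth_class M N 1 (zm M [n] [\<epsilon>])) =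
          tensor_class M N p 0 (if p = n then tensM M (projA M (zm M [p] [\<epsilon>])) 1 else 0)"
    and D_depth2: "odd p \<Longrightarrow> p \<ge> 3 \<Longrightarrow> admissible N [n1, n2] [\<epsilon>, inverse \<epsilon>] \<Longrightarrow>
          p + 2 \<le> n1 + n2 \<Longrightarrow>
          D_gr M N p 2 (depth_class M N 2 (zm M [n1, n2] [\<epsilon>, inverse \<epsilon>])) =
          tensor_class M N p 1
            ((if p = n1 then tensM M (projA M (zm M [p] [\<epsilon>])) (zm M [n2] [inverse \<epsilon>]) else 0) +
             tscale ((if n1 \<le> p then (-1) ^ n1 * of_nat ((p - 1) choose (p - n1)) else 0) +
                     (if n2 \<le> p then (-1) ^ (p - n2) * of_nat ((p - 1) choose (p - n2)) else 0))
               (tensM M (projA M (zm M [p] [inverse \<epsilon>])) (zm M [n1 + n2 - p] [1])))"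
    and lie_depth1: "odd p \<Longrightarrow> p \<ge> 3 \<Longrightarrow> \<epsilon> ^ N = 1 \<Longrightarrow>
          projA M (zm M [p] [\<epsilon>]) - scaleA M (lie_const N \<epsilon> p) (projA M (zm M [p] [1])) \<in> lie_ker M p"
    and lie_depth1_nonzero: "odd p \<Longrightarrow> p \<ge> 3 \<Longrightarrow> projA M (zm M [p] [1]) \<notin> lie_ker M p"


section \<open>The matrix\<close>

definition root_N :: "nat \<Rightarrow> complex" where
  "root_N N = exp (2 * of_real pi * \<i> / of_nat N)"

text \<open>As \<open>\<D>\<^sub>-\<^sub>1 = 0\<close> and the total weight is \<open>0\<close>, the result in \<open>gr\<^sub>0\<close> is the class of a unique
  rational multiple of \<open>1\<close>.\<close>

definition C_entry ::
    "('a::comm_ring_1, 'h::comm_ring_1) motivic_data \<Rightarrow> nat \<Rightarrow> nat \<times> nat \<Rightarrow> nat \<times> nat \<Rightarrow> rat" where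
  "C_entry M N = (\<lambda>(m1, m2) (n1, n2). THE q.
     deriv_gr M N m2 1 (deriv_gr M N m1 2
       (depth_class M N 2 (zm M [n1, n2] [root_N N, inverse (root_N N)]))) =
     depth_class M N 0 (scaleH M q 1))"

definition C_matrix ::
    "('a::comm_ring_1, 'h::comm_ring_1) motivic_data \<Rightarrow> nat \<Rightarrow> int \<Rightarrow> complex mat" where
  "C_matrix M N k =
     mat (length (odd_pairs k)) (length (odd_pairs_rev k)) (\<lambda>(i, j). of_rat (C_entry M N (odd_pairs k ! i) (odd_pairs_rev k ! j)))"

end

theory Submission
  imports Defs "HOL-Real_Asymp.Real_Asymp"
begin

text \<open>Let \<open>w = k - 2\<close> and let \<open>E(z; x, y)\<close> be the integral of \<open>f(\<tau>) (\<tau> y - x)\<^sup>w\<close> from \<open>z\<close> to \<open>i\<infinity>\<close>.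
  It is equivariant under \<open>z \<mapsto> z + 1\<close>, and under \<open>z \<mapsto> -1/z\<close> up to the period polynomial \<open>r\<close>. As a
  Hecke operator acts on \<open>E\<close> by the matrices \<open>(p 0; 0 1)\<close> and \<open>(1 j; 0 p)\<close>, comparing both sides at
  \<open>z = i\<close> gives, for \<open>p = 2, 3\<close>, its action on \<open>r\<close>, e.g.
  \<open>\<lambda>\<^sub>2 r(x, y) = r(2x, y) + r(x, 2y) + r(x + y, 2y) + r(2x, x + y)\<close> on the even part. On the motivic side,
  \<open>\<partial>\<^sub>m\<^sub>2 \<partial>\<^sub>m\<^sub>1\<close> produces binomial coefficients times powers of \<open>1/N\<close>, so that \<open>v\<^sub>f C\<close> is the coefficient vector
  of the last two terms, corrected by the three term relation of \<open>r\<close>.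

  If \<open>v\<^sub>f = 0\<close>, then the even part of \<open>r\<close> is a multiple of the coboundary \<open>x\<^sup>w - y\<^sup>w\<close>. Up to a constant, the
  even part of \<open>E(z; z, 1)\<close> is then modular of weight \<open>-w\<close>, so it tends to \<open>0\<close> at the real line.
  Comparing Fourier coefficients of positive index gives \<open>E(z; z, 1) = 0\<close> and hence \<open>f = 0\<close>.\<close>


section \<open>Periodic functions on the upper half plane\<close>

text \<open>The matrix entries carry the factor \<open>lie_const\<close>, which is N^(-n) - 1 with n
  = m1 - 1, halved for N = 3. Its power N^(-n) turns the binomial differences into coefficients of
  the last Hecke terms, its -1 into those of the three term relation. The product of two such
  factors, present only for m1 = n1, meets a coefficient of opposite sign because the even part is
  antisymmetric. It cancels the powers N^(w-j) + N^j from the first two Hecke terms, so that a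
  scalar remains. For N = 3 the last terms occur twice, exchanged by y -> -y; this and the halving
  of \<open>lie_const\<close> make the 4 in the eigenvalue. What singles out p = 2, 3 is that 0, 1,
  -1 represent all residues: for s = (i - 1)/p one has p s + 1 = i, so s/(p s + 1) = (i + 1)/p, and
  lower triangular matrices with translations connect the points j = 1, -1 of the Hecke sum at i. An
  eigenvector must be nonzero. Weight at most 0 and weight 2 lie outside the coboundary argument and
  are handled by the maximum principle.\<close>

abbreviation uhp :: "complex set" where "uhp \<equiv> {z. Im z > 0}"

lemma uhp_open [simp]: "open uhp" and uhp_convex [simp]: "convex uhp"
  and uhp_connected [simp]: "connected uhp"
proof -
  show "convex uhp" by (rule convex_halfspace_Im_gt)
  then show "connected uhp" by (rule convex_connected)
qed (rule open_halfspace_Im_gt)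

lemma Im_minus_inverse: "Im (- 1 / z) = Im z / (cmod z)\<^sup>2"
  by (simp add: Im_divide cmod_power2)

lemma Im_minus_inverse_pos: "Im z > 0 \<Longrightarrow> Im (- 1 / z) > 0"
  by (subst Im_minus_inverse, rule divide_pos_pos) auto

lemma periodic_int:
  fixes h :: "complex \<Rightarrow> 'a"
  assumes per: "\<And>z. Im z > 0 \<Longrightarrow> h (z + 1) = h z" and "Im z > 0"
  shows "h (z + of_int n) = h z"
proof (induction n rule: int_induct[where k = 0])
  case (step1 i)
  then show ?case using per[of "z + of_int i"] assms(2) by (simp add: algebra_simps)
next
  case (step2 i)
  then show ?case using per[of "z + of_int (i - 1)"] assms(2) by (simp add: algebra_simps)
qed simp

text \<open>A logarithm of q is determined up to multiples of 2 pi i, and periodicity makes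
  \<open>h\<close> blind to the choice. So \<open>g\<close> is holomorphic off 0, and the limit at
  the cusp makes it continuous, hence holomorphic, at 0.\<close>

lemma q_expansion:
  assumes hol: "h holomorphic_on uhp"
    and per: "\<And>z. Im z > 0 \<Longrightarrow> h (z + 1) = h z"
    and lim: "(h \<longlongrightarrow> 0) (filtercomap Im at_top)"
  obtains g where "g holomorphic_on ball 0 1" "g 0 = 0"
    "\<And>z. Im z > 0 \<Longrightarrow> h z = g (exp (2 * of_real pi * \<i> * z))"
proof -
  define c where "c = 2 * of_real pi * \<i>"
  have c0: "c \<noteq> 0" by (simp add: c_def)
  have Imc: "Im (l / c) = - Re l / (2 * pi)" for l
    by (simp add: c_def Im_divide power2_eq_square)
  define g where "g q = (if q = 0 then 0 else h (Ln q / c))" for q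
  have glocal: "g q = h (l / c)" if "exp l = q" "cmod q < 1" for l q
  proof -
    have q0: "q \<noteq> 0" using that(1) exp_not_eq_zero by blast
    have "exp l = exp (Ln q)" using q0 that by simp
    then obtain n :: int where n: "l = Ln q + of_int (2 * n) * of_real pi * \<i>"
      using exp_eq by auto
    have "l / c = Ln q / c + of_int n"
      using c0 by (simp add: n field_simps) (simp add: c_def)
    moreover have "Im (Ln q / c) > 0"
      using q0 that(2) by (simp add: Imc divide_simps)
    ultimately show ?thesis using periodic_int[of h, OF per] q0 by (simp add: g_def)
  qed
  have hg: "h z = g (exp (2 * of_real pi * \<i> * z))" if "Im z > 0" for z
    using glocal[of "c * z"] that c0 by (simp add: c_def norm_exp)
  have diff: "g field_differentiable (at q0)" if q0: "q0 \<in> ball 0 1 - {0}" for q0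
  proof -
    \<comment> \<open>A branch of the logarithm that is holomorphic near \<open>q0\<close> even if
      \<open>q0\<close> is a negative real: on \<open>S\<close> the quotient \<open>q / q0\<close>
      stays in the right half plane.\<close>
    define L where "L q = Ln (q / q0) + Ln q0" for q
    define S where "S = ball q0 (cmod q0) \<inter> ball 0 1"
    have S: "open S" "q0 \<in> S" using q0 by (auto simp: S_def)
    have re: "Re (q / q0) > 0" if "q \<in> S" for q
    proof -
      have "cmod (1 - q / q0) = cmod (q0 - q) / cmod q0"
        using q0 by (simp add: diff_divide_distrib flip: norm_divide)
      also have "\<dots> < 1" using that q0 by (auto simp: S_def dist_norm divide_simps)
      finally have "\<bar>Re (1 - q / q0)\<bar> < 1" using abs_Re_le_cmod order_le_less_trans by blast
      then show ?thesis by simp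
    qed
    have nz: "q / q0 \<notin> \<real>\<^sub>\<le>\<^sub>0" if "q \<in> S" for q
      using re[OF that] by (auto simp: complex_nonpos_Reals_iff)
    have eL: "exp (L q) = q" if "q \<in> S" for q
    proof -
      have "exp (Ln (q / q0)) = q / q0" using re[OF that] by (intro exp_Ln) auto
      then show ?thesis using q0 by (simp add: L_def exp_add)
    qed
    have pos: "Im (L q / c) > 0" if "q \<in> S" for q
    proof -
      have "exp (Re (L q)) = cmod q" using eL[OF that] by (metis norm_exp_eq_Re)
      also have "\<dots> < 1" using that by (auto simp: S_def)
      finally show ?thesis by (simp add: Imc divide_simps)
    qed
    have "(\<lambda>q. h (L q / c)) holomorphic_on S"
    proof -
      have "(\<lambda>q. L q / c) holomorphic_on S"
        unfolding L_def using nz q0 c0 by (intro holomorphic_intros) auto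
      then have "(h \<circ> (\<lambda>q. L q / c)) holomorphic_on S"
        by (rule holomorphic_on_compose_gen[OF _ hol]) (use pos in auto)
      then show ?thesis by (simp add: o_def)
    qed
    then have "g holomorphic_on S"
    proof (rule holomorphic_transform)
      show "h (L q / c) = g q" if "q \<in> S" for q
        using glocal[OF eL[OF that]] that by (auto simp: S_def)
    qed
    then show ?thesis using S holomorphic_on_imp_differentiable_at by blast
  qed
  have cont0: "isCont g 0"
    unfolding continuous_at_eps_delta
  proof (intro allI impI)
    fix e :: real assume "e > 0"
    then obtain Y where Y: "\<And>z. Im z \<ge> Y \<Longrightarrow> cmod (h z) < e"
      using tendstoD[OF lim] by (auto simp: eventually_filtercomap_at_top_linorder)
    show "\<exists>d>0. \<forall>x'. dist x' 0 < d \<longrightarrow> dist (g x') (g 0) < e"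
    proof (intro exI[of _ "exp (- 2 * pi * Y)"] conjI allI impI)
      fix q :: complex assume q: "dist q 0 < exp (- 2 * pi * Y)"
      show "dist (g q) (g 0) < e"
      proof (cases "q = 0")
        case False
        then have "ln (cmod q) < - 2 * pi * Y"
          using q by (metis dist_0_norm dist_commute exp_less_cancel_iff exp_ln zero_less_norm_iff)
        then have "Im (Ln q / c) \<ge> Y" using False by (simp add: Imc divide_simps mult.commute)
        then show ?thesis using False Y by (simp add: g_def)
      qed (use \<open>e > 0\<close> in simp)
    qed simp
  qed
  have "g holomorphic_on ball 0 1"
  proof (rule no_isolated_singularity[where K = "{0}"])
    show "continuous_on (ball 0 1) g"
      using cont0 diff field_differentiable_imp_continuous_at
      by (intro continuous_at_imp_continuous_on) blast
    show "g holomorphic_on ball 0 1 - {0}"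
      using diff by (auto simp: holomorphic_on_open open_delete field_differentiable_def)
  qed auto
  moreover have "g 0 = 0" by (simp add: g_def)
  ultimately show ?thesis using hg that by blast
qed

text \<open>Since \<open>g 0 = 0\<close> and the derivative of \<open>g\<close> is bounded on a
  smaller closed disc, \<open>g q\<close> is at most a multiple of the modulus of q. The height 1/2
  is the one from which \<open>uhp_descent\<close> starts.\<close>

lemma cuspidal_exp_decay:
  assumes "h holomorphic_on uhp"
    and "\<And>z. Im z > 0 \<Longrightarrow> h (z + 1) = h z"
    and "(h \<longlongrightarrow> 0) (filtercomap Im at_top)"
  obtains C where "C > 0" "\<And>z. Im z \<ge> 1 / 2 \<Longrightarrow> cmod (h z) \<le> C * exp (- 2 * pi * Im z)"
proof -
  obtain g where g: "g holomorphic_on ball 0 1" "g 0 = 0"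
    and hg: "\<And>z. Im z > 0 \<Longrightarrow> h z = g (exp (2 * of_real pi * \<i> * z))"
    using q_expansion[OF assms] by blast
  \<comment> \<open>The modulus of q at height 1/2.\<close>
  define r where "r = exp (- pi)"
  have r: "r < 1" "r > 0" by (auto simp: r_def)
  have dg: "deriv g holomorphic_on ball 0 1" using g by (intro holomorphic_deriv) auto
  then have "continuous_on (cball 0 r) (deriv g)"
    by (rule holomorphic_on_imp_continuous_on[OF holomorphic_on_subset]) (use r in auto)
  then have "compact (deriv g ` cball 0 r)" by (intro compact_continuous_image) auto
  then obtain B where B: "B > 0" "\<And>q. q \<in> cball 0 r \<Longrightarrow> cmod (deriv g q) \<le> B"
    by (auto dest!: compact_imp_bounded simp: bounded_pos)
  have "cmod (g q) \<le> B * cmod q" if "q \<in> cball 0 r" for q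
  proof -
    have "cmod (g q - g 0) \<le> B * cmod (q - 0)"
    proof (rule field_differentiable_bound[of "cball 0 r" g "deriv g"])
      show "(g has_field_derivative deriv g z) (at z within cball 0 r)" if "z \<in> cball 0 r" for z
        using that r g by (intro has_field_derivative_at_within[OF holomorphic_derivI[of g "ball 0 1"]]) auto
    qed (use B that r in auto)
    then show ?thesis by (simp add: g)
  qed
  note gb = this
  show ?thesis
  proof (rule that[OF B(1)])
    fix z assume z: "Im z \<ge> 1 / 2"
    have n: "cmod (exp (2 * of_real pi * \<i> * z)) = exp (- 2 * pi * Im z)" by (simp add: norm_exp_eq_Re)
    have "exp (- 2 * pi * Im z) \<le> r" using z by (simp add: r_def)
    then show "cmod (h z) \<le> B * exp (- 2 * pi * Im z)"
      using gb[of "exp (2 * of_real pi * \<i> * z)"] hg[of z] z n by simp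
  qed
qed

lemma pow_le_fact_exp: "(x::real) \<ge> 0 \<Longrightarrow> x ^ n \<le> fact n * exp x"
proof -
  assume x: "x \<ge> 0"
  have "x ^ n / fact n \<le> exp x"
  proof -
    have s: "(\<lambda>n. x ^ n / fact n) sums exp x" using exp_converges[of x] by (simp add: field_simps scaleR_conv_of_real)
    have "(\<Sum>i\<in>{n}. x ^ i / fact i) \<le> (\<Sum>i. x ^ i / fact i)"
      by (rule sum_le_suminf) (use s x in \<open>auto simp: sums_iff\<close>)
    then show ?thesis using s by (simp add: sums_iff)
  qed
  then show ?thesis by (simp add: field_simps)
qed

text \<open>Powers of z are not periodic, hence the restriction to vertical strips. The power costs
  a factor exp (Im z), and 2 pi >= 2 still leaves exp (- Im z).\<close>

lemma exp_decay_times_poly: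
  assumes C: "C > 0" and h: "\<And>z. Im z \<ge> 1 / 2 \<Longrightarrow> cmod (h z) \<le> C * exp (- 2 * pi * Im z)"
    and R: "R \<ge> 0"
  shows "\<exists>C'>0. \<forall>z. Im z \<ge> 1 / 2 \<longrightarrow> \<bar>Re z\<bar> \<le> R \<longrightarrow> cmod (h z * z ^ n) \<le> C' * exp (- Im z)"
proof (intro exI[of _ "C * (fact n * exp R)"] conjI allI impI)
  fix z assume z: "Im z \<ge> 1 / 2" "\<bar>Re z\<bar> \<le> R"
  have "cmod z \<le> R + Im z" using cmod_le[of z] z by linarith
  then have "cmod z ^ n \<le> (R + Im z) ^ n" by (intro power_mono) auto
  also have "\<dots> \<le> fact n * exp (R + Im z)" using R z by (intro pow_le_fact_exp) auto
  finally have zn: "cmod z ^ n \<le> fact n * exp (R + Im z)" .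
  have "cmod (h z * z ^ n) \<le> (C * exp (- 2 * pi * Im z)) * (fact n * exp (R + Im z))"
    unfolding norm_mult norm_power using h[OF z(1)] zn C by (intro mult_mono) auto
  also have "\<dots> = C * (fact n * exp R) * exp (Im z - 2 * pi * Im z)"
    by (simp add: exp_add exp_diff exp_minus field_simps)
  also have "\<dots> \<le> C * (fact n * exp R) * exp (- Im z)"
  proof (intro mult_left_mono)
    have "1 * Im z \<le> pi * Im z" using pi_gt3 z by (intro mult_right_mono) auto
    then show "exp (Im z - 2 * pi * Im z) \<le> exp (- Im z)" by simp
  qed (use C in auto)
  finally show "cmod (h z * z ^ n) \<le> C * (fact n * exp R) * exp (- Im z)" .
qed (use C in auto)

text \<open>The sign makes \<open>E z\<close> the integral of \<open>F\<close> from z to i infinity.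
  A primitive on the convex domain is normalised by its limit along the imaginary axis, and a
  horizontal estimate carries the decay from the axis across the strip.\<close>

lemma decaying_primitive:
  assumes hol: "F holomorphic_on uhp"
    and bd: "\<And>R. R \<ge> 0 \<Longrightarrow> \<exists>C>0. \<forall>z. Im z \<ge> 1 / 2 \<longrightarrow> \<bar>Re z\<bar> \<le> R \<longrightarrow> cmod (F z) \<le> C * exp (- Im z)"
  shows "\<exists>E. (\<forall>z. Im z > 0 \<longrightarrow> (E has_field_derivative - F z) (at z)) \<and>
    (\<forall>R\<ge>0. \<exists>C>0. \<forall>z. Im z \<ge> 1 / 2 \<longrightarrow> \<bar>Re z\<bar> \<le> R \<longrightarrow> cmod (E z) \<le> C * exp (- Im z))"
proof -
  have "(\<lambda>z. - F z) holomorphic_on uhp" using hol by (intro holomorphic_intros)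
  then obtain G where "\<And>z. z \<in> uhp \<Longrightarrow> (G has_field_derivative - F z) (at z within uhp)"
    using holomorphic_convex_primitive'[OF uhp_convex uhp_open] by metis
  then have G: "(G has_field_derivative - F z) (at z)" if "Im z > 0" for z
    using that at_within_open[OF _ uhp_open, of z] by fastforce
  obtain C0 where C0: "C0 > 0" "\<And>z. Im z \<ge> 1 / 2 \<Longrightarrow> Re z = 0 \<Longrightarrow> cmod (F z) \<le> C0 * exp (- Im z)"
    using bd[of 0] by auto
  have vert: "cmod (G (\<i> * of_real b) - G (\<i> * of_real a)) \<le> C0 * exp (- a)"
    if ab: "1 / 2 \<le> a" "a < b" for a b
  proof -
    define G1 where "G1 t = G (\<i> * of_real t)" for t :: real
    have G1: "(G1 has_vector_derivative \<i> * (- F (\<i> * of_real t))) (at t)" if "t > 0" for t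
    proof -
      have "((\<lambda>t. \<i> * of_real t) has_vector_derivative \<i>) (at t)"
        by (auto intro!: derivative_eq_intros)
      from field_vector_diff_chain_at[OF this, of G "- F (\<i> * of_real t)"] G[of "\<i> * of_real t"] that
      show ?thesis by (simp add: o_def G1_def[abs_def])
    qed
    have "norm (G1 b - G1 a) \<le> - C0 * exp (- b) - (- C0 * exp (- a))"
    proof (rule differentiable_bound_general[where f' = "\<lambda>t. \<i> * (- F (\<i> * of_real t))" and \<phi>' = "\<lambda>t. C0 * exp (- t)"])
      show "continuous_on {a..b} G1"
        using G1 ab by (intro continuous_at_imp_continuous_on ballI has_vector_derivative_continuous[OF G1]) auto
      show "((\<lambda>b. - C0 * exp (- b)) has_vector_derivative C0 * exp (- x)) (at x)" for x
        by (auto intro!: derivative_eq_intros simp flip: has_real_derivative_iff_has_vector_derivative)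
      show "norm (\<i> * (- F (\<i> * of_real t))) \<le> C0 * exp (- t)" if "a < t" for t
        using C0(2)[of "\<i> * of_real t"] ab that by (simp add: norm_mult)
    qed (use ab G1 in \<open>auto intro!: continuous_intros\<close>)
    also have "\<dots> \<le> C0 * exp (- a)" using C0 by simp
    finally show ?thesis by (simp add: G1_def)
  qed
  have "Cauchy (\<lambda>n. G (\<i> * of_real (real n + 1)))"
  proof (rule metric_CauchyI)
    fix e :: real assume e: "e > 0"
    have "((\<lambda>n. C0 * exp (- (real n + 1))) \<longlongrightarrow> 0) sequentially" by real_asymp
    then obtain M where M: "\<And>n. n \<ge> M \<Longrightarrow> C0 * exp (- (real n + 1)) < e"
      using order_tendstoD(2)[of _ 0 sequentially e] e by (auto simp: eventually_sequentially)
    have *: "dist (G (\<i> * of_real (real m + 1))) (G (\<i> * of_real (real n + 1))) < e"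
      if "n \<ge> M" "m > n" for m n
      using vert[of "real n + 1" "real m + 1"] M[of n] that by (simp only: dist_norm) force
    show "\<exists>M. \<forall>m\<ge>M. \<forall>n\<ge>M. dist (G (\<i> * of_real (real m + 1))) (G (\<i> * of_real (real n + 1))) < e"
      using * e by (intro exI[of _ M]) (metis dist_commute dist_self linorder_neqE_nat)
  qed
  then obtain L where L: "(\<lambda>n. G (\<i> * of_real (real n + 1))) \<longlonglongrightarrow> L"
    by (auto simp: Cauchy_convergent_iff convergent_def)
  have vertL: "cmod (L - G (\<i> * of_real a)) \<le> C0 * exp (- a)" if "a \<ge> 1 / 2" for a
  proof (rule tendsto_upperbound)
    show "((\<lambda>n. cmod (G (\<i> * of_real (real n + 1)) - G (\<i> * of_real a))) \<longlongrightarrow> cmod (L - G (\<i> * of_real a))) sequentially"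
      by (intro tendsto_intros L)
    have "eventually (\<lambda>n. real n + 1 > a) sequentially" by real_asymp
    then show "\<forall>\<^sub>F n in sequentially. cmod (G (\<i> * of_real (real n + 1)) - G (\<i> * of_real a)) \<le> C0 * exp (- a)"
      by eventually_elim (intro vert that)
  qed auto
  show ?thesis
  proof (intro exI[of _ "\<lambda>z. G z - L"] conjI allI impI)
    fix z assume "Im z > 0"
    then show "((\<lambda>z. G z - L) has_field_derivative - F z) (at z)"
      by (auto intro!: derivative_eq_intros G)
  next
    fix R :: real assume R: "R \<ge> 0"
    obtain C where C: "C > 0" "\<And>z. Im z \<ge> 1 / 2 \<Longrightarrow> \<bar>Re z\<bar> \<le> R \<Longrightarrow> cmod (F z) \<le> C * exp (- Im z)"
      using bd[OF R] by auto
    show "\<exists>C>0. \<forall>z. Im z \<ge> 1 / 2 \<longrightarrow> \<bar>Re z\<bar> \<le> R \<longrightarrow> cmod (G z - L) \<le> C * exp (- Im z)"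
    proof (intro exI[of _ "C * R + C0"] conjI allI impI)
      fix z assume z: "Im z \<ge> 1 / 2" "\<bar>Re z\<bar> \<le> R"
      define S where "S = {u. Im u = Im z \<and> \<bar>Re u\<bar> \<le> R}"
      have conv: "convex S"
      proof -
        have "S = {u. Im u \<le> Im z} \<inter> {u. Im u \<ge> Im z} \<inter> {u. Re u \<le> R} \<inter> {u. Re u \<ge> - R}"
          by (auto simp: S_def)
        then show ?thesis
          by (simp only:) (intro convex_Int convex_halfspace_Re_le convex_halfspace_Re_ge
            convex_halfspace_Im_le convex_halfspace_Im_ge)
      qed
      have "cmod (G z - G (\<i> * of_real (Im z))) \<le> (C * exp (- Im z)) * cmod (z - \<i> * of_real (Im z))"
        using conv
      proof (rule field_differentiable_bound[where f' = "\<lambda>z. - F z"])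
        show "(G has_field_derivative - F u) (at u within S)" if "u \<in> S" for u
          using that z by (intro has_field_derivative_at_within[OF G]) (auto simp: S_def)
        show "cmod (- F u) \<le> C * exp (- Im z)" if "u \<in> S" for u
          using C(2)[of u] that z by (auto simp: S_def)
      qed (use z R in \<open>auto simp: S_def\<close>)
      also have "z - \<i> * of_real (Im z) = of_real (Re z)" by (simp add: complex_eq_iff)
      also have "(C * exp (- Im z)) * cmod (of_real (Re z)) \<le> (C * exp (- Im z)) * R"
        using z C by (intro mult_left_mono) auto
      finally have h: "cmod (G z - G (\<i> * of_real (Im z))) \<le> (C * R) * exp (- Im z)"
        by (simp add: mult_ac)
      have "cmod (G z - L) \<le> cmod (G z - G (\<i> * of_real (Im z))) + cmod (L - G (\<i> * of_real (Im z)))"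
        using norm_triangle_ineq4[of "G z - G (\<i> * of_real (Im z))" "L - G (\<i> * of_real (Im z))"] by simp
      then show "cmod (G z - L) \<le> (C * R + C0) * exp (- Im z)"
        using h vertL[OF z(1)] by (simp add: algebra_simps)
    qed (use C C0 R in \<open>auto intro: add_nonneg_pos\<close>)
  qed
qed

text \<open>Identities between Eichler integrals are obtained by applying this to the difference of
  the two sides.\<close>

lemma eq_0_if_deriv_0_and_vanishing_limit:
  assumes d: "\<And>z. Im z > 0 \<Longrightarrow> (D has_field_derivative 0) (at z)"
    and lim: "((\<lambda>t::real. D (\<i> * of_real t)) \<longlongrightarrow> 0) at_top" and z: "Im z > 0"
  shows "D z = 0"
proof -
  have "\<exists>c. \<forall>z\<in>uhp. D z = c"
    using d by (intro has_field_derivative_zero_constant has_field_derivative_at_within[OF d]) auto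
  then obtain c where c: "\<And>z. Im z > 0 \<Longrightarrow> D z = c" by auto
  have "((\<lambda>t::real. D (\<i> * of_real t)) \<longlongrightarrow> c) at_top"
  proof (rule tendsto_eventually)
    show "\<forall>\<^sub>F t in at_top. D (\<i> * of_real t) = c"
      using eventually_gt_at_top[of "0::real"] by eventually_elim (auto intro: c)
  qed
  then have "c = 0" using lim tendsto_unique trivial_limit_at_top_linorder by blast
  then show ?thesis using c z by simp
qed


section \<open>The Eichler integral\<close>

lemma cusp_form_hol: "cusp_form k f \<Longrightarrow> f holomorphic_on uhp"
  and cusp_form_lim: "cusp_form k f \<Longrightarrow> (f \<longlongrightarrow> 0) (filtercomap Im at_top)"
  by (auto simp: cusp_form_def)

lemma cusp_form_modular:
  assumes "cusp_form k f" "a * d - b * c = 1" "Im z > 0"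
  shows "f ((of_int a * z + of_int b) / (of_int c * z + of_int d)) = (of_int c * z + of_int d) powi k * f z"
  using assms unfolding cusp_form_def by blast

lemma cusp_form_T: "cusp_form k f \<Longrightarrow> Im z > 0 \<Longrightarrow> f (z + 1) = f z"
  using cusp_form_modular[of k f 1 1 1 0 z] by simp

lemma cusp_form_S: "cusp_form k f \<Longrightarrow> Im z > 0 \<Longrightarrow> f (- 1 / z) = z powi k * f z"
  using cusp_form_modular[of k f 0 0 "-1" 1 z] by simp

text \<open>The bound on the weight makes k - 2 a natural number; even weights below it are covered
  by \<open>cusp_form_nonpos_weight_eq_0\<close>.\<close>

locale even_cusp_form =
  fixes k :: int and f :: "complex \<Rightarrow> complex"
  assumes cusp: "cusp_form k f" and even_k: "even k" and k_ge_2: "k \<ge> 2"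
begin

definition w :: nat where "w = nat (k - 2)"

lemma even_w: "even w" and k_eq: "k = int w + 2"
  using even_k k_ge_2 by (auto simp: w_def even_nat_iff)

lemma f_T: "Im z > 0 \<Longrightarrow> f (z + of_int n) = f z"
  using periodic_int cusp_form_T[OF cusp] by blast

lemma f_S: "Im z > 0 \<Longrightarrow> f (- 1 / z) = z ^ (w + 2) * f z"
proof -
  have "k = int (w + 2)" using k_eq by simp
  then have "z powi k = z ^ (w + 2)" by (metis power_int_of_nat)
  then show "Im z > 0 \<Longrightarrow> f (- 1 / z) = z ^ (w + 2) * f z" using cusp_form_S[OF cusp, of z] by simp
qed

lemma powi_k_minus: "z powi (k - 1) = z ^ (w + 1)" "z powi (k - 2) = z ^ w"
proof -
  have "k - 1 = int (w + 1)" "k - 2 = int w" using k_eq by simp_all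
  then show "z powi (k - 1) = z ^ (w + 1)" "z powi (k - 2) = z ^ w" by (metis power_int_of_nat)+
qed

lemma f_moment_decay:
  assumes "R \<ge> 0"
  shows "\<exists>C>0. \<forall>z. Im z \<ge> 1 / 2 \<longrightarrow> \<bar>Re z\<bar> \<le> R \<longrightarrow> cmod (f z * z ^ n) \<le> C * exp (- Im z)"
proof -
  obtain C where "C > 0" "\<And>z. Im z \<ge> 1 / 2 \<Longrightarrow> cmod (f z) \<le> C * exp (- 2 * pi * Im z)"
    using cuspidal_exp_decay[OF cusp_form_hol[OF cusp] cusp_form_T[OF cusp] cusp_form_lim[OF cusp]]
    by blast
  then show ?thesis using exp_decay_times_poly assms by blast
qed

text \<open>\<open>Em n z\<close> is the integral of f(tau) tau^n from z to i infinity. Choosing a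
  decaying primitive gives its derivative and its decay at once.\<close>

definition Em :: "nat \<Rightarrow> complex \<Rightarrow> complex" where
  "Em n = (SOME E. (\<forall>z. Im z > 0 \<longrightarrow> (E has_field_derivative - (f z * z ^ n)) (at z)) \<and>
    (\<forall>R\<ge>0. \<exists>C>0. \<forall>z. Im z \<ge> 1 / 2 \<longrightarrow> \<bar>Re z\<bar> \<le> R \<longrightarrow> cmod (E z) \<le> C * exp (- Im z)))"

lemma Em_deriv: "Im z > 0 \<Longrightarrow> (Em n has_field_derivative - (f z * z ^ n)) (at z)"
  and Em_decay: "R \<ge> 0 \<Longrightarrow>
    \<exists>C>0. \<forall>z. Im z \<ge> 1 / 2 \<longrightarrow> \<bar>Re z\<bar> \<le> R \<longrightarrow> cmod (Em n z) \<le> C * exp (- Im z)"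
proof -
  have "(\<lambda>z. f z * z ^ n) holomorphic_on uhp"
    using cusp_form_hol[OF cusp] by (intro holomorphic_intros)
  from someI_ex[OF decaying_primitive[OF this f_moment_decay]]
  show "Im z > 0 \<Longrightarrow> (Em n has_field_derivative - (f z * z ^ n)) (at z)"
    and "R \<ge> 0 \<Longrightarrow>
    \<exists>C>0. \<forall>z. Im z \<ge> 1 / 2 \<longrightarrow> \<bar>Re z\<bar> \<le> R \<longrightarrow> cmod (Em n z) \<le> C * exp (- Im z)"
    by (auto simp: Em_def)
qed

text \<open>The Eichler integral of \<open>f(\<tau>) (\<tau> y - x)\<^sup>w d\<tau>\<close> from \<open>z\<close> to \<open>i\<infinity>\<close>.\<close>

definition EI :: "complex \<Rightarrow> complex \<Rightarrow> complex \<Rightarrow> complex" where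
  "EI z x y = (\<Sum>n\<le>w. of_nat (w choose n) * y ^ n * (- x) ^ (w - n) * Em n z)"

lemma EI_deriv:
  assumes "Im z > 0"
  shows "((\<lambda>z. EI z x y) has_field_derivative - (f z * (z * y - x) ^ w)) (at z)"
proof -
  have "((\<lambda>z. EI z x y) has_field_derivative
      (\<Sum>n\<le>w. of_nat (w choose n) * y ^ n * (- x) ^ (w - n) * - (f z * z ^ n))) (at z)"
    unfolding EI_def by (intro DERIV_sum DERIV_cmult Em_deriv assms)
  also have "(\<Sum>n\<le>w. of_nat (w choose n) * y ^ n * (- x) ^ (w - n) * - (f z * z ^ n)) =
      (\<Sum>n\<le>w. (- f z) * (of_nat (w choose n) * (z * y) ^ n * (- x) ^ (w - n)))"
    by (rule sum.cong) (auto simp: power_mult_distrib)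
  also have "\<dots> = - (f z * (z * y + - x) ^ w)"
    unfolding binomial_ring sum_distrib_left[symmetric] by simp
  finally show ?thesis by simp
qed

lemma EI_decay:
  assumes "R \<ge> 0"
  shows "\<exists>C>0. \<forall>z. Im z \<ge> 1 / 2 \<longrightarrow> \<bar>Re z\<bar> \<le> R \<longrightarrow> cmod (EI z x y) \<le> C * exp (- Im z)"
proof -
  obtain C where C: "\<And>n. C n > 0"
    "\<And>n z. Im z \<ge> 1 / 2 \<Longrightarrow> \<bar>Re z\<bar> \<le> R \<Longrightarrow> cmod (Em n z) \<le> C n * exp (- Im z)"
    using Em_decay[OF assms] by metis
  define K where "K n = cmod (of_nat (w choose n) * y ^ n * (- x) ^ (w - n))" for n
  show ?thesis
  proof (intro exI[of _ "(\<Sum>n\<le>w. K n * C n) + 1"] conjI allI impI)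
    have "(\<Sum>n\<le>w. K n * C n) \<ge> 0"
      by (intro sum_nonneg mult_nonneg_nonneg) (use C(1) less_imp_le in \<open>auto simp: K_def\<close>)
    then show "(\<Sum>n\<le>w. K n * C n) + 1 > 0" by simp
    fix z assume z: "Im z \<ge> 1 / 2" "\<bar>Re z\<bar> \<le> R"
    have "cmod (EI z x y) \<le> (\<Sum>n\<le>w. cmod (of_nat (w choose n) * y ^ n * (- x) ^ (w - n) * Em n z))"
      unfolding EI_def by (rule norm_sum)
    also have "\<dots> \<le> (\<Sum>n\<le>w. K n * (C n * exp (- Im z)))"
    proof (rule sum_mono)
      fix n
      show "cmod (of_nat (w choose n) * y ^ n * (- x) ^ (w - n) * Em n z) \<le> K n * (C n * exp (- Im z))"
        unfolding norm_mult[of _ "Em n z"] K_def using C(2)[OF z] by (intro mult_left_mono) auto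
    qed
    also have "\<dots> = (\<Sum>n\<le>w. K n * C n) * exp (- Im z)" by (simp only: sum_distrib_right mult.assoc)
    also have "\<dots> \<le> ((\<Sum>n\<le>w. K n * C n) + 1) * exp (- Im z)" by (simp add: algebra_simps)
    finally show "cmod (EI z x y) \<le> ((\<Sum>n\<le>w. K n * C n) + 1) * exp (- Im z)" .
  qed
qed

text \<open>The scale \<open>c\<close> and the offset \<open>a\<close> cover the images of the
  imaginary axis under the Hecke substitutions p z and (z + j)/p.\<close>

lemma EI_tendsto:
  assumes c: "c > 0"
  shows "((\<lambda>t. EI (\<i> * of_real (c * t) + of_real a) x y) \<longlongrightarrow> 0) at_top"
proof -
  obtain C where C: "C > 0" "\<And>z. Im z \<ge> 1 / 2 \<Longrightarrow> \<bar>Re z\<bar> \<le> \<bar>a\<bar> \<Longrightarrow> cmod (EI z x y) \<le> C * exp (- Im z)"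
    using EI_decay[of "\<bar>a\<bar>" x y] by auto
  show ?thesis
  proof (rule Lim_null_comparison)
    have "eventually (\<lambda>t. c * t \<ge> 1 / 2) at_top" using c by real_asymp
    then show "\<forall>\<^sub>F t in at_top. cmod (EI (\<i> * of_real (c * t) + of_real a) x y) \<le> C * exp (- (c * t))"
    proof eventually_elim
      case (elim t)
      then show ?case using C(2)[of "\<i> * of_real (c * t) + of_real a"] by simp
    qed
    show "((\<lambda>t. C * exp (- (c * t))) \<longlongrightarrow> 0) at_top" using c by real_asymp
  qed
qed

lemma EI_scale: "EI z (c * x) (c * y) = c ^ w * EI z x y"
proof -
  have "c ^ w = c ^ n * c ^ (w - n)" if "n \<le> w" for n
    using that by (simp flip: power_add)
  moreover have "(- (c * x)) ^ m = c ^ m * (- x) ^ m" for m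
    by (metis mult_minus_right power_mult_distrib)
  ultimately show ?thesis
    unfolding EI_def sum_distrib_left by (intro sum.cong) (auto simp: power_mult_distrib)
qed

lemma EI_minus: "EI z (- x) (- y) = EI z x y"
  using EI_scale[of z "-1" x y] even_w by simp

text \<open>As \<open>f\<close> is periodic, both sides have derivative - f(z) ((z + n) y - x)^w,
  and both decay.\<close>

lemma EI_T:
  assumes "Im z > 0"
  shows "EI (z + of_int n) x y = EI z (x - of_int n * y) y"
proof -
  have "EI (z + of_int n) x y - EI z (x - of_int n * y) y = 0"
  proof (rule eq_0_if_deriv_0_and_vanishing_limit[OF _ _ assms])
    fix z :: complex assume z: "Im z > 0"
    have "((\<lambda>z. EI (z + of_int n) x y) has_field_derivative
        - (f (z + of_int n) * ((z + of_int n) * y - x) ^ w) * 1) (at z)"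
      by (rule DERIV_chain2[OF EI_deriv]) (use z in \<open>auto intro!: derivative_eq_intros\<close>)
    with EI_deriv[OF z, of "x - of_int n * y" y]
    show "((\<lambda>z. EI (z + of_int n) x y - EI z (x - of_int n * y) y) has_field_derivative 0) (at z)"
      by (auto intro!: derivative_eq_intros simp: f_T[OF z] algebra_simps)
  next
    show "((\<lambda>t. EI (\<i> * of_real t + of_int n) x y - EI (\<i> * of_real t) (x - of_int n * y) y) \<longlongrightarrow> 0) at_top"
      using tendsto_diff[OF EI_tendsto[of 1 "of_int n" x y] EI_tendsto[of 1 0 "x - of_int n * y" y]] by simp
  qed
  then show ?thesis by simp
qed

text \<open>The defect of \<open>EI\<close> under z -> -1/z does not depend on z; it is read off
  here at the fixed point i.\<close>

definition r :: "complex \<Rightarrow> complex \<Rightarrow> complex" where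
  "r x y = EI \<i> x y - EI \<i> y (- x)"

lemma EI_S:
  assumes "Im z > 0"
  shows "EI (- 1 / z) x y = EI z y (- x) + r x y"
proof -
  have "((\<lambda>z. EI (- 1 / z) x y - EI z y (- x)) has_field_derivative 0) (at z)" if z: "Im z > 0" for z
  proof -
    have z0: "z \<noteq> 0" using z by auto
    have "((\<lambda>z. EI (- 1 / z) x y) has_field_derivative
        - (f (- 1 / z) * ((- 1 / z) * y - x) ^ w) * (1 / z\<^sup>2)) (at z)"
    proof (rule DERIV_chain2[OF EI_deriv])
      show "Im (- 1 / z) > 0" using z by (rule Im_minus_inverse_pos)
      show "((/) (- 1) has_field_derivative 1 / z\<^sup>2) (at z)"
        using z0 by (auto intro!: derivative_eq_intros simp: power2_eq_square)
    qed
    moreover have "- (f (- 1 / z) * ((- 1 / z) * y - x) ^ w) * (1 / z\<^sup>2) = - (f z * (z * (- x) - y) ^ w)"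
    proof -
      have "z ^ w * ((- 1 / z) * y - x) ^ w = (z * (- x) - y) ^ w"
      proof -
        have "z * ((- 1 / z) * y - x) = z * (- x) - y" using z0 by (simp add: algebra_simps)
        then show ?thesis by (simp only: power_mult_distrib[symmetric])
      qed
      moreover have "f (- 1 / z) * (1 / z\<^sup>2) = z ^ w * f z"
        using z0 by (simp only: f_S[OF z] power_add power2_eq_square) (simp add: field_simps)
      ultimately show ?thesis by (metis (no_types, lifting) mult.assoc mult.commute minus_mult_left)
    qed
    ultimately show ?thesis using EI_deriv[OF z, of y "- x"]
      by (auto intro!: derivative_eq_intros)
  qed
  then have "\<exists>c. \<forall>z\<in>uhp. EI (- 1 / z) x y - EI z y (- x) = c"
    by (intro has_field_derivative_zero_constant) (auto intro: has_field_derivative_at_within)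
  then obtain c where c: "\<And>z. Im z > 0 \<Longrightarrow> EI (- 1 / z) x y - EI z y (- x) = c" by auto
  have "c = r x y" using c[of \<i>] by (simp add: r_def)
  then show ?thesis using c[OF assms] by (simp add: algebra_simps)
qed

section \<open>Relations of r under the modular group and the Hecke operators\<close>

lemma r_antisym: "r y (- x) = - r x y"
  using EI_minus[of \<i> x y] by (simp add: r_def)

lemma r_minus: "r (- x) (- y) = r x y"
  using EI_minus[of \<i> x y] EI_minus[of \<i> y "- x"] by (simp add: r_def)

text \<open>The matrix (1 0; n 1) is an inversion, a translation by -n and another inversion. Each
  inversion contributes one value of \<open>r\<close>.\<close>

lemma EI_lower_triangular:
  fixes n :: int
  assumes z: "Im z > 0"
  shows "EI (z / (of_int n * z + 1)) x y =
    EI z x (y - of_int n * x) + r x y + r (y - of_int n * x) (- x)"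
proof -
  have z0: "z \<noteq> 0" using z by auto
  define u where "u = - 1 / z + of_int (- n)"
  have u: "Im u > 0" using Im_minus_inverse_pos[OF z] by (simp add: u_def)
  then have u0: "u \<noteq> 0" by auto
  define v where "v = of_int n * z + 1"
  have "u = - v / z" using z0 by (simp add: u_def v_def field_simps)
  then have "z / (of_int n * z + 1) = - 1 / u" by (simp flip: v_def)
  then have "EI (z / (of_int n * z + 1)) x y = EI u y (- x) + r x y" using EI_S[OF u] by simp
  also have "EI u y (- x) = EI (- 1 / z) (y - of_int n * x) (- x)"
    unfolding u_def by (subst EI_T[OF Im_minus_inverse_pos[OF z]]) simp
  also have "\<dots> = EI z (- x) (- (y - of_int n * x)) + r (y - of_int n * x) (- x)"
    by (rule EI_S[OF z])
  finally show ?thesis by (simp only: EI_minus) (simp add: algebra_simps)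
qed

text \<open>With S the inversion and T the translation by 1, the point s/(1 - s) is reached from s
  both by S T S and by T^(-1) S T^(-1); comparing the two evaluations of \<open>EI\<close> leaves
  only values of \<open>r\<close>. The second form starts from s/(1 + s). Taken at -y it has the
  arguments of the first form up to sign, as the even part requires.\<close>

lemma r_three_term: "r x y = r (x + y) y + r x (x + y)" and r_three_term': "r x y = r (x - y) y + r x (y - x)"
proof -
  define s :: complex where "s = \<i>"
  have s: "Im s > 0" "Im (s - 1) > 0" "Im (s + 1) > 0" by (auto simp: s_def)
  then have s0: "s \<noteq> 1" "s \<noteq> -1" by (auto simp: s_def complex_eq_iff)
  have "EI (s / (of_int (-1) * s + 1)) x y = EI (- 1 / (s - 1) + of_int (-1)) x y"
    using s0 by (intro arg_cong[of _ _ "\<lambda>u. EI u x y"]) (simp add: field_simps)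
  also have "\<dots> = EI (s - 1) y (- (x + y)) + r (x + y) y"
    by (subst EI_T[OF Im_minus_inverse_pos[OF s(2)]]) (use EI_S[OF s(2)] in simp)
  also have "EI (s - 1) y (- (x + y)) = EI s x (x + y)"
    using EI_T[OF s(1), of "-1" y "- (x + y)"] EI_minus[of s x "x + y"] by simp
  finally show "r x y = r (x + y) y + r x (x + y)"
    using EI_lower_triangular[OF s(1), of "-1" x y] r_antisym[of "x + y" x] by (simp add: add.commute)
  have "EI (s / (of_int 1 * s + 1)) x y = EI (- 1 / (s + 1) + of_int 1) x y"
    using s0 by (intro arg_cong[of _ _ "\<lambda>u. EI u x y"]) (simp add: field_simps add_eq_0_iff)
  also have "\<dots> = EI (s + 1) y (- (x - y)) + r (x - y) y"
    by (subst EI_T[OF Im_minus_inverse_pos[OF s(3)]]) (use EI_S[OF s(3)] in simp)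
  also have "EI (s + 1) y (- (x - y)) = EI s x (y - x)"
    using EI_T[OF s(1), of 1 y "- (x - y)"] by simp
  finally show "r x y = r (x - y) y + r x (y - x)"
    using EI_lower_triangular[OF s(1), of 1 x y] r_antisym[of "y - x" x] by simp
qed

text \<open>One has ((z + j)/p) p y - (x + j y) = z y - x, and p z y - p x is p times this. So all
  terms differentiate to multiples of (z y - x)^w, with the coefficients in the definition of T_p,
  and both sides decay at i infinity.\<close>

lemma EI_hecke:
  assumes p: "p > 0" and hecke: "hecke_eigenvalue k p f l" and z: "Im z > 0"
  shows "l * EI z x y = EI (of_nat p * z) (of_nat p * x) y +
    (\<Sum>j<p. EI ((z + of_nat j) / of_nat p) (x + of_nat j * y) (of_nat p * y))"
proof -
  define D where "D z = EI (of_nat p * z) (of_nat p * x) y +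
    (\<Sum>j<p. EI ((z + of_nat j) / of_nat p) (x + of_nat j * y) (of_nat p * y)) - l * EI z x y" for z
  have cancel: "a / c * (c * y) = a * y" if "c \<noteq> 0" for a c y :: complex
    using that by simp
  have "D z = 0"
  proof (rule eq_0_if_deriv_0_and_vanishing_limit[OF _ _ z])
    fix z :: complex assume z: "Im z > 0"
    let ?d1 = "- (f (of_nat p * z) * (of_nat p * z * y - of_nat p * x) ^ w) * of_nat p"
    let ?d2 = "\<lambda>j. - (f ((z + of_nat j) / of_nat p) *
        ((z + of_nat j) / of_nat p * (of_nat p * y) - (x + of_nat j * y)) ^ w) * (1 / of_nat p)"
    have 1: "((\<lambda>z. EI (of_nat p * z) (of_nat p * x) y) has_field_derivative ?d1) (at z)"
    proof (rule DERIV_chain2[OF EI_deriv])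
      show "((*) (of_nat p) has_field_derivative of_nat p) (at z)"
        using DERIV_cmult[OF DERIV_ident, of "of_nat p :: complex" z UNIV] by simp
    qed (use z p in simp)
    have 2: "((\<lambda>z. EI ((z + of_nat j) / of_nat p) (x + of_nat j * y) (of_nat p * y)) has_field_derivative ?d2 j) (at z)" for j
    proof (rule DERIV_chain2[OF EI_deriv])
      show "((\<lambda>z. (z + of_nat j) / of_nat p) has_field_derivative 1 / of_nat p) (at z)"
        by (intro DERIV_cdivide DERIV_add[where E = 0, simplified] DERIV_ident DERIV_const)
    qed (use z p in \<open>simp add: Im_divide_of_nat\<close>)
    have e1: "?d1 = - (of_nat p ^ (w + 1) * f (of_nat p * z)) * (z * y - x) ^ w"
    proof -
      have *: "of_nat p * z * y - of_nat p * x = of_nat p * (z * y - x)" by (simp add: algebra_simps)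
      show ?thesis unfolding * power_mult_distrib power_add power_one_right
        by (simp only: mult_ac mult_minus_left mult_minus_right)
    qed
    have e2: "?d2 j = - (1 / of_nat p * f ((z + of_nat j) / of_nat p)) * (z * y - x) ^ w" for j
    proof -
      have "(z + of_nat j) / of_nat p * (of_nat p * y) - (x + of_nat j * y) = z * y - x"
      proof -
        have "(z + of_nat j) / of_nat p * (of_nat p * y) = (z + of_nat j) * y" using p by (intro cancel) simp
        then show ?thesis by (simp only:) (simp add: distrib_right)
      qed
      then show ?thesis by (simp only:) simp
    qed
    have "of_nat p ^ (w + 1) * f (of_nat p * z) + (\<Sum>j<p. 1 / of_nat p * f ((z + of_nat j) / of_nat p)) = l * f z"
      using hecke z unfolding hecke_eigenvalue_def hecke_def powi_k_minus by (simp add: sum_distrib_left)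
    then have "?d1 + (\<Sum>j<p. ?d2 j) = - (l * f z) * (z * y - x) ^ w"
      unfolding e1 e2 sum_distrib_right[symmetric] sum_negf distrib_right[symmetric] minus_add_distrib[symmetric]
      by simp
    moreover have "(D has_field_derivative ?d1 + (\<Sum>j<p. ?d2 j) - l * - (f z * (z * y - x) ^ w)) (at z)"
      unfolding D_def by (intro derivative_intros DERIV_sum 1 2 DERIV_cmult EI_deriv z)
    ultimately show "(D has_field_derivative 0) (at z)" by simp
  next
    have "((\<lambda>t. EI (\<i> * of_real (real p * t) + of_real 0) (of_nat p * x) y +
      (\<Sum>j<p. EI (\<i> * of_real (1 / real p * t) + of_real (real j / real p)) (x + of_nat j * y) (of_nat p * y)) -
      l * EI (\<i> * of_real (1 * t) + of_real 0) x y) \<longlongrightarrow> 0 + (\<Sum>j<p. 0) - l * 0) at_top"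
      using p by (intro tendsto_intros EI_tendsto) auto
    then show "((\<lambda>t::real. D (\<i> * of_real t)) \<longlongrightarrow> 0) at_top"
      by (simp add: D_def add_divide_distrib mult_ac)
  qed
  then show ?thesis by (simp add: D_def)
qed

text \<open>As \<open>r\<close> compares \<open>EI\<close> at i for the arguments (x, y) and (y,
  -x), \<open>EI_hecke\<close> is used for both. Inversion exchanges 2 i and i/2, which matches the
  p z term of one with the j = 0 term of the other. The two j = 1 terms both live at u = (i + 1)/2
  and are matched by going from u to u - 1 and back.\<close>

lemma r_hecke_2:
  assumes "hecke_eigenvalue k 2 f l"
  shows "l * r x y = r (2 * x) y + r x (2 * y) + r (x + y) (2 * y) + r (2 * x) (x + y)"
    and "l * r x y = r (2 * x) y + r x (2 * y) + r (x - y) (2 * y) + r (2 * x) (y - x)"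
proof -
  define u where "u = (\<i> + 1) / 2"
  define s where "s = (\<i> - 1) / 2"
  have us: "Im u > 0" "Im s > 0" "u = s + of_int 1" "s = u + of_int (-1)"
    "s / (of_int 2 * s + 1) = u" "u / (of_int (-2) * u + 1) = s"
    by (auto simp: u_def s_def complex_eq_iff Re_divide Im_divide)
  have h: "l * EI \<i> x y = EI (2 * \<i>) (2 * x) y + EI (\<i> / 2) x (2 * y) + EI u (x + y) (2 * y)" for x y
  proof -
    have "(\<Sum>j<2. g j) = g 0 + g 1" for g :: "nat \<Rightarrow> complex" by (simp add: numeral_2_eq_2)
    then show ?thesis using EI_hecke[of 2 l \<i> x y] assms by (simp add: u_def)
  qed
  have S: "EI (2 * \<i>) (2 * x) y = EI (\<i> / 2) y (- 2 * x) + r (2 * x) y"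
    "EI (\<i> / 2) x (2 * y) = EI (2 * \<i>) (2 * y) (- x) + r x (2 * y)"
  proof -
    have e: "- 1 / (\<i> / 2) = 2 * \<i>" "- 1 / (2 * \<i>) = \<i> / 2" by (simp_all add: complex_eq_iff Re_divide Im_divide)
    show "EI (2 * \<i>) (2 * x) y = EI (\<i> / 2) y (- 2 * x) + r (2 * x) y"
      "EI (\<i> / 2) x (2 * y) = EI (2 * \<i>) (2 * y) (- x) + r x (2 * y)"
      using EI_S[of "\<i> / 2" "2 * x" y] EI_S[of "2 * \<i>" x "2 * y"] unfolding e by simp_all
  qed
  have h': "l * EI \<i> y (- x) = EI (2 * \<i>) (2 * y) (- x) + EI (\<i> / 2) y (- 2 * x) + EI u (y - x) (- 2 * x)"
    using h[of y "- x"] by simp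
  have "l * r x y = l * EI \<i> x y - l * EI \<i> y (- x)" by (simp add: r_def right_diff_distrib)
  also have "\<dots> = r (2 * x) y + r x (2 * y) + (EI u (x + y) (2 * y) - EI u (y - x) (- 2 * x))"
    unfolding h[of x y] h' S by (simp only: algebra_simps)
  finally have base: "l * r x y = r (2 * x) y + r x (2 * y) + (EI u (x + y) (2 * y) - EI u (y - x) (- 2 * x))" .
  \<comment> \<open>The way to \<open>s\<close> uses u = s/(2 s + 1), the way back s = u - 1. For
    the second form the way out is the translation and the way back is s = u/(-2 u + 1).\<close>
  have "EI u (x + y) (2 * y) = EI s (x + y) (- 2 * x) + r (x + y) (2 * y) + r (- 2 * x) (- (x + y))"
  proof -
    have "2 * y - of_int 2 * (x + y) = - 2 * x" by simp
    from EI_lower_triangular[OF us(2), of 2 "x + y" "2 * y", unfolded us(5) this] show ?thesis .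
  qed
  moreover have "EI s (x + y) (- 2 * x) = EI u (y - x) (- 2 * x)"
    using EI_T[OF us(1), of "-1" "x + y" "- 2 * x"] unfolding us(4)[symmetric] by simp
  moreover have "r (- 2 * x) (- (x + y)) = r (2 * x) (x + y)"
    using r_minus[of "2 * x" "x + y"] by simp
  ultimately show "l * r x y = r (2 * x) y + r x (2 * y) + r (x + y) (2 * y) + r (2 * x) (x + y)"
    unfolding base by (simp only: add_diff_cancel_left add_diff_cancel_right) (simp only: algebra_simps)
  have "EI u (x + y) (2 * y) = EI s (x - y) (2 * y)"
    using EI_T[OF us(2), of 1 "x + y" "2 * y"] unfolding us(3)[symmetric] by simp
  also have "\<dots> = EI u (x - y) (2 * x) + r (x - y) (2 * y) + r (2 * x) (y - x)"
  proof -
    have "2 * y - of_int (- 2) * (x - y) = 2 * x" "- (x - y) = y - x" by (simp_all add: algebra_simps)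
    from EI_lower_triangular[OF us(1), of "-2" "x - y" "2 * y", unfolded us(6) this] show ?thesis .
  qed
  also have "EI u (x - y) (2 * x) = EI u (y - x) (- 2 * x)" using EI_minus[of u "x - y" "2 * x"] by simp
  finally show "l * r x y = r (2 * x) y + r x (2 * y) + r (x - y) (2 * y) + r (2 * x) (y - x)"
    using base by simp
qed

text \<open>The residues 1 and 2 give u = (i + 1)/3 and, after a translation, s = (i - 1)/3; lower
  triangular matrices exchange the two points. Since both signs occur, one form serves y and -y
  alike.\<close>

lemma r_hecke_3:
  assumes "hecke_eigenvalue k 3 f l"
  shows "l * r x y = r (3 * x) y + r x (3 * y) + r (x + y) (3 * y) + r (3 * x) (x + y)
    + r (x - y) (3 * y) + r (3 * x) (y - x)"
proof -
  define u where "u = (\<i> + 1) / 3"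
  define s where "s = (\<i> - 1) / 3"
  have us: "Im u > 0" "Im s > 0" "(\<i> + 2) / 3 = s + of_int 1"
    "s / (of_int 3 * s + 1) = u" "u / (of_int (-3) * u + 1) = s"
    by (auto simp: u_def s_def complex_eq_iff Re_divide Im_divide)
  have h: "l * EI \<i> x y = EI (3 * \<i>) (3 * x) y + EI (\<i> / 3) x (3 * y) + EI u (x + y) (3 * y)
     + EI s (x - y) (3 * y)" for x y
  proof -
    have "(\<Sum>j<3. g j) = g 0 + g 1 + g 2" for g :: "nat \<Rightarrow> complex"
      by (simp add: numeral_3_eq_3 numeral_2_eq_2)
    then show ?thesis
      using EI_hecke[of 3 l \<i> x y] assms EI_T[OF us(2), of 1 "x + 2 * y" "3 * y"] us(3)
      by (simp add: u_def)
  qed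
  have S: "EI (3 * \<i>) (3 * x) y = EI (\<i> / 3) y (- 3 * x) + r (3 * x) y"
    "EI (\<i> / 3) x (3 * y) = EI (3 * \<i>) (3 * y) (- x) + r x (3 * y)"
  proof -
    have e: "- 1 / (\<i> / 3) = 3 * \<i>" "- 1 / (3 * \<i>) = \<i> / 3" by (simp_all add: complex_eq_iff Re_divide Im_divide)
    show "EI (3 * \<i>) (3 * x) y = EI (\<i> / 3) y (- 3 * x) + r (3 * x) y"
      "EI (\<i> / 3) x (3 * y) = EI (3 * \<i>) (3 * y) (- x) + r x (3 * y)"
      using EI_S[of "\<i> / 3" "3 * x" y] EI_S[of "3 * \<i>" x "3 * y"] unfolding e by simp_all
  qed
  have h': "l * EI \<i> y (- x) = EI (3 * \<i>) (3 * y) (- x) + EI (\<i> / 3) y (- 3 * x) + EI u (y - x) (- 3 * x)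
      + EI s (x + y) (- 3 * x)"
    using h[of y "- x"] by (simp add: add.commute)
  have e1: "EI u (x + y) (3 * y) = EI s (x + y) (- 3 * x) + r (x + y) (3 * y) + r (- 3 * x) (- (x + y))"
  proof -
    have "3 * y - of_int 3 * (x + y) = - 3 * x" by simp
    from EI_lower_triangular[OF us(2), of 3 "x + y" "3 * y", unfolded us(4) this] show ?thesis .
  qed
  have e2: "EI s (x - y) (3 * y) = EI u (x - y) (3 * x) + r (x - y) (3 * y) + r (3 * x) (y - x)"
  proof -
    have "3 * y - of_int (- 3) * (x - y) = 3 * x" "- (x - y) = y - x" by (simp_all add: algebra_simps)
    from EI_lower_triangular[OF us(1), of "-3" "x - y" "3 * y", unfolded us(5) this] show ?thesis .
  qed
  have e3: "EI u (x - y) (3 * x) = EI u (y - x) (- 3 * x)" using EI_minus[of u "x - y" "3 * x"] by simp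
  have "l * r x y = l * EI \<i> x y - l * EI \<i> y (- x)" by (simp add: r_def right_diff_distrib)
  also have "\<dots> = r (3 * x) y + r x (3 * y) + r (x + y) (3 * y) + r (- 3 * x) (- (x + y))
    + r (x - y) (3 * y) + r (3 * x) (y - x)"
    unfolding h[of x y] h' S e1 e2 e3 by (simp only: algebra_simps)
  also have "r (- 3 * x) (- (x + y)) = r (3 * x) (x + y)"
    using r_minus[of "3 * x" "x + y"] by simp
  finally show ?thesis .
qed

end

section \<open>The period polynomial as a boundary value of the Eichler integral\<close>

lemma integral_greaterThan_0_FTC:
  fixes F \<phi> :: "real \<Rightarrow> 'a::euclidean_space"
  assumes deriv: "\<And>t. t > 0 \<Longrightarrow> (F has_vector_derivative \<phi> t) (at t)"
    and bound: "\<And>t. t > 0 \<Longrightarrow> norm (\<phi> t) \<le> K * exp (- t)"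
    and A: "(F \<longlongrightarrow> A) (at_right 0)" and B: "(F \<longlongrightarrow> B) at_top"
  shows "integral {0<..} \<phi> = B - A"
proof -
  \<comment> \<open>Compact intervals exhausting the open half line: the fundamental theorem applies
    on each, and dominated convergence passes to the limit.\<close>
  define I where "I n = {1 / real (Suc n)..real (Suc n)}" for n
  define g where "g n t = (if t \<in> I n then \<phi> t else 0)" for n t
  have Ipos: "I n \<subseteq> {0<..}" for n
    by (auto simp: I_def intro: less_le_trans[of 0 "1 / real (Suc n)"])
  have FTC: "(\<phi> has_integral F (real (Suc n)) - F (1 / real (Suc n))) (I n)" for n
    unfolding I_def
  proof (rule fundamental_theorem_of_calculus)
    fix t assume "t \<in> {1 / real (Suc n)..real (Suc n)}"
    then have "t > 0" using Ipos[of n] by (auto simp: I_def)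
    then show "(F has_vector_derivative \<phi> t) (at t within {1 / real (Suc n)..real (Suc n)})"
      by (rule has_vector_derivative_at_within[OF deriv])
  qed (simp add: field_simps)
  have g_int: "(g n has_integral F (real (Suc n)) - F (1 / real (Suc n))) {0<..}" for n
    unfolding g_def using FTC[of n] Ipos[of n] by (subst has_integral_restrict) auto
  have "(\<lambda>n. integral {0<..} (g n)) \<longlonglongrightarrow> integral {0<..} \<phi>"
  proof (rule dominated_convergence(2))
    show "g n integrable_on {0<..}" for n using g_int by blast
    have "(\<lambda>t. K * exp (- t)) integrable_on {0..}"
      using integrable_on_exp_minus_to_infinity[of 1 0] by (intro integrable_on_mult_right) simp
    then show "(\<lambda>t. K * exp (- t)) integrable_on {0<..}"
    proof (rule integrable_spike_set)
      show "negligible {x \<in> {0..} - {0<..}. K * exp (- x) \<noteq> 0}"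
        by (rule negligible_subset[of "{0}"]) auto
      show "negligible {x \<in> {0<..} - {0..}. K * exp (- x) \<noteq> 0}"
        by (rule negligible_subset[of "{0}"]) auto
    qed
    show "norm (g n t) \<le> K * exp (- t)" if "t \<in> {0<..}" for n t
      using bound[of t] that norm_ge_zero[of "\<phi> t"] by (auto simp: g_def simp del: norm_ge_zero)
    show "(\<lambda>n. g n t) \<longlonglongrightarrow> \<phi> t" if "t \<in> {0<..}" for t
    proof (rule tendsto_eventually)
      have "eventually (\<lambda>n. 1 / real (Suc n) < t) sequentially"
        using order_tendstoD(2)[OF LIMSEQ_inverse_real_of_nat, of t] that by (simp add: inverse_eq_divide)
      moreover have "eventually (\<lambda>n. real (Suc n) > t) sequentially" by real_asymp
      ultimately show "eventually (\<lambda>n. g n t = \<phi> t) sequentially"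
        by eventually_elim (auto simp: g_def I_def)
    qed
  qed
  then have 1: "(\<lambda>n. F (real (Suc n)) - F (1 / real (Suc n))) \<longlonglongrightarrow> integral {0<..} \<phi>"
    unfolding integral_unique[OF g_int] .
  have 2: "(\<lambda>n. F (real (Suc n)) - F (1 / real (Suc n))) \<longlonglongrightarrow> B - A"
  proof (intro tendsto_diff)
    show "(\<lambda>n. F (real (Suc n))) \<longlonglongrightarrow> B"
      by (rule filterlim_compose[OF B]) real_asymp
    show "(\<lambda>n. F (1 / real (Suc n))) \<longlonglongrightarrow> A"
      by (rule filterlim_compose[OF A]) real_asymp
  qed
  from 1 2 show ?thesis by (rule LIMSEQ_unique)
qed

text \<open>The uniqueness behind the \<open>THE\<close> in \<open>period_poly\<close>: P - Q
  vanishes at infinitely many elements of the coefficient ring, namely the constants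
  \<open>[:y:]\<close>.\<close>

lemma poly2_eqI:
  fixes P Q :: "complex poly poly"
  assumes "\<And>x y. poly (poly P [:y:]) x = poly (poly Q [:y:]) x"
  shows "P = Q"
proof (rule ccontr)
  assume "P \<noteq> Q"
  then have "finite {p. poly (P - Q) p = 0}" by (intro poly_roots_finite) simp
  moreover have "range (\<lambda>y. [:y:]) \<subseteq> {p. poly (P - Q) p = 0}"
  proof safe
    fix y
    have "poly P [:y:] = poly Q [:y:]" by (rule poly_ext) (rule assms)
    then show "poly (P - Q) [:y:] = 0" by simp
  qed
  ultimately have "finite (range (\<lambda>y::complex. [:y:]))" by (rule finite_subset[rotated])
  then have "finite (UNIV :: complex set)" by (rule finite_imageD) (auto simp: inj_on_def)
  then show False by (simp add: infinite_UNIV_char_0)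
qed

lemma coeff_restrict_even:
  assumes "even i" "even j" "i \<le> n" "j \<le> n" "(i, j) \<noteq> (n, 0)" "(i, j) \<noteq> (0, n)"
  shows "coeff (coeff (restrict_even n P) j) i = coeff (coeff P j) i"
proof -
  define c where "c = (\<lambda>i' j'. if even i' \<and> even j' \<and> (i', j') \<noteq> (n, 0) \<and> (i', j') \<noteq> (0, n)
      then coeff (coeff P j') i' else 0)"
  have *: "coeff (coeff (if Q then monom (monom a i') j' else 0) j) i =
      (if j' = j then (if i' = i then (if Q then a else 0) else 0) else 0)" for Q i' j' and a :: complex
    by simp
  have "coeff (coeff (restrict_even n P) j) i = (\<Sum>i'\<le>n. \<Sum>j'\<le>n. if j' = j then (if i' = i then c i' j' else 0) else 0)"
    unfolding restrict_even_def coeff_sum * c_def ..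
  also have "\<dots> = c i j" using assms(3,4) by simp
  also have "\<dots> = coeff (coeff P j) i" using assms by (auto simp: c_def)
  finally show ?thesis .
qed

context even_cusp_form begin
definition e :: "nat \<Rightarrow> complex" where
  "e n = of_nat (w choose n) * (- 1) ^ (w - n) * Em n \<i>"

text \<open>The coefficient of x^(w-n) y^n in \<open>r\<close>; the second summand comes from the
  substitution (y, -x).\<close>

definition b :: "nat \<Rightarrow> complex" where
  "b n = e n - (- 1) ^ (w - n) * e (w - n)"

lemma r_poly: "r x y = (\<Sum>n\<le>w. b n * x ^ (w - n) * y ^ n)"
proof -
  have m: "(- x) ^ m = (- 1) ^ m * x ^ m" for m :: nat and x :: complex
    by (metis power_minus)
  have 1: "EI \<i> x y = (\<Sum>n\<le>w. e n * x ^ (w - n) * y ^ n)" for x y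
    unfolding EI_def e_def by (intro sum.cong) (auto simp: m[of x] mult_ac)
  have "EI \<i> y (- x) = (\<Sum>n\<le>w. e (w - n) * y ^ (w - (w - n)) * (- x) ^ (w - n))"
    unfolding 1 by (subst sum.atLeastAtMost_rev[of _ 0 w, simplified atLeast0AtMost]) simp
  also have "\<dots> = (\<Sum>n\<le>w. (- 1) ^ (w - n) * e (w - n) * x ^ (w - n) * y ^ n)"
    by (intro sum.cong) (auto simp: m[of x] mult_ac)
  finally show ?thesis
    unfolding r_def 1 b_def by (simp add: sum_subtractf left_diff_distrib)
qed


text \<open>Inversion takes i t to i/t, where \<open>EI\<close> decays, so only the defect
  \<open>r\<close> is left.\<close>

lemma EI_tendsto_at_right_0: "((\<lambda>t. EI (\<i> * of_real t) x y) \<longlongrightarrow> r x y) (at_right 0)"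
proof -
  have "((\<lambda>t. EI (\<i> * of_real (1 * inverse t) + of_real 0) y (- x) + r x y) \<longlongrightarrow> 0 + r x y) (at_right 0)"
    by (intro tendsto_add tendsto_const filterlim_compose[OF EI_tendsto filterlim_inverse_at_top_right]) simp
  moreover have "\<forall>\<^sub>F t in at_right 0. EI (\<i> * of_real (1 * inverse t) + of_real 0) y (- x) + r x y = EI (\<i> * of_real t) x y"
  proof (rule eventually_at_rightI[of 0 1])
    fix t :: real assume t: "t \<in> {0<..<1}"
    have "- 1 / (\<i> * of_real (inverse t)) = \<i> * of_real t"
      using t by (simp add: complex_eq_iff Re_divide Im_divide power2_eq_square)
    with EI_S[of "\<i> * of_real (inverse t)" x y] t
    show "EI (\<i> * of_real (1 * inverse t) + of_real 0) y (- x) + r x y = EI (\<i> * of_real t) x y"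
      by (simp only: mult_1 of_real_0 add_0_right) simp
  qed simp
  ultimately show ?thesis using tendsto_cong by fastforce
qed


lemma period_integrand_bound:
  "\<exists>K. \<forall>t>0. cmod (f (\<i> * of_real t) * (\<i> * of_real t * y - x) ^ w * \<i>) \<le> K * exp (- t)"
proof -
  define m where "m = cmod x + cmod y"
  obtain C0 where C0: "C0 > 0" "\<And>z. Im z \<ge> 1 / 2 \<Longrightarrow> Re z = 0 \<Longrightarrow> cmod (f z * z ^ 0) \<le> C0 * exp (- Im z)"
    using f_moment_decay[of 0 0] by auto
  obtain C1 where C1: "C1 > 0" "\<And>z. Im z \<ge> 1 / 2 \<Longrightarrow> Re z = 0 \<Longrightarrow> cmod (f z * z ^ w) \<le> C1 * exp (- Im z)"
    using f_moment_decay[of 0 w] by auto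
  obtain C2 where C2: "C2 > 0" "\<And>z. Im z \<ge> 1 / 2 \<Longrightarrow> Re z = 0 \<Longrightarrow> cmod (f z * z ^ (w + 2)) \<le> C2 * exp (- Im z)"
    using f_moment_decay[of 0 "w + 2"] by auto
  have m0: "m \<ge> 0" by (simp add: m_def)
  have nb: "cmod (\<i> * of_real t * y - x) \<le> max 1 t * m" if "t > 0" for t
  proof -
    have "cmod (\<i> * of_real t * y - x) \<le> t * cmod y + cmod x"
      using norm_triangle_ineq4[of "\<i> * of_real t * y" x] that by (simp add: norm_mult)
    also have "\<dots> \<le> max 1 t * cmod y + max 1 t * cmod x"
      using mult_right_mono[of 1 "max 1 t" "cmod x"] by (intro add_mono mult_right_mono) auto
    finally show ?thesis by (simp add: m_def algebra_simps)
  qed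
  \<comment> \<open>The first summand serves t >= 1 and the second t < 1, where exp 1 makes up for
    the factor exp (- t).\<close>
  define K where "K = C1 * m ^ w + C2 * m ^ w * exp 1"
  have "cmod (f (\<i> * of_real t) * (\<i> * of_real t * y - x) ^ w * \<i>) \<le> K * exp (- t)" if t: "t > 0" for t
  proof (cases "t \<ge> 1")
    case True
    have "cmod (f (\<i> * of_real t) * (\<i> * of_real t * y - x) ^ w * \<i>) \<le> cmod (f (\<i> * of_real t)) * (t * m) ^ w"
      using nb[OF t] True by (simp add: norm_mult norm_power mult_left_mono power_mono max_def)
    also have "\<dots> = cmod (f (\<i> * of_real t) * (\<i> * of_real t) ^ w) * m ^ w"
      using t by (simp add: norm_mult norm_power power_mult_distrib)
    also have "\<dots> \<le> (C1 * exp (- t)) * m ^ w"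
      using C1(2)[of "\<i> * of_real t"] True m0 by (intro mult_right_mono) auto
    also have "\<dots> \<le> K * exp (- t)" using C2 m0 by (simp add: K_def algebra_simps)
    finally show ?thesis .
  next
    case False
    \<comment> \<open>Near 0 modularity expresses f(i t) by \<open>f\<close> at the high point u =
      i/t, where the moment of order w + 2 is bounded.\<close>
    define u where "u = \<i> * of_real (1 / t)"
    have u: "Im u \<ge> 1" "Re u = 0" using False t by (auto simp: u_def)
    have "- 1 / u = \<i> * of_real t"
      using t by (simp add: u_def complex_eq_iff Re_divide Im_divide power2_eq_square)
    then have fu: "f (\<i> * of_real t) = f u * u ^ (w + 2)" using f_S[of u] u by (simp add: mult.commute)
    have "cmod (f (\<i> * of_real t)) \<le> C2 * exp (- Im u)" unfolding fu using C2(2)[of u] u by simp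
    also have "\<dots> \<le> C2 * 1" using u C2 by (intro mult_left_mono) auto
    finally have f1: "cmod (f (\<i> * of_real t)) \<le> C2" by simp
    have "cmod (f (\<i> * of_real t) * (\<i> * of_real t * y - x) ^ w * \<i>) \<le> C2 * m ^ w"
      using nb[OF t] False f1 C2 m0 by (auto simp: norm_mult norm_power max_def intro!: mult_mono power_mono)
    also have "\<dots> \<le> C2 * m ^ w * exp (1 - t)"
      using False C2 m0 mult_left_mono[of 1 "exp (1 - t)" "C2 * m ^ w"] by simp
    also have "exp (1 - t) = exp 1 * exp (- t)" by (simp flip: exp_add)
    also have "C2 * m ^ w * (exp 1 * exp (- t)) \<le> K * exp (- t)"
      using C1 m0 by (simp add: K_def distrib_right)
    finally show ?thesis .
  qed
  then show ?thesis by blast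
qed


lemma period_fun_eq: "period_fun k f x y = r x y"
proof -
  obtain K where K: "\<And>t. t > 0 \<Longrightarrow> cmod (f (\<i> * of_real t) * (\<i> * of_real t * y - x) ^ w * \<i>) \<le> K * exp (- t)"
    using period_integrand_bound[of y x] by auto
  have d: "((\<lambda>t. - EI (\<i> * of_real t) x y) has_vector_derivative f (\<i> * of_real t) * (\<i> * of_real t * y - x) ^ w * \<i>) (at t)"
    if "t > 0" for t :: real
  proof -
    have "((\<lambda>t. \<i> * of_real t) has_vector_derivative \<i>) (at t)"
      by (auto intro!: derivative_eq_intros)
    from field_vector_diff_chain_at[OF this, OF EI_deriv[of "\<i> * of_real t" x y]] \<open>t > 0\<close>
    have "((\<lambda>t. EI (\<i> * of_real t) x y) has_vector_derivative \<i> * - (f (\<i> * of_real t) * (\<i> * of_real t * y - x) ^ w)) (at t)"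
      by (simp add: o_def)
    from has_vector_derivative_minus[OF this] show ?thesis
      by (simp only: mult_minus_right minus_minus mult.commute[of \<i> "f _ * _"])
  qed
  have "((\<lambda>t. EI (\<i> * of_real t) x y) \<longlongrightarrow> 0) at_top"
    using EI_tendsto[of 1 0 x y] by simp
  note lim = tendsto_minus[OF EI_tendsto_at_right_0[of x y]] tendsto_minus[OF this]
  have *: "integral {0<..} (\<lambda>t. f (\<i> * of_real t) * (\<i> * of_real t * y - x) ^ w * \<i>) = - 0 - (- r x y)"
    by (rule integral_greaterThan_0_FTC[OF d K lim])
  show ?thesis unfolding period_fun_def w_def[symmetric] * by simp
qed

lemma period_poly_eq: "period_poly k f = (\<Sum>n\<le>w. monom (monom (b n) (w - n)) n)"
  unfolding period_poly_def
proof (rule the_equality)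
  have *: "poly (poly (\<Sum>n\<le>w. monom (monom (b n) (w - n)) n) [:y:]) x = period_fun k f x y" for x y
    by (simp add: poly_sum poly_monom period_fun_eq r_poly)
  then show "\<forall>x y. poly (poly (\<Sum>n\<le>w. monom (monom (b n) (w - n)) n) [:y:]) x = period_fun k f x y" by blast
  show "P = (\<Sum>n\<le>w. monom (monom (b n) (w - n)) n)"
    if "\<forall>x y. poly (poly P [:y:]) x = period_fun k f x y" for P
    using that * by (intro poly2_eqI) simp
qed

lemma coeff_period_poly:
  assumes "n \<le> w"
  shows "coeff (coeff (period_poly k f) n) (w - n) = b n"
proof -
  have "coeff (period_poly k f) n = (\<Sum>i\<le>w. if i = n then monom (b i) (w - i) else 0)"
    unfolding period_poly_eq coeff_sum coeff_monom ..
  also have "\<dots> = monom (b n) (w - n)" using assms by simp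
  finally show ?thesis by simp
qed

lemma coeff_restricted_even_period_poly:
  assumes "even n" "2 \<le> n" "n + 2 \<le> w"
  shows "coeff (coeff (restricted_even_period_poly k f) n) (w - n) = b n"
proof -
  have "coeff (coeff (restrict_even w (period_poly k f)) n) (w - n) = coeff (coeff (period_poly k f) n) (w - n)"
    by (rule coeff_restrict_even) (use assms even_w in simp_all)
  also have "\<dots> = b n" by (rule coeff_period_poly) (use assms in simp)
  finally show ?thesis unfolding restricted_even_period_poly_def w_def .
qed

end


section \<open>Nonvanishing of the restricted even period polynomial\<close>

text \<open>After a translation to real part at most 1/2 in modulus, a point of height below 1/2 has
  squared modulus at most 1/2, so inversion at least doubles its height. Finitely many doublings
  lead to height 1/2.\<close>

lemma uhp_descent [consumes 1, case_names high shift inversion]: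
  assumes "Im z > 0"
    and high: "\<And>z. Im z \<ge> 1 / 2 \<Longrightarrow> P z"
    and shift: "\<And>z n. Im z > 0 \<Longrightarrow> P (z + of_int n) \<Longrightarrow> P z"
    and inv: "\<And>z. Im z > 0 \<Longrightarrow> cmod z \<le> 1 \<Longrightarrow> P (- 1 / z) \<Longrightarrow> P z"
  shows "P z"
proof -
  have *: "P z" if "Im z \<ge> 1 / 2 / 2 ^ m" for m z
    using that
  proof (induction m arbitrary: z)
    case 0
    then show ?case by (intro high) simp
  next
    case (Suc m)
    show ?case
    proof (cases "Im z \<ge> 1 / 2")
      case True
      then show ?thesis by (rule high)
    next
      case False
      have "(0::real) < 1 / 2 / 2 ^ Suc m" by simp
      with Suc.prems have pos: "Im z > 0" by linarith
      define z' where "z' = z + of_int (- round (Re z))"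
      have im: "Im z' = Im z" by (simp add: z'_def)
      have "\<bar>Re z'\<bar> \<le> 1 / 2" using of_int_round_abs_le[of "Re z"] by (simp add: z'_def abs_minus_commute)
      then have "(Re z')\<^sup>2 \<le> (1 / 2)\<^sup>2" by (metis abs_ge_zero power2_abs power_mono)
      moreover have "(Im z')\<^sup>2 \<le> (1 / 2)\<^sup>2" using False pos im by (intro power_mono) auto
      ultimately have n: "(cmod z')\<^sup>2 \<le> 1 / 2" unfolding cmod_power2 by (simp add: power2_eq_square)
      then have "(cmod z')\<^sup>2 \<le> 1\<^sup>2" by simp
      then have n1: "cmod z' \<le> 1" by (rule power2_le_imp_le) simp
      have "z' \<noteq> 0" using im pos by auto
      then have n0: "(cmod z')\<^sup>2 > 0" by simp
      have "Im z * (cmod z')\<^sup>2 \<le> Im z * (1 / 2)" using n pos by (intro mult_left_mono) auto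
      then have "2 * Im z \<le> Im z / (cmod z')\<^sup>2" using n0 by (simp add: field_simps)
      then have "Im (- 1 / z') \<ge> 2 * Im z" by (subst Im_minus_inverse) (simp only: im)
      moreover have "2 * Im z \<ge> 1 / 2 / 2 ^ m" using Suc.prems by (simp add: field_simps)
      ultimately have "P (- 1 / z')" by (intro Suc.IH) linarith
      then have "P z'" using inv n1 pos im by metis
      then show ?thesis unfolding z'_def by (rule shift[OF pos])
    qed
  qed
  have "eventually (\<lambda>m. 1 / 2 / 2 ^ m < Im z) sequentially"
  proof (rule order_tendstoD)
    show "(\<lambda>m. 1 / 2 / 2 ^ m :: real) \<longlonglongrightarrow> 0" by real_asymp
  qed fact
  then obtain m where "1 / 2 / 2 ^ m < Im z" by (auto simp: eventually_sequentially)
  then show ?thesis by (intro *[of m]) simp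
qed

section \<open>Fourier coefficients on circles\<close>

lemma fourier_coefficient_holomorphic:
  assumes g: "g holomorphic_on ball 0 1" and r: "0 < \<rho>" "\<rho> < 1"
  shows "((\<lambda>t. g (of_real \<rho> * cis t) * cis (- (real n * t))) has_integral
      2 * of_real pi * of_real \<rho> ^ n * (deriv ^^ n) g 0 / fact n) {0..2 * pi}"
proof -
  have cancel: "a / j * (d * j * c) = a * d * c" if "j \<noteq> 0" for a c d j :: complex
    using that by (simp add: field_simps)
  have "((\<lambda>u. g u / (u - 0) ^ Suc n) has_contour_integral (2 * pi * \<i>) / (fact n) * (deriv ^^ n) g 0) (circlepath 0 \<rho>)"
  proof (rule Cauchy_has_contour_integral_higher_derivative_circlepath)
    show "continuous_on (cball 0 \<rho>) g"
      by (rule holomorphic_on_imp_continuous_on[OF holomorphic_on_subset[OF g]]) (use r in auto)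
    show "g holomorphic_on ball 0 \<rho>"
      by (rule holomorphic_on_subset[OF g]) (use r in auto)
  qed (use r in auto)
  then have "((\<lambda>t. g (0 + of_real \<rho> * cis t) / (0 + of_real \<rho> * cis t - 0) ^ Suc n * of_real \<rho> * \<i> * cis t)
      has_integral (2 * pi * \<i>) / (fact n) * (deriv ^^ n) g 0) {0..2 * pi}"
    unfolding circlepath_def by (subst (asm) has_contour_integral_part_circlepath_iff) auto
  from has_integral_mult_right[OF this, of "of_real \<rho> ^ n / \<i>"]
  have "((\<lambda>t. of_real \<rho> ^ n / \<i> * (g (0 + of_real \<rho> * cis t) / (0 + of_real \<rho> * cis t - 0) ^ Suc n * of_real \<rho> * \<i> * cis t))
      has_integral of_real \<rho> ^ n / \<i> * ((2 * pi * \<i>) / (fact n) * (deriv ^^ n) g 0)) {0..2 * pi}" .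
  also have "of_real \<rho> ^ n / \<i> * ((2 * pi * \<i>) / (fact n) * (deriv ^^ n) g 0) =
      of_real \<rho> ^ n / \<i> * ((2 * pi / fact n) * \<i> * (deriv ^^ n) g 0)"
    by simp
  also have "\<dots> = 2 * of_real pi * of_real \<rho> ^ n * (deriv ^^ n) g 0 / fact n"
    by (subst cancel) simp_all
  also have "(\<lambda>t. of_real \<rho> ^ n / \<i> * (g (0 + of_real \<rho> * cis t) / (0 + of_real \<rho> * cis t - 0) ^ Suc n * of_real \<rho> * \<i> * cis t)) =
      (\<lambda>t. g (of_real \<rho> * cis t) * cis (- (real n * t)))"
  proof
    fix t
    have c: "cis (- (real n * t)) = 1 / cis t ^ n"
      using Complex.DeMoivre[of t n] by (simp only: cis_inverse[symmetric] inverse_eq_divide)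
    show "of_real \<rho> ^ n / \<i> * (g (0 + of_real \<rho> * cis t) / (0 + of_real \<rho> * cis t - 0) ^ Suc n * of_real \<rho> * \<i> * cis t) =
        g (of_real \<rho> * cis t) * cis (- (real n * t))"
      unfolding c cancel[OF complex_i_not_zero] using r by (simp add: power_mult_distrib divide_simps)
  qed
  finally show ?thesis .
qed

text \<open>Up to the factor rho^n the integrand is the conjugate of the local \<open>h\<close>,
  which is holomorphic and vanishes at 0 because n > 0. Its mean over a circle is therefore
  0.\<close>

lemma fourier_coefficient_antiholomorphic:
  assumes g: "g holomorphic_on ball 0 1" and r: "0 < \<rho>" "\<rho> < 1" and n: "n > 0"
  shows "((\<lambda>t. g (of_real \<rho> * cis (- t)) * cis (- (real n * t))) has_integral 0) {0..2 * pi}"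
proof -
  define h where "h u = (cnj \<circ> g \<circ> cnj) u * u ^ n" for u
  have "cnj ` ball 0 1 = ball 0 1"
    by (force simp: image_iff intro!: bexI[of _ "cnj _"])
  then have "(cnj \<circ> g \<circ> cnj) holomorphic_on ball 0 1"
    by (intro holomorphic_on_compose_cnj_cnj) (use g in auto)
  then have "h holomorphic_on ball 0 1"
    unfolding h_def by (intro holomorphic_on_mult holomorphic_on_power holomorphic_on_ident)
  from fourier_coefficient_holomorphic[OF this r, of 0]
  have "((\<lambda>t. h (of_real \<rho> * cis t)) has_integral 0) {0..2 * pi}"
    by (simp add: h_def zero_power[OF n])
  then have "((cnj \<circ> (\<lambda>t. h (of_real \<rho> * cis t))) has_integral cnj 0) {0..2 * pi}"
    by (simp only: has_integral_cnj)
  from has_integral_mult_right[OF this, of "1 / of_real \<rho> ^ n"]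
  have "((\<lambda>t. 1 / of_real \<rho> ^ n * (cnj \<circ> (\<lambda>t. h (of_real \<rho> * cis t))) t) has_integral 0) {0..2 * pi}"
    by simp
  also have "(\<lambda>t. 1 / of_real \<rho> ^ n * (cnj \<circ> (\<lambda>t. h (of_real \<rho> * cis t))) t) =
      (\<lambda>t. g (of_real \<rho> * cis (- t)) * cis (- (real n * t)))"
  proof
    fix t
    have "cis (- (real n * t)) = cis (- t) ^ n" using Complex.DeMoivre[of "- t" n] by simp
    then show "1 / of_real \<rho> ^ n * (cnj \<circ> (\<lambda>t. h (of_real \<rho> * cis t))) t = g (of_real \<rho> * cis (- t)) * cis (- (real n * t))"
      using r by (simp add: h_def power_mult_distrib cis_cnj)
  qed
  finally show ?thesis .
qed

text \<open>On each circle the antiholomorphic part \<open>G \<rho>\<close> has no Fourier coefficients of positive index, so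
  those of \<open>g\<close> are bounded by \<open>\<epsilon>\<close>.\<close>

lemma holomorphic_eq_0_if_boundary_antiholomorphic:
  assumes g: "g holomorphic_on ball 0 1" "g 0 = 0"
    and G: "\<And>\<rho>. 0 < \<rho> \<Longrightarrow> \<rho> < 1 \<Longrightarrow> G \<rho> holomorphic_on ball 0 1"
    and bound: "\<And>\<rho> t. 0 < \<rho> \<Longrightarrow> \<rho> < 1 \<Longrightarrow>
      cmod (g (of_real \<rho> * cis t) + G \<rho> (of_real \<rho> * cis (- t))) \<le> \<epsilon> \<rho>"
    and lim: "(\<epsilon> \<longlongrightarrow> 0) (at_left 1)" and q: "cmod q < 1"
  shows "g q = 0"
proof -
  have "(deriv ^^ n) g 0 = 0" for n
  proof (cases "n = 0")
    case True
    then show ?thesis using g by simp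
  next
    case False
    define D where "D = 2 * of_real pi * (deriv ^^ n) g 0 / fact n"
    have b: "cmod (of_real \<rho> ^ n * D) \<le> \<epsilon> \<rho> * (2 * pi)" if r: "0 < \<rho>" "\<rho> < 1" for \<rho>
    proof -
      have "((\<lambda>t. g (of_real \<rho> * cis t) * cis (- (real n * t)) + G \<rho> (of_real \<rho> * cis (- t)) * cis (- (real n * t)))
          has_integral 2 * of_real pi * of_real \<rho> ^ n * (deriv ^^ n) g 0 / fact n + 0) {0..2 * pi}"
        using False by (intro has_integral_add fourier_coefficient_holomorphic[OF g(1) r]
            fourier_coefficient_antiholomorphic[OF G[OF r] r]) simp
      also have "2 * of_real pi * of_real \<rho> ^ n * (deriv ^^ n) g 0 / fact n + 0 = of_real \<rho> ^ n * D"
        by (simp add: D_def)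
      finally have "((\<lambda>t. (g (of_real \<rho> * cis t) + G \<rho> (of_real \<rho> * cis (- t))) * cis (- (real n * t)))
          has_integral of_real \<rho> ^ n * D) (cbox 0 (2 * pi))"
        by (simp only: distrib_right interval_cbox)
      then have "cmod (of_real \<rho> ^ n * D) \<le> \<epsilon> \<rho> * measure lborel (cbox 0 (2 * pi))"
      proof (rule has_integral_bound[rotated])
        show "0 \<le> \<epsilon> \<rho>" using order_trans[OF norm_ge_zero bound[OF r]] .
        show "cmod ((g (of_real \<rho> * cis t) + G \<rho> (of_real \<rho> * cis (- t))) * cis (- (real n * t))) \<le> \<epsilon> \<rho>" for t
          unfolding norm_mult using bound[OF r] by simp
      qed
      then show ?thesis by simp
    qed
    have "((\<lambda>\<rho>. cmod (of_real \<rho> ^ n * D)) \<longlongrightarrow> cmod (of_real 1 ^ n * D)) (at_left 1)"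
      by (intro tendsto_intros)
    moreover have "((\<lambda>\<rho>. \<epsilon> \<rho> * (2 * pi)) \<longlongrightarrow> 0 * (2 * pi)) (at_left 1)"
      by (intro tendsto_intros lim)
    moreover have "eventually (\<lambda>\<rho>. cmod (of_real \<rho> ^ n * D) \<le> \<epsilon> \<rho> * (2 * pi)) (at_left 1)"
      by (rule eventually_at_leftI[of 0]) (use b in auto)
    ultimately have "cmod (of_real 1 ^ n * D) \<le> 0 * (2 * pi)"
      by (intro tendsto_le[OF trivial_limit_at_left_real])
    then show ?thesis by (simp add: D_def)
  qed
  then show ?thesis using holomorphic_fun_eq_0_on_ball[OF g(1), of q] q by simp
qed

section \<open>A maximum principle for periodic functions\<close>

lemma uhp_int_shift:
  obtains n :: int where "\<bar>Re (z + of_int n)\<bar> \<le> 1 / 2" "Im (z + of_int n) = Im z"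
  by (rule that[of "- round (Re z)"]) (use of_int_round_abs_le[of "Re z"] in \<open>simp_all add: abs_minus_commute\<close>)

text \<open>By descent every value is dominated by one at height at least 1/2, and periodicity with
  the limit at the cusp confines the largest values to a compact rectangle. So the modulus attains
  its maximum, and \<open>h\<close> is constant with limit 0.\<close>

lemma vanishes_if_inversion_increases_norm:
  assumes hol: "h holomorphic_on uhp"
    and per: "\<And>z. Im z > 0 \<Longrightarrow> h (z + 1) = h z"
    and inv: "\<And>z. Im z > 0 \<Longrightarrow> cmod z \<le> 1 \<Longrightarrow> cmod (h z) \<le> cmod (h (- 1 / z))"
    and lim: "(h \<longlongrightarrow> 0) (filtercomap Im at_top)" and z: "Im z > 0"
  shows "h z = 0"
proof (rule ccontr)
  assume nz: "h z \<noteq> 0"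
  have perint: "h (z + of_int n) = h z" if "Im z > 0" for z n
    using periodic_int[of h, OF per] that by blast
  have "(\<exists>z0. Im z0 \<ge> 1 / 2 \<and> cmod (h z) \<le> cmod (h z0))" if "Im z > 0" for z
    using that
  proof (induction z rule: uhp_descent)
    case (shift z n)
    then show ?case using perint by metis
  next
    case (inversion z)
    then show ?case using inv order_trans by blast
  qed auto
  from this[OF z] obtain z1 where "Im z1 \<ge> 1 / 2" "cmod (h z) \<le> cmod (h z1)" by blast
  then have z1: "Im z1 \<ge> 1 / 2" "h z1 \<noteq> 0" using nz by auto
  \<comment> \<open>Comparison with a nonzero value at height at least 1/2 shows that no maximum
    occurs above \<open>Y\<close>.\<close>
  obtain Y where Y: "\<And>z. Im z \<ge> Y \<Longrightarrow> cmod (h z) < cmod (h z1)"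
    using tendstoD[OF lim, of "cmod (h z1)"] z1(2) by (auto simp: eventually_filtercomap_at_top_linorder)
  define K where "K = cbox (Complex (- 1 / 2) (1 / 2)) (Complex (1 / 2) Y)"
  have inK: "z \<in> K \<longleftrightarrow> \<bar>Re z\<bar> \<le> 1 / 2 \<and> 1 / 2 \<le> Im z \<and> Im z \<le> Y" for z
    by (auto simp: K_def in_cbox_complex_iff)
  obtain n1 where n1: "\<bar>Re (z1 + of_int n1)\<bar> \<le> 1 / 2" "Im (z1 + of_int n1) = Im z1"
    by (rule uhp_int_shift)
  have hz1: "h (z1 + of_int n1) = h z1" using perint[of z1 n1] z1 by simp
  have "Im z1 < Y" using Y[of z1] by fastforce
  then have "z1 + of_int n1 \<in> K" using n1 z1 by (auto simp: inK)
  moreover have "compact K" by (simp add: K_def)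
  moreover have "continuous_on K (\<lambda>z. cmod (h z))"
    by (intro continuous_on_norm holomorphic_on_imp_continuous_on holomorphic_on_subset[OF hol])
      (auto simp: inK)
  ultimately obtain z0 where z0: "z0 \<in> K" "\<And>z. z \<in> K \<Longrightarrow> cmod (h z) \<le> cmod (h z0)"
    using continuous_attains_sup[of K "\<lambda>z. cmod (h z)"] by blast
  have z10: "cmod (h z1) \<le> cmod (h z0)" using z0(2)[OF \<open>z1 + of_int n1 \<in> K\<close>] hz1 by simp
  have max: "cmod (h z) \<le> cmod (h z0)" if "Im z > 0" for z
    using that
  proof (induction z rule: uhp_descent)
    case (high z)
    obtain n where n: "\<bar>Re (z + of_int n)\<bar> \<le> 1 / 2" "Im (z + of_int n) = Im z"
      by (rule uhp_int_shift)
    have hz: "h (z + of_int n) = h z" using perint[of z n] high by simp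
    show ?case
    proof (cases "Im z \<le> Y")
      case True
      then have "z + of_int n \<in> K" using n high by (auto simp: inK)
      from z0(2)[OF this] show ?thesis by (simp only: hz)
    next
      case False
      then have "cmod (h z) < cmod (h z1)" by (intro Y) simp
      then show ?thesis using z10 by simp
    qed
  next
    case (shift z n)
    then show ?case by (simp only: perint)
  next
    case (inversion z)
    show ?case by (rule order_trans[OF inv inversion(3)]) (use inversion in auto)
  qed
  have z0u: "z0 \<in> uhp" using z0(1) by (auto simp: inK)
  have "h constant_on uhp"
    by (rule maximum_modulus_principle[OF hol uhp_open uhp_connected uhp_open order_refl z0u]) (use max in auto)
  then obtain c where c: "\<And>z. Im z > 0 \<Longrightarrow> h z = c" by (auto simp: constant_on_def)
  have "h (\<i> * of_real (max Y 1)) = h z1"   proof -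
    have "h (\<i> * of_real (max Y 1)) = c" by (rule c) simp
    moreover have "h z1 = c" by (rule c) (use z1 in simp)
    ultimately show ?thesis by simp
  qed
  moreover have "cmod (h (\<i> * of_real (max Y 1))) < cmod (h z1)" by (rule Y) simp
  ultimately show False by simp
qed

section \<open>The Eichler integral on the diagonal x = z, y = 1\<close>

context even_cusp_form begin

text \<open>On the diagonal the argument x grows with u, so a bound uniform in x is required. Half
  of the exponential decay is spent on the power of x.\<close>

lemma EI_strip_bound:
  assumes "m \<ge> 1"
  shows "\<exists>B>0. \<forall>u x y. Im u \<ge> 1 / 2 \<longrightarrow> \<bar>Re u\<bar> \<le> 1 \<longrightarrow> cmod x \<le> m + Im u \<longrightarrow> cmod y \<le> 1 \<longrightarrow>
    cmod (EI u x y) \<le> B * exp (- Im u / 2)"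
proof -
  obtain C where C: "\<And>n. C n > 0"
    "\<And>n z. Im z \<ge> 1 / 2 \<Longrightarrow> \<bar>Re z\<bar> \<le> 1 \<Longrightarrow> cmod (Em n z) \<le> C n * exp (- Im z)"
    using Em_decay[of 1] by (metis zero_le_one)
  define S where "S = (\<Sum>n\<le>w. real (w choose n) * C n)"
  have "S > 0" unfolding S_def by (rule sum_pos) (use C(1) in auto)
  \<comment> \<open>Comes from (m + t)^w = 2^w ((m + t)/2)^w and \<open>pow_le_fact_exp\<close> at
    (m + t)/2, where t is the height.\<close>
  define A where "A = 2 ^ w * (fact w * exp (m / 2))"
  have A: "A > 0" by (simp add: A_def)
  show ?thesis
  proof (intro exI[of _ "S * A"] conjI allI impI)
    show "S * A > 0" using \<open>S > 0\<close> A by simp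
    fix u x y assume u: "Im u \<ge> 1 / 2" "\<bar>Re u\<bar> \<le> 1" and x: "cmod x \<le> m + Im u" and y: "cmod y \<le> 1"
    let ?t = "Im u"
    have mt: "m + ?t \<ge> 1" using u assms by simp
    have "(m + ?t) ^ w = 2 ^ w * ((m + ?t) / 2) ^ w" by (simp add: power_divide)
    also have "\<dots> \<le> 2 ^ w * (fact w * exp ((m + ?t) / 2))"
      using mt by (intro mult_left_mono pow_le_fact_exp) auto
    also have "\<dots> = A * exp (?t / 2)" by (simp add: A_def add_divide_distrib exp_add)
    finally have pw: "(m + ?t) ^ w \<le> A * exp (?t / 2)" .
    have term_le: "cmod (of_nat (w choose n) * y ^ n * (- x) ^ (w - n) * Em n u)
        \<le> real (w choose n) * C n * ((m + ?t) ^ w * exp (- ?t))" for n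
    proof -
      have "cmod y ^ n \<le> 1" using y by (simp add: power_le_one)
      moreover have "cmod x ^ (w - n) \<le> (m + ?t) ^ w"
      proof -
        have "cmod x ^ (w - n) \<le> (m + ?t) ^ (w - n)" using x by (intro power_mono) auto
        also have "\<dots> \<le> (m + ?t) ^ w" using mt by (intro power_increasing) auto
        finally show ?thesis .
      qed
      ultimately have "cmod y ^ n * cmod x ^ (w - n) * cmod (Em n u) \<le> 1 * (m + ?t) ^ w * (C n * exp (- ?t))"
        using C(2)[OF u] mt by (intro mult_mono) auto
      then have "real (w choose n) * (cmod y ^ n * cmod x ^ (w - n) * cmod (Em n u))
          \<le> real (w choose n) * (1 * (m + ?t) ^ w * (C n * exp (- ?t)))"
        by (intro mult_left_mono) auto
      then show ?thesis by (simp add: norm_mult norm_power mult_ac)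
    qed
    have "cmod (EI u x y) \<le> (\<Sum>n\<le>w. real (w choose n) * C n * ((m + ?t) ^ w * exp (- ?t)))"
      unfolding EI_def by (rule order_trans[OF norm_sum sum_mono[OF term_le]])
    also have "\<dots> = S * ((m + ?t) ^ w * exp (- ?t))" by (simp only: S_def sum_distrib_right)
    also have "\<dots> \<le> S * (A * exp (?t / 2) * exp (- ?t))"
      using pw \<open>S > 0\<close> by (intro mult_left_mono mult_right_mono) auto
    also have "\<dots> = S * A * exp (- ?t / 2)"
      by (simp only: mult.assoc exp_add[symmetric]) simp
    finally show "cmod (EI u x y) \<le> S * A * exp (- Im u / 2)" .
  qed
qed

text \<open>The offset \<open>s\<close> is 0 for the diagonal itself; the value 2 i Y is taken by
  the reflected term of \<open>H\<close> below on the line of height Y.\<close>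

lemma EI_diag_holomorphic: "(\<lambda>u. EI u (u - s) 1) holomorphic_on uhp"
proof -
  have "Em n holomorphic_on uhp" for n
    using Em_deriv by (auto simp: holomorphic_on_open)
  then show ?thesis unfolding EI_def
    by (intro holomorphic_intros)
qed

lemma EI_diag_periodic: "Im u > 0 \<Longrightarrow> EI (u + of_int n) (u + of_int n - s) 1 = EI u (u - s) 1"
  by (subst EI_T) (auto simp: algebra_simps)

lemma EI_diag_lim: "((\<lambda>u. EI u (u - s) 1) \<longlongrightarrow> 0) (filtercomap Im at_top)"
proof -
  have "1 + cmod s \<ge> 1" by simp
  from EI_strip_bound[OF this] obtain B where B: "\<And>u x y. Im u \<ge> 1 / 2 \<Longrightarrow> \<bar>Re u\<bar> \<le> 1 \<Longrightarrow>
    cmod x \<le> 1 + cmod s + Im u \<Longrightarrow> cmod y \<le> 1 \<Longrightarrow> cmod (EI u x y) \<le> B * exp (- Im u / 2)"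
    by blast
  have "cmod (EI u (u - s) 1) \<le> B * exp (- Im u / 2)" if u: "Im u \<ge> 1 / 2" for u
  proof -
    obtain n where n: "\<bar>Re (u + of_int n)\<bar> \<le> 1 / 2" "Im (u + of_int n) = Im u"
      by (rule uhp_int_shift)
    define v where "v = u + of_int n"
    have "cmod (v - s) \<le> cmod v + cmod s" by (rule norm_triangle_ineq4)
    also have "cmod v \<le> \<bar>Re v\<bar> + \<bar>Im v\<bar>" by (rule cmod_le)
    finally have "cmod (EI v (v - s) 1) \<le> B * exp (- Im v / 2)"
      using n u by (intro B) (auto simp: v_def)
    moreover have "EI v (v - s) 1 = EI u (u - s) 1" unfolding v_def using u by (intro EI_diag_periodic) simp
    ultimately show ?thesis using n by (simp add: v_def)
  qed
  then have "\<forall>\<^sub>F u in filtercomap Im at_top. cmod (EI u (u - s) 1) \<le> B * exp (- Im u / 2)"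
    unfolding eventually_filtercomap_at_top_linorder by (intro exI[of _ "1 / 2"]) auto
  moreover have "((\<lambda>t. B * exp (- t / 2)) \<longlongrightarrow> 0) at_top" by real_asymp
  then have "((\<lambda>u. B * exp (- Im u / 2)) \<longlongrightarrow> 0) (filtercomap Im at_top)"
    by (rule filterlim_filtercomapI)
  ultimately show ?thesis by (rule Lim_null_comparison)
qed

text \<open>\<open>EI z z 1\<close> is the integral of f(tau) (tau - z)^w, and the local
  \<open>h m\<close> has the exponent m instead of w. For positive exponent the boundary term of the
  derivative contains a power of z - z, so differentiation only lowers the exponent, step by step
  down to \<open>Em 0\<close>, whose derivative is - f.\<close>

lemma f_eq_0_if_EI_diag_eq_0:
  assumes 0: "\<And>z. Im z > 0 \<Longrightarrow> EI z z 1 = 0" and z: "Im z > 0"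
  shows "f z = 0"
proof -
  define h where "h m z = (\<Sum>n\<le>m. of_nat (m choose n) * (- z) ^ (m - n) * Em n z)" for m z
  have arith: "a * (b * - (c * x) + - (y * p) * q) = - c * (a * x * b) - a * y * p * q"
    for a b c x y p q :: complex by (simp add: algebra_simps)
  have d: "((\<lambda>z. (- z) ^ m) has_field_derivative - (of_nat m * (- z) ^ (m - 1))) (at z)" for m and z :: complex
    using DERIV_power[OF DERIV_minus[OF DERIV_ident], of m z UNIV] by simp
  have h_deriv: "(h (Suc m) has_field_derivative - (of_nat (Suc m) * h m z)) (at z)" if z: "Im z > 0" for m z
  proof -
    have "(h (Suc m) has_field_derivative
        (\<Sum>n\<le>Suc m. of_nat (Suc m choose n) * ((- z) ^ (Suc m - n) * - (f z * z ^ n) +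
          - (of_nat (Suc m - n) * (- z) ^ (Suc m - n - 1)) * Em n z))) (at z)"
      unfolding h_def mult.assoc
      by (intro DERIV_sum DERIV_cmult DERIV_mult' d Em_deriv z)
    also have "(\<Sum>n\<le>Suc m. of_nat (Suc m choose n) * ((- z) ^ (Suc m - n) * - (f z * z ^ n) +
          - (of_nat (Suc m - n) * (- z) ^ (Suc m - n - 1)) * Em n z)) =
       - f z * (\<Sum>n\<le>Suc m. of_nat (Suc m choose n) * z ^ n * (- z) ^ (Suc m - n)) -
       (\<Sum>n\<le>Suc m. of_nat (Suc m choose n) * of_nat (Suc m - n) * (- z) ^ (Suc m - n - 1) * Em n z)"
      unfolding sum_distrib_left sum_subtractf[symmetric] by (rule sum.cong[OF refl], rule arith)
    also have "(\<Sum>n\<le>Suc m. of_nat (Suc m choose n) * z ^ n * (- z) ^ (Suc m - n)) = 0"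
      by (simp only: binomial_ring[symmetric]) simp
    also have "(\<Sum>n\<le>Suc m. of_nat (Suc m choose n) * of_nat (Suc m - n) * (- z) ^ (Suc m - n - 1) * Em n z) =
        of_nat (Suc m) * h m z"
    proof -
      have "(of_nat (Suc m choose n) * of_nat (Suc m - n) :: complex) = of_nat (Suc m) * of_nat (m choose n)"
        if "n \<le> m" for n
      proof -
        have "(Suc m choose n) * (Suc m - n) = Suc m * (m choose n)"
          using binomial_absorb_comp[of "Suc m" n] by (simp add: mult.commute)
        then show ?thesis by (metis of_nat_mult)
      qed
      then have "(\<Sum>n\<le>m. of_nat (Suc m choose n) * of_nat (Suc m - n) * (- z) ^ (Suc m - n - 1) * Em n z) =
        (\<Sum>n\<le>m. of_nat (Suc m) * (of_nat (m choose n) * (- z) ^ (m - n) * Em n z))"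
        by (intro sum.cong) (auto simp: Suc_diff_le mult.assoc)
      then show ?thesis by (simp only: sum.atMost_Suc h_def sum_distrib_left) simp
    qed
    finally show ?thesis by (simp only: mult_zero_right diff_0)
  qed
  have step: "h m z = 0" if "\<And>z. Im z > 0 \<Longrightarrow> h (Suc m) z = 0" and z: "Im z > 0" for m z
  proof -
    have "(h (Suc m) has_field_derivative 0) (at z)"
      by (rule has_field_derivative_transform_within_open[of "\<lambda>_. 0", OF _ uhp_open]) (use that in auto)
    from DERIV_unique[OF this h_deriv[OF z]] have "of_nat (Suc m) * h m z = 0"
      by (metis neg_0_equal_iff_equal)
    then show ?thesis by (simp only: mult_eq_0_iff of_nat_eq_0_iff) simp
  qed
  have "h (w - j) z = 0" if "Im z > 0" for j z
    using that
  proof (induction j arbitrary: z)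
    case 0
    have "h w z = EI z z 1" by (simp add: h_def EI_def)
    then show ?case using 0 assms(1) by simp
  next
    case (Suc j)
    show ?case
    proof (cases "j < w")
      case True
      then have "w - j = Suc (w - Suc j)" by simp
      then show ?thesis using Suc step[of "w - Suc j" z] by simp
    next
      case False
      then show ?thesis using Suc by simp
    qed
  qed
  from this[of _ w] have Em0: "Em 0 z = 0" if "Im z > 0" for z using that by (simp add: h_def)
  have "(Em 0 has_field_derivative 0) (at z)"
    by (rule has_field_derivative_transform_within_open[OF DERIV_const uhp_open]) (use z Em0 in auto)
  from DERIV_unique[OF this Em_deriv[OF z]] show ?thesis by simp
qed


text \<open>For w = 0 a function of weight - w need not decay at the real line. But then
  \<open>r\<close> is 0, so \<open>Em 0\<close> is invariant under inversion.\<close>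

lemma f_eq_0_weight_2:
  assumes "w = 0" and z: "Im z > 0"
  shows "f z = 0"
proof (rule f_eq_0_if_EI_diag_eq_0[OF _ z])
  have E: "EI u x y = Em 0 u" for u x y using \<open>w = 0\<close> by (simp add: EI_def)
  fix z :: complex assume z: "Im z > 0"
  have "EI z (z - 0) 1 = 0"
  proof (rule vanishes_if_inversion_increases_norm[of "\<lambda>u. EI u (u - 0) 1", OF EI_diag_holomorphic _ _ EI_diag_lim z])
    show "EI (z + 1) (z + 1 - 0) 1 = EI z (z - 0) 1" if "Im z > 0" for z
      using EI_diag_periodic[OF that, of 1 0] by simp
    show "cmod (EI z (z - 0) 1) \<le> cmod (EI (- 1 / z) (- 1 / z - 0) 1)" if "Im z > 0" for z
      using EI_S[OF that, of 0 0] by (simp add: E r_def)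
  qed
  then show "EI z z 1 = 0" by simp
qed

lemma b_w: "w > 0 \<Longrightarrow> b w = - b 0"
proof -
  assume w: "w > 0"
  have "r 0 (- 1) = - r 1 0" by (rule r_antisym)
  moreover have "r 0 (- 1) = b w"
  proof -
    have "r 0 (- 1) = (\<Sum>n\<le>w. if n = w then b w else 0)"
      unfolding r_poly by (rule sum.cong) (use even_w in auto)
    then show ?thesis by simp
  qed
  moreover have "r 1 0 = b 0"
  proof -
    have "r 1 0 = (\<Sum>n\<le>w. if n = 0 then b 0 else 0)"
      unfolding r_poly by (rule sum.cong) auto
    then show ?thesis by simp
  qed
  ultimately show "b w = - b 0" by simp
qed

lemma even_part_eq:
  assumes w: "w > 0" and 0: "\<And>n. even n \<Longrightarrow> 2 \<le> n \<Longrightarrow> n + 2 \<le> w \<Longrightarrow> b n = 0"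
  shows "r x y + r x (- y) = 2 * b 0 * (x ^ w - y ^ w)"
proof -
  have "r x y + r x (- y) = (\<Sum>n\<le>w. b n * x ^ (w - n) * (y ^ n + (- y) ^ n))"
    unfolding r_poly sum.distrib[symmetric] by (intro sum.cong) (auto simp: distrib_left)
  also have "\<dots> = (\<Sum>n\<in>{0, w}. b n * x ^ (w - n) * (y ^ n + (- y) ^ n))"
  proof (rule sum.mono_neutral_right)
    show "\<forall>n\<in>{..w} - {0, w}. b n * x ^ (w - n) * (y ^ n + (- y) ^ n) = 0"
    proof
      fix n assume n: "n \<in> {..w} - {0, w}"
      show "b n * x ^ (w - n) * (y ^ n + (- y) ^ n) = 0"
      proof (cases "even n")
        case True
        have "n + 2 \<le> w" "2 \<le> n"
          using n True even_w by (auto elim!: evenE)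
        then have "b n = 0" using True 0 by simp
        then show ?thesis by simp
      qed simp
    qed
  qed auto
  also have "\<dots> = b 0 * x ^ w * 2 + b w * (y ^ w + (- y) ^ w)" using w by simp
  also have "(- y) ^ w = y ^ w" using even_w by simp
  finally show ?thesis using b_w[OF w] by (simp add: algebra_simps)
qed

text \<open>If the even part of \<open>r\<close> is a coboundary, then adding a constant to the even part of the Eichler
  integral on the diagonal gives a function that transforms with weight \<open>- w\<close>, hence tends to \<open>0\<close> at
  the real line. Its holomorphic part then vanishes, because the other part is antiholomorphic on horizontal
  lines.\<close>

lemma f_eq_0_if_even_part_coboundary:
  assumes w: "w > 0" and cob: "\<And>x y. r x y + r x (- y) = c * (x ^ w - y ^ w)" and z: "Im z > 0"
  shows "f z = 0"
proof (rule f_eq_0_if_EI_diag_eq_0[OF _ z])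
  \<comment> \<open>The second summand is the counterpart for -y: the reflection z -> - cnj z
    commutes with inversion and reverses translations, as y = -1 does. The constant absorbs the
    coboundary, whose value at (-1/z, 1) is c / z^w - c.\<close>
  define H where "H z = EI z z 1 + EI (- cnj z) z (- 1) + c" for z
  have H_T: "H (z + of_int n) = H z" if "Im z > 0" for z n
  proof -
    have "- cnj (z + of_int n) = - cnj z + of_int (- n)" by simp
    then have "EI (- cnj (z + of_int n)) (z + of_int n) (- 1) = EI (- cnj z) z (- 1)"
      using EI_T[of "- cnj z" "- n" "z + of_int n" "- 1"] that by simp
    moreover have "EI (z + of_int n) (z + of_int n) 1 = EI z z 1"
      using EI_diag_periodic[OF that, of n 0] by simp
    ultimately show ?thesis by (simp add: H_def)
  qed
  have H_S: "H (- 1 / z) = H z / z ^ w" if z: "Im z > 0" for z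
  proof -
    have z0: "z \<noteq> 0" using z by auto
    have scale: "EI u (a / z) (d / z) = EI u a d / z ^ w" for u a d
      using EI_scale[of u "1 / z" a d] by (simp add: power_divide)
    have "EI (- 1 / z) (- 1 / z) 1 = EI z 1 (1 / z) + r (- 1 / z) 1"
      using EI_S[OF z, of "- 1 / z" 1] by simp
    also have "EI z 1 (1 / z) = EI z z 1 / z ^ w" using scale[of z z 1] z0 by simp
    finally have 1: "EI (- 1 / z) (- 1 / z) 1 = EI z z 1 / z ^ w + r (- 1 / z) 1" .
    have "- cnj (- 1 / z) = - 1 / (- cnj z)" by simp
    then have "EI (- cnj (- 1 / z)) (- 1 / z) (- 1) = EI (- 1 / (- cnj z)) (- 1 / z) (- 1)" by (simp only:)
    also have "\<dots> = EI (- cnj z) (- 1) (- (- 1 / z)) + r (- 1 / z) (- 1)"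
      by (rule EI_S) (use z in simp)
    also have "EI (- cnj z) (- 1) (- (- 1 / z)) = EI (- cnj z) (- z) 1 / z ^ w"
      using scale[of "- cnj z" "- z" 1] z0 by simp
    also have "EI (- cnj z) (- z) 1 = EI (- cnj z) z (- 1)" using EI_minus[of "- cnj z" z "- 1"] by simp
    finally have 2: "EI (- cnj (- 1 / z)) (- 1 / z) (- 1) = EI (- cnj z) z (- 1) / z ^ w + r (- 1 / z) (- 1)" .
    have "(- 1 / z) ^ w = 1 / z ^ w" using even_w by (simp add: power_divide)
    then have "r (- 1 / z) 1 + r (- 1 / z) (- 1) = c / z ^ w - c"
      unfolding cob by (simp add: algebra_simps)
    then have "r (- 1 / z) 1 = c / z ^ w - c - r (- 1 / z) (- 1)" by (simp only: eq_diff_eq)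
    then show ?thesis unfolding H_def 1 2 by (simp only: add_divide_distrib) simp
  qed
  obtain h where h: "w = 2 * h" using even_w by blast
  obtain B where B: "B > 0" "\<And>u x y. Im u \<ge> 1 / 2 \<Longrightarrow> \<bar>Re u\<bar> \<le> 1 \<Longrightarrow>
      cmod x \<le> 1 + Im u \<Longrightarrow> cmod y \<le> 1 \<Longrightarrow> cmod (EI u x y) \<le> B * exp (- Im u / 2)"
    using EI_strip_bound[of 1] by auto
  \<comment> \<open>At height 1/2 or more, 2 Im z >= 1, so the factor 2^h converts a constant bound
    into a multiple of (Im z)^h.\<close>
  define K where "K = (2 * B + cmod c) * 2 ^ h"
  have K0: "2 * B + cmod c \<ge> 0" using B by simp
  \<comment> \<open>The quotient of \<open>cmod (H z)\<close> by (Im z)^h is invariant under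
    translations and inversion, so a bound at height 1/2 or more spreads by descent.\<close>
  have H_bound: "cmod (H z) \<le> K * Im z ^ h" if "Im z > 0" for z
    using that
  proof (induction z rule: uhp_descent)
    case (high z)
    obtain n where n: "\<bar>Re (z + of_int n)\<bar> \<le> 1 / 2" "Im (z + of_int n) = Im z"
      by (rule uhp_int_shift)
    define v where "v = z + of_int n"
    have v: "Im v \<ge> 1 / 2" "\<bar>Re v\<bar> \<le> 1" "Im v = Im z" using n high by (auto simp: v_def)
    have cv: "cmod v \<le> 1 + Im v" using cmod_le[of v] v by linarith
    have e1: "B * exp (- Im v / 2) \<le> B * 1" using v B by (intro mult_left_mono) auto
    have "cmod (EI v v 1) \<le> B" using B(2)[OF v(1,2) cv, of 1] e1 by simp
    moreover have "cmod (EI (- cnj v) v (- 1)) \<le> B"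
      using B(2)[of "- cnj v" v "- 1"] v cv e1 by simp
    ultimately have "cmod (H v) \<le> 2 * B + cmod c"
      unfolding H_def by (intro norm_triangle_le order_trans[OF add_mono[OF norm_triangle_ineq order_refl]]) linarith
    moreover have "H v = H z" using H_T[of z n] high by (simp add: v_def)
    moreover have "1 \<le> (2 * Im z) ^ h" using high by (intro one_le_power) auto
    then have "2 * B + cmod c \<le> (2 * B + cmod c) * (2 * Im z) ^ h"
      using K0 mult_left_mono[of 1 "(2 * Im z) ^ h"] by simp
    ultimately show ?case by (simp add: K_def power_mult_distrib)
  next
    case (shift z n)
    then show ?case by (simp only: H_T) simp
  next
    case (inversion z)
    have z0: "z \<noteq> 0" using inversion by auto
    have "H z = z ^ w * H (- 1 / z)" using H_S[OF inversion(1)] z0 by simp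
    then have "cmod (H z) = cmod z ^ w * cmod (H (- 1 / z))" by (simp add: norm_mult norm_power)
    also have "\<dots> \<le> cmod z ^ w * (K * (Im z / (cmod z)\<^sup>2) ^ h)"
      using inversion(3) unfolding Im_minus_inverse by (intro mult_left_mono) auto
    also have "\<dots> = K * Im z ^ h" using z0 by (simp add: h power_mult power_divide)
    finally show ?case .
  qed
  have exq: "\<exists>g. g holomorphic_on ball 0 1 \<and> g 0 = 0 \<and>
      (\<forall>u. Im u > 0 \<longrightarrow> EI u (u - s) 1 = g (exp (2 * of_real pi * \<i> * u)))" for s
  proof -
    have "EI (u + 1) (u + 1 - s) 1 = EI u (u - s) 1" if "Im u > 0" for u
      using EI_diag_periodic[OF that, of 1 s] by simp
    from q_expansion[OF EI_diag_holomorphic this EI_diag_lim] show ?thesis by metis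
  qed
  define g where "g s = (SOME g. g holomorphic_on ball 0 1 \<and> g 0 = 0 \<and>
      (\<forall>u. Im u > 0 \<longrightarrow> EI u (u - s) 1 = g (exp (2 * of_real pi * \<i> * u))))" for s
  have g: "g s holomorphic_on ball 0 1" "g s 0 = 0"
    "Im u > 0 \<Longrightarrow> EI u (u - s) 1 = g s (exp (2 * of_real pi * \<i> * u))" for s u
    using someI_ex[OF exq[of s]] by (auto simp: g_def)
  \<comment> \<open>The height at which exp (2 pi i z) has modulus rho.\<close>
  define Y where "Y \<rho> = - ln \<rho> / (2 * pi)" for \<rho> :: real
  have g0: "g 0 q = 0" if "cmod q < 1" for q
  proof (rule holomorphic_eq_0_if_boundary_antiholomorphic[where g = "g 0" and q = q
        and G = "\<lambda>\<rho> u. g (2 * \<i> * of_real (Y \<rho>)) u + c" and \<epsilon> = "\<lambda>\<rho>. K * Y \<rho> ^ h"])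
    show "g 0 holomorphic_on ball 0 1" "g 0 0 = 0" by (fact g)+
    show "(\<lambda>u. g (2 * \<i> * of_real (Y \<rho>)) u + c) holomorphic_on ball 0 1" for \<rho>
      by (intro holomorphic_on_add holomorphic_on_const g)
    have "h > 0" using w h by simp
    have "((\<lambda>\<rho>::real. K * Y \<rho> ^ h) \<longlongrightarrow> K * (- ln 1 / (2 * pi)) ^ h) (at_left 1)"
      unfolding Y_def by (intro tendsto_intros) auto
    then show "((\<lambda>\<rho>. K * Y \<rho> ^ h) \<longlongrightarrow> 0) (at_left 1)" using \<open>h > 0\<close> by (simp add: zero_power)
    fix \<rho> t :: real assume r: "0 < \<rho>" "\<rho> < 1"
    define z where "z = Complex (t / (2 * pi)) (Y \<rho>)"
    have Y: "Y \<rho> > 0" using r by (simp add: Y_def divide_neg_pos)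
    have z: "Im z > 0" "Im z = Y \<rho>" using Y by (auto simp: z_def)
    have q: "exp (2 * of_real pi * \<i> * Complex (a / (2 * pi)) (Y \<rho>)) = of_real \<rho> * cis a" for a
    proof -
      have "2 * of_real pi * \<i> * Complex (a / (2 * pi)) (Y \<rho>) = Complex (ln \<rho>) a"
        by (simp add: complex_eq_iff Y_def)
      then show ?thesis using r by (simp add: exp_eq_polar)
    qed
    have c: "- cnj z = Complex (- t / (2 * pi)) (Y \<rho>)" by (simp add: z_def complex_eq_iff)
    have "EI z z 1 = g 0 (of_real \<rho> * cis t)"
      using g(3)[OF z(1), of 0] q[of t] by (simp add: z_def)
    \<comment> \<open>On this line the reflected point u = - cnj z satisfies - z = u - 2 i Y, so the
      term is a holomorphic function of exp (2 pi i u), the conjugate of exp (2 pi i z).\<close>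
    moreover have "EI (- cnj z) z (- 1) = g (2 * \<i> * of_real (Y \<rho>)) (of_real \<rho> * cis (- t))"
    proof -
      have "- cnj z - 2 * \<i> * of_real (Y \<rho>) = - z" by (simp add: z_def complex_eq_iff)
      moreover have "Im (- cnj z) > 0" using z by simp
      ultimately have "EI (- cnj z) (- z) 1 = g (2 * \<i> * of_real (Y \<rho>)) (exp (2 * of_real pi * \<i> * (- cnj z)))"
        using g(3)[of "- cnj z" "2 * \<i> * of_real (Y \<rho>)"] by simp
      also have "exp (2 * of_real pi * \<i> * (- cnj z)) = of_real \<rho> * cis (- t)" unfolding c by (rule q)
      finally show ?thesis using EI_minus[of "- cnj z" z "- 1"] by simp
    qed
    ultimately have "g 0 (of_real \<rho> * cis t) + (g (2 * \<i> * of_real (Y \<rho>)) (of_real \<rho> * cis (- t)) + c) = H z"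
      by (simp add: H_def)
    then show "cmod (g 0 (of_real \<rho> * cis t) + (g (2 * \<i> * of_real (Y \<rho>)) (of_real \<rho> * cis (- t)) + c)) \<le> K * Y \<rho> ^ h"
      using H_bound[OF z(1)] z(2) by simp
  qed fact
  show "EI z z 1 = 0" if "Im z > 0" for z
  proof -
    have "cmod (exp (2 * of_real pi * \<i> * z)) < 1" using that by (simp add: norm_exp_eq_Re)
    from g0[OF this] g(3)[OF that, of 0] show ?thesis by simp
  qed
qed

lemma f_eq_0_if_even_coeffs_eq_0:
  assumes "\<And>n. even n \<Longrightarrow> 2 \<le> n \<Longrightarrow> n + 2 \<le> w \<Longrightarrow> b n = 0" and "Im z > 0"
  shows "f z = 0"
proof (cases "w = 0")
  case False
  then have "w > 0" by simp
  show ?thesis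
    by (rule f_eq_0_if_even_part_coboundary[OF \<open>w > 0\<close> even_part_eq[OF \<open>w > 0\<close> assms(1)] assms(2)])
qed (use f_eq_0_weight_2 assms(2) in blast)

end

text \<open>For |z| <= 1 and k <= 0 the factor |z|^k is at least 1, so inversion does not decrease
  the modulus of \<open>f\<close>.\<close>

lemma cusp_form_nonpos_weight_eq_0:
  assumes cusp: "cusp_form k f" and k: "k \<le> 0" and z: "Im z > 0"
  shows "f z = 0"
proof (rule vanishes_if_inversion_increases_norm[OF cusp_form_hol[OF cusp] cusp_form_T[OF cusp] _ cusp_form_lim[OF cusp] z])
  fix z :: complex assume z: "Im z > 0" "cmod z \<le> 1"
  have z0: "cmod z > 0" using z by auto
  have "1 \<le> cmod z powi k"
  proof -
    have "cmod z powi 0 \<le> cmod z powi k" using z0 z k by (intro power_int_decreasing) auto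
    then show ?thesis by simp
  qed
  then have "1 * cmod (f z) \<le> cmod z powi k * cmod (f z)" by (intro mult_right_mono) auto
  then show "cmod (f z) \<le> cmod (f (- 1 / z))"
    using cusp_form_S[OF cusp z(1)] by (simp add: norm_mult norm_power_int)
qed


section \<open>Hecke action on the even period polynomial\<close>

lemma coeff_one_plus_X_power: "coeff ([:1, 1:] ^ n) j = (of_nat (n choose j) :: complex)"
proof (cases "j \<le> n")
  case True
  then show ?thesis using coeff_linear_poly_power[of j n "1 :: complex" 1] by simp
next
  case False
  have "degree ([:1, 1 :: complex:] ^ n) \<le> n" using degree_power_le[of "[:1, 1 :: complex:]" n] by simp
  then show ?thesis using False by (simp add: coeff_eq_0 binomial_eq_0)
qed

context even_cusp_form begin

text \<open>The even part of \<open>r\<close>; since w is even, parity in y is parity in both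
  variables.\<close>

definition q :: "complex \<Rightarrow> complex \<Rightarrow> complex" where
  "q x y = (\<Sum>n\<le>w. (if even n then b n else 0) * x ^ (w - n) * y ^ n)"

lemma r_even_part: "r x y + r x (- y) = 2 * q x y"
  unfolding r_poly q_def sum.distrib[symmetric] sum_distrib_left
  by (intro sum.cong) auto

lemma q_eq: "q x y = (r x y + r x (- y)) / 2"
  by (simp add: r_even_part)

lemma q_minus_right: "q x (- y) = q x y"
  by (simp add: q_eq add.commute)

lemma q_antisym: "q y x = - q x y"
  using r_antisym[of y x] r_antisym[of y "- x"] r_minus[of x "- y"] r_minus[of x y]
  by (simp add: q_eq field_simps)

text \<open>The second form of the relation for \<open>r\<close>, taken at -y, has the arguments of
  the first up to a sign in the second variable, so the sum of the two pairs up even parts.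
  \<open>q_hecke_2\<close> uses the two forms of \<open>r_hecke_2\<close> in the same way.\<close>

lemma q_three_term: "q x (x + y) + q (x + y) y = q x y"
proof -
  have "r x y = r (x + y) y + r x (x + y)" by (rule r_three_term)
  moreover have "r x (- y) = r (x + y) (- y) + r x (- (x + y))"
  proof -
    have "- y - x = - (x + y)" by simp
    with r_three_term'[of x "- y"] show ?thesis by (simp only: diff_minus_eq_add)
  qed
  ultimately show ?thesis by (simp add: q_eq field_simps)
qed

lemma q_hecke_2:
  assumes "hecke_eigenvalue k 2 f l"
  shows "l * q x y = q (2 * x) y + q x (2 * y) + q (x + y) (2 * y) + q (2 * x) (x + y)"
proof -
  have "l * r x y = r (2 * x) y + r x (2 * y) + r (x + y) (2 * y) + r (2 * x) (x + y)"
    by (rule r_hecke_2[OF assms])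
  moreover have "l * r x (- y) = r (2 * x) (- y) + r x (- (2 * y)) + r (x + y) (- (2 * y)) + r (2 * x) (- (x + y))"
  proof -
    have "- y - x = - (x + y)" by simp
    with r_hecke_2(2)[OF assms, of x "- y"] show ?thesis by (simp only: diff_minus_eq_add mult_minus_right)
  qed
  ultimately have "l * (r x y + r x (- y)) = (r (2 * x) y + r (2 * x) (- y)) + (r x (2 * y) + r x (- (2 * y)))
     + (r (x + y) (2 * y) + r (x + y) (- (2 * y))) + (r (2 * x) (x + y) + r (2 * x) (- (x + y)))"
    by (simp add: distrib_left)
  then have "2 * (l * q x y) = 2 * (q (2 * x) y + q x (2 * y) + q (x + y) (2 * y) + q (2 * x) (x + y))"
    unfolding r_even_part by (simp add: mult_ac distrib_left)
  then show ?thesis by (subst (asm) mult_left_cancel) simp_all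
qed

lemma q_hecke_3:
  assumes "hecke_eigenvalue k 3 f l"
  shows "l * q x y = q (3 * x) y + q x (3 * y) + (q (x + y) (3 * y) + q (3 * x) (x + y))
    + (q (x - y) (3 * y) + q (3 * x) (x - y))"
proof -
  have "l * r x y = r (3 * x) y + r x (3 * y) + r (x + y) (3 * y) + r (3 * x) (x + y)
    + r (x - y) (3 * y) + r (3 * x) (- (x - y))"
    using r_hecke_3[OF assms, of x y] by simp
  moreover have "l * r x (- y) = r (3 * x) (- y) + r x (- (3 * y)) + r (x - y) (- (3 * y)) + r (3 * x) (x - y)
    + r (x + y) (- (3 * y)) + r (3 * x) (- (x + y))"
  proof -
    have "- y - x = - (x + y)" by simp
    with r_hecke_3[OF assms, of x "- y"] show ?thesis
      by (simp only: diff_minus_eq_add mult_minus_right) simp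
  qed
  ultimately have "l * (r x y + r x (- y)) = (r (3 * x) y + r (3 * x) (- y)) + (r x (3 * y) + r x (- (3 * y)))
     + ((r (x + y) (3 * y) + r (x + y) (- (3 * y))) + (r (3 * x) (x + y) + r (3 * x) (- (x + y))))
     + ((r (x - y) (3 * y) + r (x - y) (- (3 * y))) + (r (3 * x) (x - y) + r (3 * x) (- (x - y))))"
    unfolding distrib_left by (simp only: add_ac)
  then have "2 * (l * q x y) = 2 * (q (3 * x) y + q x (3 * y) + (q (x + y) (3 * y) + q (3 * x) (x + y))
    + (q (x - y) (3 * y) + q (3 * x) (x - y)))"
    unfolding r_even_part by (simp only: mult_ac distrib_left)
  then show ?thesis by (subst (asm) mult_left_cancel) simp_all
qed

section \<open>Comparison of coefficients at x = 1\<close>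

definition qpoly :: "complex \<Rightarrow> complex poly" where
  "qpoly s = (\<Sum>n\<le>w. monom ((if even n then b n else 0) * s ^ (w - n)) n)"

text \<open>The last two Hecke terms with scale \<open>s\<close>, the second rewritten by
  antisymmetry so that both expand in powers of 1 + y. The scale 1 gives the left side of the three
  term relation.\<close>

definition tpoly :: "complex \<Rightarrow> complex poly" where
  "tpoly s = (\<Sum>n\<le>w. Polynomial.smult ((if even n then b n else 0) * s ^ (w - n))
    ([:1, 1:] ^ n - monom 1 (w - n) * [:1, 1:] ^ n))"

text \<open>With n = m1 - 1 and j = n2 - 1, hence w - j = n1 - 1, the binomial difference is the one
  in \<open>C_entry_eq\<close>.\<close>

definition tcoeff :: "complex \<Rightarrow> nat \<Rightarrow> complex" where
  "tcoeff s j = (\<Sum>n\<le>w. (if even n then b n else 0) * s ^ (w - n) *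
    (of_nat (n choose j) - of_nat (n choose (w - j))))"

lemma poly_qpoly: "poly (qpoly s) y = q s y"
  by (simp add: qpoly_def q_def poly_sum poly_monom)

lemma coeff_qpoly: "even j \<Longrightarrow> j \<le> w \<Longrightarrow> coeff (qpoly s) j = b j * s ^ (w - j)"
  by (simp add: qpoly_def coeff_sum)

lemma poly_tpoly: "poly (tpoly s) y = q s (1 + y) + q (1 + y) (s * y)"
proof -
  have "q (1 + y) (s * y) = - q (s * y) (1 + y)" by (rule q_antisym)
  then show ?thesis
    unfolding q_def tpoly_def
    by (simp add: poly_sum poly_monom right_diff_distrib sum_subtractf power_mult_distrib mult_ac)
qed

lemma coeff_tpoly:
  assumes j: "j \<le> w"
  shows "coeff (tpoly s) j = tcoeff s j"
proof -
  have "coeff (monom 1 (w - n) * [:1, 1:] ^ n :: complex poly) j = of_nat (n choose (w - j))" if n: "n \<le> w" for n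
  proof (cases "j < w - n")
    case True
    then have "n < w - j" by linarith
    then show ?thesis using True by (simp add: coeff_monom_mult binomial_eq_0)
  next
    case False
    \<comment> \<open>The complementary lower index is n - (j - (w - n)) = w - j.\<close>
    then have "n choose (j - (w - n)) = n choose (w - j)"
      using n j by (subst binomial_symmetric) (auto intro: arg_cong[of _ _ "\<lambda>m. n choose m"])
    then show ?thesis using False by (simp add: coeff_monom_mult coeff_one_plus_X_power)
  qed
  then show ?thesis
    unfolding tpoly_def tcoeff_def coeff_sum coeff_smult coeff_diff coeff_one_plus_X_power
    by (intro sum.cong) auto
qed

text \<open>The three term relation at x = 1. It accounts for the summand -1 in
  \<open>lie_const\<close>.\<close>

lemma tcoeff_1:
  assumes "even j" "j \<le> w"
  shows "tcoeff 1 j = b j"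
proof -
  have "tpoly 1 = qpoly 1"
    by (rule poly_ext) (simp add: poly_tpoly poly_qpoly q_three_term[of 1])
  then show ?thesis using coeff_tpoly[OF assms(2), of 1] coeff_qpoly[OF assms, of 1] by simp
qed

lemma tcoeff_hecke_2:
  assumes "hecke_eigenvalue k 2 f l" and j: "even j" "j \<le> w"
  shows "l * b j = (2 ^ (w - j) + 2 ^ j) * b j + tcoeff 2 j"
proof -
  have "Polynomial.smult l (qpoly 1) = qpoly 2 + pcompose (qpoly 1) (monom 2 1) + tpoly 2"
  proof (rule poly_ext)
    fix y
    show "poly (Polynomial.smult l (qpoly 1)) y = poly (qpoly 2 + pcompose (qpoly 1) (monom 2 1) + tpoly 2) y"
      using q_hecke_2[OF assms(1), of 1 y]
      by (simp add: poly_tpoly poly_qpoly poly_pcompose poly_monom)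
  qed
  then have "coeff (Polynomial.smult l (qpoly 1)) j = coeff (qpoly 2 + pcompose (qpoly 1) (monom 2 1) + tpoly 2) j" by simp
  then show ?thesis
    by (simp add: coeff_qpoly[OF j] coeff_tpoly[OF j(2)] coeff_pcompose_monom_linear algebra_simps)
qed

text \<open>The terms in x - y are those in x + y at -y; coefficients of even powers do not see the
  sign, hence the factor 2.\<close>

lemma tcoeff_hecke_3:
  assumes "hecke_eigenvalue k 3 f l" and j: "even j" "j \<le> w"
  shows "l * b j = (3 ^ (w - j) + 3 ^ j) * b j + 2 * tcoeff 3 j"
proof -
  have "Polynomial.smult l (qpoly 1) = qpoly 3 + pcompose (qpoly 1) (monom 3 1) + tpoly 3 + pcompose (tpoly 3) (monom (- 1) 1)"
  proof (rule poly_ext)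
    fix y
    have "q (1 - y) (3 * y) = q (1 + - y) (3 * - y)" using q_minus_right[of "1 - y" "3 * y"] by simp
    then show "poly (Polynomial.smult l (qpoly 1)) y =
        poly (qpoly 3 + pcompose (qpoly 1) (monom 3 1) + tpoly 3 + pcompose (tpoly 3) (monom (- 1) 1)) y"
      using q_hecke_3[OF assms(1), of 1 y]
      by (simp add: poly_tpoly poly_qpoly poly_pcompose poly_monom)
  qed
  then have "coeff (Polynomial.smult l (qpoly 1)) j =
    coeff (qpoly 3 + pcompose (qpoly 1) (monom 3 1) + tpoly 3 + pcompose (tpoly 3) (monom (- 1) 1)) j" by simp
  then show ?thesis using j
    by (simp add: coeff_qpoly[OF j] coeff_tpoly[OF j(2)] coeff_pcompose_monom_linear algebra_simps)
qed

lemma b_reflect: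
  assumes "even j" "j \<le> w"
  shows "b (w - j) = - b j"
proof -
  have "qpoly 1 = - (\<Sum>n\<le>w. monom (if even n then b n else 0) (w - n))"
  proof (rule poly_ext)
    fix y
    have "q 1 y = - q y 1" by (rule q_antisym)
    then show "poly (qpoly 1) y = poly (- (\<Sum>n\<le>w. monom (if even n then b n else 0) (w - n))) y"
      by (simp add: poly_qpoly q_def poly_sum poly_monom)
  qed
  then have "coeff (qpoly 1) (w - j) = coeff (- (\<Sum>n\<le>w. monom (if even n then b n else 0) (w - n))) (w - j)" by simp
  moreover have "coeff (qpoly 1) (w - j) = b (w - j)"
    using coeff_qpoly[of "w - j" 1] assms even_w by simp
  moreover have "coeff (\<Sum>n\<le>w. monom (if even n then b n else 0) (w - n)) (w - j) =
      (\<Sum>n\<le>w. if n = j then b j else 0)"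
    unfolding coeff_sum coeff_monom using assms by (intro sum.cong) auto
  ultimately show ?thesis using assms by simp
qed

end


section \<open>The motivic derivations\<close>

lemma vector_space_tscale: "vector_space tscale"
  by unfold_locales (auto simp: tscale_def fun_eq_iff algebra_simps)

lemma vector_space_rat_mult: "vector_space ((*) :: rat \<Rightarrow> rat \<Rightarrow> rat)"
  by unfold_locales (auto simp: algebra_simps)

interpretation T: vector_space tscale by (rule vector_space_tscale)

context motivic_mzv begin

sublocale A: vector_space "scaleA M" using algA by (simp add: graded_Q_algebra_def)
sublocale H: vector_space "scaleH M" using algH by (simp add: graded_Q_algebra_def)
sublocale AQ: vector_space_pair "scaleA M" "(*) :: rat \<Rightarrow> rat \<Rightarrow> rat"
  by (intro vector_space_pair.intro A.vector_space_axioms vector_space_rat_mult)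
sublocale HQ: vector_space_pair "scaleH M" "(*) :: rat \<Rightarrow> rat \<Rightarrow> rat"
  by (intro vector_space_pair.intro H.vector_space_axioms vector_space_rat_mult)

text \<open>Gives the uniqueness behind the \<open>THE\<close> in \<open>contract\<close>.\<close>

lemma functional_separates:
  assumes "h \<noteq> 0"
  obtains \<phi> where "Vector_Spaces.linear (scaleH M) (*) \<phi>" "\<phi> h \<noteq> 0"
proof -
  have "H.independent {h}" using assms by simp
  from HQ.linear_independent_extend[OF this, of "\<lambda>_. 1"] that show ?thesis by auto
qed

text \<open>The condition inside the \<open>THE\<close> of \<open>contract\<close>, as a relation:
  it is additive and homogeneous, so contractions can be built up before uniqueness is invoked once
  in \<open>contract_eqI\<close>.\<close>

definition contracts_to :: "('a \<Rightarrow> rat) \<Rightarrow> ('a, 'h) tensor \<Rightarrow> 'h \<Rightarrow> bool" where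
  "contracts_to \<psi> t h \<longleftrightarrow>
     (\<forall>\<phi>. Vector_Spaces.linear (scaleH M) (*) \<phi> \<longrightarrow> \<phi> h = t (\<lambda>a x. \<psi> a * \<phi> x))"

lemma contract_eqI:
  assumes "contracts_to \<psi> t h"
  shows "contract (scaleH M) \<psi> t = h"
  unfolding contract_def
proof (rule the_equality)
  show "\<forall>\<phi>. Vector_Spaces.linear (scaleH M) (*) \<phi> \<longrightarrow> \<phi> h = t (\<lambda>a x. \<psi> a * \<phi> x)"
    using assms by (simp add: contracts_to_def)
  fix h' assume h': "\<forall>\<phi>. Vector_Spaces.linear (scaleH M) (*) \<phi> \<longrightarrow> \<phi> h' = t (\<lambda>a x. \<psi> a * \<phi> x)"
  show "h' = h"
  proof (rule ccontr)
    assume "h' \<noteq> h"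
    then have "h' - h \<noteq> 0" by simp
    then obtain \<phi> where \<phi>: "Vector_Spaces.linear (scaleH M) (*) \<phi>" "\<phi> (h' - h) \<noteq> 0"
      by (rule functional_separates)
    have "\<phi> (h' - h) = \<phi> h' - \<phi> h" by (rule HQ.linear_diff[OF \<phi>(1)])
    moreover have "\<phi> h' = t (\<lambda>a x. \<psi> a * \<phi> x)" using h' \<phi>(1) by blast
    moreover have "\<phi> h = t (\<lambda>a x. \<psi> a * \<phi> x)" using assms \<phi>(1) by (simp add: contracts_to_def)
    ultimately show False using \<phi>(2) by simp
  qed
qed

lemma contracts_to_add:
  "contracts_to \<psi> t h \<Longrightarrow> contracts_to \<psi> t' h' \<Longrightarrow> contracts_to \<psi> (t + t') (h + h')"
  by (simp add: contracts_to_def HQ.linear_add)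

lemma contracts_to_scale:
  "contracts_to \<psi> t h \<Longrightarrow> contracts_to \<psi> (tscale q t) (scaleH M q h)"
  by (simp add: contracts_to_def HQ.linear_scale tscale_def)

lemma contracts_to_0: "contracts_to \<psi> 0 0"
  by (simp add: contracts_to_def HQ.linear_0)

lemma contracts_to_tensM:
  assumes "Vector_Spaces.linear (scaleA M) (*) \<psi>"
  shows "contracts_to \<psi> (tensM M a h) (scaleH M (\<psi> a) h)"
  unfolding contracts_to_def
proof (intro allI impI)
  fix \<phi> assume \<phi>: "Vector_Spaces.linear (scaleH M) (*) \<phi>"
  have 1: "Vector_Spaces.linear (scaleA M) (*) (\<lambda>a. \<psi> a * c)" for c
    unfolding Vector_Spaces.linear_iff
    by (simp add: A.vector_space_axioms vector_space_rat_mult AQ.linear_add[OF assms] AQ.linear_scale[OF assms] algebra_simps)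
  have 2: "Vector_Spaces.linear (scaleH M) (*) (\<lambda>x. c * \<phi> x)" for c
    unfolding Vector_Spaces.linear_iff
    by (simp add: H.vector_space_axioms vector_space_rat_mult HQ.linear_add[OF \<phi>] HQ.linear_scale[OF \<phi>] algebra_simps)
  have "bilinear_form (scaleA M) (scaleH M) (\<lambda>a x. \<psi> a * \<phi> x)"
    unfolding bilinear_form_def using 1 2 by blast
  then show "\<phi> (scaleH M (\<psi> a) h) = tensM M a h (\<lambda>a x. \<psi> a * \<phi> x)"
    by (simp add: tensM_def tens_def HQ.linear_scale[OF \<phi>])
qed

section \<open>Derivations on cosets of the depth filtration\<close>

definition null_tensors :: "nat \<Rightarrow> nat \<Rightarrow> ('a, 'h) tensor set" where
  "null_tensors p r = tspan {tensM M a h | a h. a \<in> lie_ker M p \<or> h \<in> depth_lt M N r}"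

lemma null_tensors_subspace: "T.subspace (null_tensors p r)"
  unfolding null_tensors_def tspan_def by (rule T.subspace_span)

lemma tensor_class_eq: "t' - t \<in> null_tensors p r \<Longrightarrow> tensor_class M N p r t' = tensor_class M N p r t"
proof -
  assume a: "t' - t \<in> null_tensors p r"
  have "s - t' \<in> null_tensors p r \<longleftrightarrow> s - t \<in> null_tensors p r" for s
    using T.subspace_add[OF null_tensors_subspace a, of "s - t'"]
      T.subspace_diff[OF null_tensors_subspace _ a, of "s - t"] by (auto simp: algebra_simps)
  then show ?thesis by (simp add: tensor_class_def flip: null_tensors_def)
qed

lemma self_in_tensor_class: "t \<in> tensor_class M N p r t"
  using T.subspace_0[OF null_tensors_subspace] by (simp add: tensor_class_def flip: null_tensors_def)

lemma depth_lt_subspace: "H.subspace (depth_lt M N r)"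
  unfolding depth_lt_def by (rule H.subspace_span)

lemma depth_class_eq: "y - x \<in> depth_lt M N r \<Longrightarrow> depth_class M N r y = depth_class M N r x"
proof -
  assume a: "y - x \<in> depth_lt M N r"
  have "s - y \<in> depth_lt M N r \<longleftrightarrow> s - x \<in> depth_lt M N r" for s
    using H.subspace_add[OF depth_lt_subspace a, of "s - y"]
      H.subspace_diff[OF depth_lt_subspace _ a, of "s - x"] by (auto simp: algebra_simps)
  then show ?thesis by (simp add: depth_class_def)
qed

text \<open>A generator has its left factor in the kernel of the functional or its right factor in
  lower depth. This makes the contraction well defined on tensor classes.\<close>

lemma null_tensors_contract:
  assumes \<psi>: "lie_coord M N p \<psi>" and t: "t \<in> null_tensors p r"
  shows "\<exists>d\<in>depth_lt M N r. contracts_to \<psi> t d"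
proof -
  have lin: "Vector_Spaces.linear (scaleA M) (*) \<psi>" using \<psi> by (simp add: lie_coord_def)
  have "t \<in> T.span {tensM M a h | a h. a \<in> lie_ker M p \<or> h \<in> depth_lt M N r}"
    using t by (simp add: null_tensors_def tspan_def)
  then show ?thesis
  proof (induction rule: T.span_induct_alt)
    case base
    then show ?case using contracts_to_0 H.subspace_0[OF depth_lt_subspace] by blast
  next
    case (step c x y)
    then obtain d where d: "d \<in> depth_lt M N r" "contracts_to \<psi> y d" by blast
    from step obtain a h where x: "x = tensM M a h" and ah: "a \<in> lie_ker M p \<or> h \<in> depth_lt M N r" by blast
    have "scaleH M (\<psi> a) h \<in> depth_lt M N r"
    proof (cases "a \<in> lie_ker M p")
      case True
      then have "\<psi> a = 0" using \<psi> by (simp add: lie_coord_def)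
      then show ?thesis using H.subspace_0[OF depth_lt_subspace] by simp
    next
      case False
      then show ?thesis using ah H.subspace_scale[OF depth_lt_subspace] by blast
    qed
    then have "scaleH M c (scaleH M (\<psi> a) h) + d \<in> depth_lt M N r"
      using d(1) H.subspace_add[OF depth_lt_subspace] H.subspace_scale[OF depth_lt_subspace] by blast
    moreover have "contracts_to \<psi> (tscale c x + y) (scaleH M c (scaleH M (\<psi> a) h) + d)"
      unfolding x by (intro contracts_to_add contracts_to_scale contracts_to_tensM lin d)
    ultimately show ?case by blast
  qed
qed

text \<open>\<open>deriv_gr\<close> is a union over such functionals and would be empty without one.
  The class of zeta(p; 1) lies outside \<open>lie_ker\<close>, so it extends a basis of the kernel,
  and a functional may be 1 on it and 0 on the kernel. \<open>lie_depth1\<close> then fixes the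
  values at the other roots of unity.\<close>

lemma lie_coord_exists:
  assumes p: "odd p" "p \<ge> 3"
  shows "\<exists>\<psi>. lie_coord M N p \<psi>"
proof -
  define v where "v = projA M (zm M [p] [1])"
  obtain S where S: "lie_ker M p = A.span S" unfolding lie_ker_def by blast
  obtain B where B: "B \<subseteq> S" "A.independent B" "S \<subseteq> A.span B"
    using A.maximal_independent_subset[of S] by blast
  have SB: "A.span S = A.span B"
    using B A.span_mono[OF B(1)] A.span_minimal[OF B(3) A.subspace_span] by blast
  have v: "v \<notin> A.span B" using lie_depth1_nonzero[OF p] S SB by (simp add: v_def)
  then have "A.independent (insert v B)" using B(2) by (simp add: A.independent_insertI)
  from AQ.linear_independent_extend[OF this, of "\<lambda>x. if x = v then 1 else 0"]
  obtain \<psi> where \<psi>: "Vector_Spaces.linear (scaleA M) (*) \<psi>"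
    "\<forall>x\<in>insert v B. \<psi> x = (if x = v then 1 else 0)" by blast
  have vB: "v \<notin> B" using v A.span_base by blast
  have ker: "\<psi> a = 0" if "a \<in> lie_ker M p" for a
  proof (rule AQ.linear_eq_0_on_span[OF \<psi>(1)])
    show "a \<in> A.span B" using that S SB by simp
    show "\<psi> x = 0" if "x \<in> B" for x using \<psi>(2) that vB by auto
  qed
  have "\<psi> (projA M (zm M [p] [\<epsilon>])) = lie_const N \<epsilon> p" if "\<epsilon> ^ N = 1" for \<epsilon>
  proof -
    have "\<psi> (projA M (zm M [p] [\<epsilon>]) - scaleA M (lie_const N \<epsilon> p) v) = 0"
      unfolding v_def by (rule ker[OF lie_depth1[OF p that]])
    then show ?thesis
      using \<psi>(2) by (simp add: AQ.linear_diff[OF \<psi>(1)] AQ.linear_scale[OF \<psi>(1)])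
  qed
  then show ?thesis using \<psi>(1) ker unfolding lie_coord_def by blast
qed

text \<open>All members of the union in \<open>deriv_gr\<close> coincide: two representatives of the
  tensor class differ by a null tensor, whose contraction has lower depth.\<close>

lemma deriv_gr_eq:
  assumes p: "odd p" "p \<ge> 3" and D: "D_gr M N p r X = tensor_class M N p (r - 1) t"
    and contr: "\<And>\<psi>. lie_coord M N p \<psi> \<Longrightarrow> contracts_to \<psi> t h"
  shows "deriv_gr M N p r X = depth_class M N (r - 1) h"
proof -
  have "depth_class M N (r - 1) (contract (scaleH M) \<psi> t') = depth_class M N (r - 1) h"
    if \<psi>: "lie_coord M N p \<psi>" and t': "t' \<in> tensor_class M N p (r - 1) t" for \<psi> t'
  proof -
    have "t' - t \<in> null_tensors p (r - 1)" using t' by (simp add: tensor_class_def null_tensors_def)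
    then obtain d where d: "d \<in> depth_lt M N (r - 1)" "contracts_to \<psi> (t' - t) d"
      using null_tensors_contract[OF \<psi>] by blast
    have "contracts_to \<psi> ((t' - t) + t) (d + h)" by (rule contracts_to_add[OF d(2) contr[OF \<psi>]])
    then have "contract (scaleH M) \<psi> t' = d + h" by (intro contract_eqI) simp
    then show ?thesis using d(1) by (intro depth_class_eq) simp
  qed
  moreover obtain \<psi> where "lie_coord M N p \<psi>" using lie_coord_exists[OF p] by blast
  moreover have "t \<in> tensor_class M N p (r - 1) t" by (rule self_in_tensor_class)
  ultimately show ?thesis unfolding deriv_gr_def D by blast
qed

lemma one_in_lie_ker: "p > 0 \<Longrightarrow> 1 \<in> lie_ker M p"
proof -
  assume "p > 0"
  have "1 \<in> weightA M 0"
  proof -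
    have "weightA M 0 = range (\<lambda>q. scaleA M q 1)" using algA by (simp add: graded_Q_algebra_def)
    moreover have "1 = scaleA M 1 1" by simp
    ultimately show ?thesis by blast
  qed
  then show ?thesis using \<open>p > 0\<close> unfolding lie_ker_def by (intro A.span_base UnI1) blast
qed

lemma coact_add: "coact M (x + y) = coact M x + coact M y"
  and coact_scale: "coact M (scaleH M q x) = tscale q (coact M x)"
  using coact_linear unfolding Vector_Spaces.linear_iff by blast+

text \<open>Depth 0 consists of the rational multiples of 1. Since 1 has weight 0 and p > 0, the
  tensor of 1 with 1 vanishes on projection to weight p.\<close>

lemma coact_depth_lt_1:
  assumes p: "p > 0" and d: "d \<in> depth_lt M N 1"
  shows "coact M d \<in> null_tensors p r"
proof -
  have "{zm M ns es |ns es. admissible N ns es \<and> length ns < 1} \<subseteq> {1}"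
    by (auto simp: admissible_def zm_empty)
  then have "d \<in> H.span {1}" using d H.span_mono unfolding depth_lt_def by blast
  then obtain q where q: "d = scaleH M q 1" by (auto simp: H.span_singleton)
  have "tensM M 1 1 \<in> null_tensors p r"
    unfolding null_tensors_def tspan_def using one_in_lie_ker[OF p] by (intro T.span_base) blast
  moreover have "coact M d = tscale q (tensM M 1 1)"
    by (simp add: q coact_scale coact_one)
  ultimately show ?thesis using T.subspace_scale[OF null_tensors_subspace] by simp
qed


text \<open>\<open>D_depth1\<close> concerns the class of a single generator, whereas the first
  derivation yields the class of a linear combination. The coaction of one representative suffices,
  because depth 0 contributes nothing.\<close>

lemma D_gr_depth_1:
  assumes p: "p > 0" and t: "coact M z - t \<in> null_tensors p 0"
  shows "D_gr M N p 1 (depth_class M N 1 z) = tensor_class M N p 0 t"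
proof -
  have "tensor_class M N p 0 (coact M x) = tensor_class M N p 0 t" if "x \<in> depth_class M N 1 z" for x
  proof (rule tensor_class_eq)
    have "x - z \<in> depth_lt M N 1" using that by (simp add: depth_class_def)
    then have "coact M (x - z) \<in> null_tensors p 0" by (rule coact_depth_lt_1[OF p])
    from T.subspace_add[OF null_tensors_subspace this t]
    have "coact M (x - z) + coact M z - t \<in> null_tensors p 0" by (simp add: algebra_simps)
    then show "coact M x - t \<in> null_tensors p 0" using coact_add[of "x - z" z] by simp
  qed
  moreover have "z \<in> depth_class M N 1 z"
    using H.subspace_0[OF depth_lt_subspace] by (simp add: depth_class_def)
  ultimately show ?thesis unfolding D_gr_def by auto
qed

text \<open>Recovers from \<open>D_depth1\<close> a statement about the coaction itself, to which
  linearity applies.\<close>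

lemma coact_depth_1:
  assumes p: "odd p" "p \<ge> 3" and "admissible N [n] [\<epsilon>]"
  shows "coact M (zm M [n] [\<epsilon>]) - (if p = n then tensM M (projA M (zm M [p] [\<epsilon>])) 1 else 0) \<in> null_tensors p 0"
proof -
  have "zm M [n] [\<epsilon>] \<in> depth_class M N 1 (zm M [n] [\<epsilon>])"
    using H.subspace_0[OF depth_lt_subspace] by (simp add: depth_class_def)
  then have "coact M (zm M [n] [\<epsilon>]) \<in> D_gr M N p 1 (depth_class M N 1 (zm M [n] [\<epsilon>]))"
    unfolding D_gr_def using self_in_tensor_class by fastforce
  then show ?thesis unfolding D_depth1[OF assms] by (simp add: tensor_class_def null_tensors_def)
qed

text \<open>The first derivation gives \<open>\<alpha>\<close> times zeta(n2; 1/epsilon) plus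
  \<open>\<beta>\<close> times zeta(m2; 1). The second leaves \<open>\<beta>\<close> unchanged, as
  \<open>lie_const\<close> is 1 at the root 1, and it sees the other summand only if m2 = n2, which
  for equal weights means m1 = n1.\<close>

lemma deriv_deriv_depth_2:
  assumes m: "odd m1" "m1 \<ge> 3" "odd m2" "m2 \<ge> 3" and n: "n1 \<ge> 3" "n2 \<ge> 3" "m1 + m2 = n1 + n2"
    and e: "\<epsilon> ^ N = 1"
  defines "\<alpha> \<equiv> if m1 = n1 then lie_const N \<epsilon> m1 else 0"
    and "\<beta> \<equiv> ((if n1 \<le> m1 then (-1) ^ n1 * of_nat ((m1 - 1) choose (m1 - n1)) else 0) +
        (if n2 \<le> m1 then (-1) ^ (m1 - n2) * of_nat ((m1 - 1) choose (m1 - n2)) else 0)) *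
        lie_const N (inverse \<epsilon>) m1"
  shows "deriv_gr M N m2 1 (deriv_gr M N m1 2 (depth_class M N 2 (zm M [n1, n2] [\<epsilon>, inverse \<epsilon>]))) =
    depth_class M N 0 (scaleH M (\<alpha> * lie_const N (inverse \<epsilon>) m2 + \<beta>) 1)"
proof -
  have e': "inverse \<epsilon> ^ N = 1" using e by (simp add: power_inverse)
  define z1 where "z1 = zm M [n2] [inverse \<epsilon>]"
  define z2 where "z2 = zm M [m2] [1]"
  have m2: "n1 + n2 - m1 = m2" using n by linarith
  have "deriv_gr M N m1 2 (depth_class M N 2 (zm M [n1, n2] [\<epsilon>, inverse \<epsilon>])) =
      depth_class M N (2 - 1) (scaleH M \<alpha> z1 + scaleH M \<beta> z2)"
  proof (rule deriv_gr_eq[OF m(1,2)])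
    show "D_gr M N m1 2 (depth_class M N 2 (zm M [n1, n2] [\<epsilon>, inverse \<epsilon>])) =
      tensor_class M N m1 (2 - 1)
            ((if m1 = n1 then tensM M (projA M (zm M [m1] [\<epsilon>])) z1 else 0) +
             tscale ((if n1 \<le> m1 then (-1) ^ n1 * of_nat ((m1 - 1) choose (m1 - n1)) else 0) +
        (if n2 \<le> m1 then (-1) ^ (m1 - n2) * of_nat ((m1 - 1) choose (m1 - n2)) else 0))
               (tensM M (projA M (zm M [m1] [inverse \<epsilon>])) z2))"
      using D_depth2[OF m(1,2), of n1 n2 \<epsilon>] n m e e' by (simp add: admissible_def z1_def z2_def m2)
  next
    fix \<psi> assume \<psi>: "lie_coord M N m1 \<psi>"
    then have lin: "Vector_Spaces.linear (scaleA M) (*) \<psi>"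
      and v: "\<psi> (projA M (zm M [m1] [\<epsilon>])) = lie_const N \<epsilon> m1"
        "\<psi> (projA M (zm M [m1] [inverse \<epsilon>])) = lie_const N (inverse \<epsilon>) m1"
      using e e' by (auto simp: lie_coord_def)
    have "contracts_to \<psi> (if m1 = n1 then tensM M (projA M (zm M [m1] [\<epsilon>])) z1 else 0) (scaleH M \<alpha> z1)"
    proof (cases "m1 = n1")
      case True
      then show ?thesis
        using contracts_to_tensM[OF lin, of "projA M (zm M [m1] [\<epsilon>])" z1] v(1) by (simp add: \<alpha>_def)
    next
      case False
      then show ?thesis using contracts_to_0 by (simp add: \<alpha>_def)
    qed
    moreover have "contracts_to \<psi> (tscale c (tensM M (projA M (zm M [m1] [inverse \<epsilon>])) z2))
        (scaleH M (c * lie_const N (inverse \<epsilon>) m1) z2)" for c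
      using contracts_to_scale[OF contracts_to_tensM[OF lin, of "projA M (zm M [m1] [inverse \<epsilon>])" z2], of c] v by simp
    ultimately show "contracts_to \<psi> ((if m1 = n1 then tensM M (projA M (zm M [m1] [\<epsilon>])) z1 else 0) +
             tscale ((if n1 \<le> m1 then (-1) ^ n1 * of_nat ((m1 - 1) choose (m1 - n1)) else 0) +
        (if n2 \<le> m1 then (-1) ^ (m1 - n2) * of_nat ((m1 - 1) choose (m1 - n2)) else 0))
               (tensM M (projA M (zm M [m1] [inverse \<epsilon>])) z2)) (scaleH M \<alpha> z1 + scaleH M \<beta> z2)"
      unfolding \<beta>_def by (intro contracts_to_add)
  qed
  then have 1: "deriv_gr M N m1 2 (depth_class M N 2 (zm M [n1, n2] [\<epsilon>, inverse \<epsilon>])) =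
      depth_class M N 1 (scaleH M \<alpha> z1 + scaleH M \<beta> z2)" by simp
  define t1 where "t1 = (if m2 = n2 then tensM M (projA M (zm M [m2] [inverse \<epsilon>])) 1 else 0)"
  define t2 where "t2 = tensM M (projA M (zm M [m2] [1])) 1"
  have "coact M z1 - t1 \<in> null_tensors m2 0"
    unfolding z1_def t1_def by (rule coact_depth_1[OF m(3,4)]) (use n e' in \<open>auto simp: admissible_def\<close>)
  moreover have "coact M z2 - t2 \<in> null_tensors m2 0"
    using coact_depth_1[OF m(3,4), of m2 1] m by (simp add: z2_def t2_def admissible_def)
  ultimately have "tscale \<alpha> (coact M z1 - t1) + tscale \<beta> (coact M z2 - t2) \<in> null_tensors m2 0"
    by (intro T.subspace_add[OF null_tensors_subspace] T.subspace_scale[OF null_tensors_subspace])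
  also have "tscale \<alpha> (coact M z1 - t1) + tscale \<beta> (coact M z2 - t2) =
      coact M (scaleH M \<alpha> z1 + scaleH M \<beta> z2) - (tscale \<alpha> t1 + tscale \<beta> t2)"
    unfolding coact_add coact_scale T.scale_right_diff_distrib by (simp only: algebra_simps)
  finally have "D_gr M N m2 1 (depth_class M N 1 (scaleH M \<alpha> z1 + scaleH M \<beta> z2)) =
      tensor_class M N m2 0 (tscale \<alpha> t1 + tscale \<beta> t2)"
    by (rule D_gr_depth_1[rotated]) (use m in simp)
  then have D: "D_gr M N m2 1 (depth_class M N 1 (scaleH M \<alpha> z1 + scaleH M \<beta> z2)) =
      tensor_class M N m2 (1 - 1) (tscale \<alpha> t1 + tscale \<beta> t2)" by simp
  have "deriv_gr M N m2 1 (depth_class M N 1 (scaleH M \<alpha> z1 + scaleH M \<beta> z2)) =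
      depth_class M N (1 - 1) (scaleH M (\<alpha> * lie_const N (inverse \<epsilon>) m2 + \<beta>) 1)"
  proof (rule deriv_gr_eq[OF m(3,4) D])
    fix \<psi> assume \<psi>: "lie_coord M N m2 \<psi>"
    then have lin: "Vector_Spaces.linear (scaleA M) (*) \<psi>"
      and v: "\<psi> (projA M (zm M [m2] [1])) = 1"
        "\<psi> (projA M (zm M [m2] [inverse \<epsilon>])) = lie_const N (inverse \<epsilon>) m2"
      using e' by (auto simp: lie_coord_def lie_const_def)
    have mn: "m2 = n2 \<longleftrightarrow> m1 = n1" using n by linarith
    have "contracts_to \<psi> (tscale \<alpha> t1) (scaleH M (\<alpha> * lie_const N (inverse \<epsilon>) m2) 1)"
    proof (cases "m1 = n1")
      case True
      then show ?thesis
        using contracts_to_scale[OF contracts_to_tensM[OF lin, of "projA M (zm M [m2] [inverse \<epsilon>])" 1], of \<alpha>] v mn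
        by (simp add: t1_def)
    next
      case False
      then show ?thesis using contracts_to_0 mn by (simp add: t1_def \<alpha>_def)
    qed
    moreover have "contracts_to \<psi> (tscale \<beta> t2) (scaleH M \<beta> 1)"
      using contracts_to_scale[OF contracts_to_tensM[OF lin, of "projA M (zm M [m2] [1])" 1], of \<beta>] v
      by (simp add: t2_def)
    ultimately show "contracts_to \<psi> (tscale \<alpha> t1 + tscale \<beta> t2) (scaleH M (\<alpha> * lie_const N (inverse \<epsilon>) m2 + \<beta>) 1)"
      unfolding H.scale_left_distrib by (rule contracts_to_add)
  qed
  then show ?thesis by (simp add: 1)
qed

text \<open>\<open>depth_lt M N 0\<close> is the span of the empty set, so its cosets are
  singletons; as 1 is nonzero, the rational multiple is determined.\<close>

lemma C_entry_eqI:
  assumes "deriv_gr M N m2 1 (deriv_gr M N m1 2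
       (depth_class M N 2 (zm M [n1, n2] [root_N N, inverse (root_N N)]))) =
     depth_class M N 0 (scaleH M q 1)"
  shows "C_entry M N (m1, m2) (n1, n2) = q"
proof -
  have single: "depth_class M N 0 x = {x}" for x
    unfolding depth_class_def depth_lt_def by auto
  show ?thesis
    unfolding C_entry_def prod.case assms single by (rule the_equality) auto
qed

end


section \<open>The matrix and its eigenvector\<close>

lemma root_N_power: "N > 0 \<Longrightarrow> root_N N ^ N = 1"
  by (simp add: root_N_def exp_of_nat_mult[symmetric])

lemma root_N_neq_1:
  assumes "N \<in> {2, 3}"
  shows "root_N N \<noteq> 1"
proof
  assume "root_N N = 1"
  then obtain n :: int where n: "2 * pi / real N = of_int (2 * n) * pi"
    unfolding root_N_def exp_eq_1 by auto
  then have "real N * of_int n = 1" using assms by (auto simp: field_simps)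
  then have "int N * n = 1" by (metis of_int_eq_1_iff of_int_mult of_int_of_nat_eq)
  then show False using assms by (auto simp: zmult_eq_1_iff)
qed

text \<open>All indices are odd, so the sign is -1 for n1 and 1 for m1 - n2. The root and its
  inverse have the same constant.\<close>

lemma (in motivic_mzv) C_entry_eq:
  assumes N: "N \<in> {2, 3}"
    and m: "odd m1" "m1 \<ge> 3" "odd m2" "m2 \<ge> 3" and n: "odd n1" "n1 \<ge> 3" "odd n2" "n2 \<ge> 3" "m1 + m2 = n1 + n2"
  defines "c \<equiv> \<lambda>p. lie_const N (root_N N) p"
  shows "C_entry M N (m1, m2) (n1, n2) = (if m1 = n1 then c m1 * c m2 else 0) +
    (of_nat ((m1 - 1) choose (n2 - 1)) - of_nat ((m1 - 1) choose (n1 - 1))) * c m1"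
proof (rule C_entry_eqI)
  have c': "lie_const N (inverse (root_N N)) p = c p" for p
    using root_N_neq_1[OF N] by (simp add: c_def lie_const_def)
  \<comment> \<open>Binomial symmetry; for n > m1 both sides are 0, in line with the convention for
    negative lower arguments.\<close>
  have choose: "(if n \<le> m1 then of_nat ((m1 - 1) choose (m1 - n)) else (0::rat)) = of_nat ((m1 - 1) choose (n - 1))"
    if "n \<ge> 3" for n
  proof (cases "n \<le> m1")
    case True
    then have "m1 - n = m1 - 1 - (n - 1)" using that by simp
    then show ?thesis using True that binomial_symmetric[of "n - 1" "m1 - 1"] by simp
  qed (use that m in \<open>simp add: binomial_eq_0\<close>)
  have "(if n1 \<le> m1 then (-1) ^ n1 * of_nat ((m1 - 1) choose (m1 - n1)) else 0) =
      - (of_nat ((m1 - 1) choose (n1 - 1)) :: rat)"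
    by (subst choose[OF n(2), symmetric]) (use n(1) in simp)
  moreover have "(if n2 \<le> m1 then (-1) ^ (m1 - n2) * of_nat ((m1 - 1) choose (m1 - n2)) else 0) =
      (of_nat ((m1 - 1) choose (n2 - 1)) :: rat)"
    by (subst choose[OF n(4), symmetric]) (use n(3) m(1) in simp)
  ultimately have e: "(if m1 = n1 then c m1 else 0) * c m2 +
      ((if n1 \<le> m1 then (-1) ^ n1 * of_nat ((m1 - 1) choose (m1 - n1)) else 0) +
       (if n2 \<le> m1 then (-1) ^ (m1 - n2) * of_nat ((m1 - 1) choose (m1 - n2)) else 0)) * c m1 =
     (if m1 = n1 then c m1 * c m2 else 0) +
    (of_nat ((m1 - 1) choose (n2 - 1)) - of_nat ((m1 - 1) choose (n1 - 1))) * c m1"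
    by simp
  have "N > 0" using N by auto
  from deriv_deriv_depth_2[OF m n(2,4,5) root_N_power[OF this], unfolded c']
  show "deriv_gr M N m2 1 (deriv_gr M N m1 2 (depth_class M N 2 (zm M [n1, n2] [root_N N, inverse (root_N N)]))) =
    depth_class M N 0 (scaleH M ((if m1 = n1 then c m1 * c m2 else 0) +
    (of_nat ((m1 - 1) choose (n2 - 1)) - of_nat ((m1 - 1) choose (n1 - 1))) * c m1) 1)"
    unfolding c_def[symmetric] e by (simp only: e)
qed

context even_cusp_form begin

lemma nat_k: "nat k = w + 2"
  using k_eq by simp

lemma length_odd_pairs: "length (odd_pairs k) = w div 2 - 1"
  by (simp add: odd_pairs_def nat_k)

text \<open>Both entries are written as one more than an even exponent; the first exponent, that of
  y, is the index into \<open>b\<close>.\<close>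

lemma odd_pairs_nth:
  "i < w div 2 - 1 \<Longrightarrow> odd_pairs k ! i = (w - (2 * i + 2) + 1, 2 * i + 3)"
  using even_w by (auto simp: odd_pairs_def nat_k)

lemma odd_pairs_rev_nth:
  assumes "j < w div 2 - 1"
  shows "odd_pairs_rev k ! j = (2 * j + 3, w - (2 * j + 2) + 1)"
proof -
  have "odd_pairs_rev k ! j = odd_pairs k ! (w div 2 - 1 - Suc j)"
    unfolding odd_pairs_rev_def using assms by (subst rev_nth) (simp_all add: length_odd_pairs)
  also have "\<dots> = (w - (2 * (w div 2 - 1 - Suc j) + 2) + 1, 2 * (w div 2 - 1 - Suc j) + 3)"
    by (rule odd_pairs_nth) (use assms in simp)
  also have "\<dots> = (2 * j + 3, w - (2 * j + 2) + 1)"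
    using assms even_w by (auto elim!: evenE)
  finally show ?thesis .
qed

lemma period_vector_nth:
  assumes "i < w div 2 - 1"
  shows "vec_index (period_vector k f) i = b (w - (2 * i + 2))"
proof -
  have "vec_index (period_vector k f) i = coeff (coeff (restricted_even_period_poly k f) (w - (2 * i + 2))) (w - (w - (2 * i + 2)))"
    using assms by (simp add: period_vector_def length_odd_pairs odd_pairs_nth)
  also have "\<dots> = b (w - (2 * i + 2))"
    by (rule coeff_restricted_even_period_poly) (use assms even_w in auto)
  finally show ?thesis .
qed

text \<open>Row i stands for the even index n = w - (2 i + 2), which runs through 2, ..., w - 2. As
  \<open>X\<close> vanishes at 0 and w, the sum extends to the two indices deleted by the
  restriction.\<close>

lemma sum_even_interior:
  fixes X :: "nat \<Rightarrow> complex"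
  assumes "X 0 = 0" "X w = 0"
  shows "(\<Sum>n\<le>w. (if even n then b n else 0) * X n) =
    (\<Sum>i<w div 2 - 1. b (w - (2 * i + 2)) * X (w - (2 * i + 2)))"
proof -
  let ?g = "\<lambda>i. w - (2 * i + 2)"
  have inj: "inj_on ?g {..<w div 2 - 1}" by (rule inj_onI) auto
  have "(\<Sum>i<w div 2 - 1. b (?g i) * X (?g i)) = (\<Sum>n\<in>?g ` {..<w div 2 - 1}. b n * X n)"
    unfolding sum.reindex[OF inj] by simp
  also have "\<dots> = (\<Sum>n\<in>?g ` {..<w div 2 - 1}. (if even n then b n else 0) * X n)"
    by (rule sum.cong) (use even_w in auto)
  also have "\<dots> = (\<Sum>n\<le>w. (if even n then b n else 0) * X n)"
  proof (rule sum.mono_neutral_left)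
    show "\<forall>n\<in>{..w} - ?g ` {..<w div 2 - 1}. (if even n then b n else 0) * X n = 0"
    proof
      fix n assume n: "n \<in> {..w} - ?g ` {..<w div 2 - 1}"
      show "(if even n then b n else 0) * X n = 0"
      proof (cases "even n \<and> n \<noteq> 0 \<and> n \<noteq> w")
        case True
        obtain u v where uv: "n = 2 * u" "w = 2 * v" using True even_w by (auto elim!: evenE)
        have "u < v" "u > 0" using True n uv by auto
        then have "n = ?g (v - u - 1)" "v - u - 1 < w div 2 - 1" using uv by auto
        then have "n \<in> ?g ` {..<w div 2 - 1}" by blast
        then show ?thesis using n by blast
      qed (use assms in auto)
    qed
  qed auto
  finally show ?thesis by simp
qed

lemma f_eq_0_if_period_vector_eq_0:
  assumes "\<And>i. i < w div 2 - 1 \<Longrightarrow> vec_index (period_vector k f) i = 0" and "Im z > 0"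
  shows "f z = 0"
proof (rule f_eq_0_if_even_coeffs_eq_0[OF _ assms(2)])
  fix n assume n: "even n" "2 \<le> n" "n + 2 \<le> w"
  obtain u v where uv: "n = 2 * u" "w = 2 * v" using n even_w by (auto elim!: evenE)
  have i: "v - u - 1 < w div 2 - 1" "w - (2 * (v - u - 1) + 2) = n" using n uv by auto
  show "b n = 0" using assms(1)[OF i(1)] period_vector_nth[OF i(1)] i(2) by simp
qed

text \<open>Put s = N. The sum of b n s^(-n) d n is \<open>tcoeff s J / s ^ w\<close>, to which the
  Hecke relation applies, and the sum of b n d n is b J. The powers s^(-J) and s^(-(w-J)) from the
  Hecke relation cancel against those in the subtracted product. What remains is (l - 1 - s^(w+1)) /
  s^w, divided by 4 if N = 3, times b J.\<close>

lemma column_identity: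
  assumes N: "N \<in> {2, 3}" and l: "hecke_eigenvalue k N f l" and J: "even J" "2 \<le> J" "J + 2 \<le> w"
  defines "c \<equiv> \<lambda>n. (if N = 2 then 1 / 2 ^ n - 1 else (1 / 3 ^ n - 1) / 2) :: complex"
    and "d \<equiv> \<lambda>n. of_nat (n choose J) - of_nat (n choose (w - J)) :: complex"
  shows "(\<Sum>i<w div 2 - 1. b (w - (2 * i + 2)) * (c (w - (2 * i + 2)) * d (w - (2 * i + 2)))) - b J * (c J * c (w - J)) =
    (if N = 2 then (l - (1 + 2 powi (k - 1))) / 2 powi (k - 2)
            else (l - (1 + 3 powi (k - 1))) / (4 * 3 powi (k - 2))) * b J"
proof -
  \<comment> \<open>At 0 both binomials vanish because J and w - J are positive; at w they agree by
    symmetry. This is what \<open>sum_even_interior\<close> requires.\<close>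
  have d0: "d 0 = 0" "d w = 0" using J binomial_symmetric[of J w] by (simp_all add: d_def binomial_eq_0)
  have sum: "(\<Sum>i<w div 2 - 1. b (w - (2 * i + 2)) * (c (w - (2 * i + 2)) * d (w - (2 * i + 2)))) =
      (\<Sum>n\<le>w. (if even n then b n else 0) * (c n * d n))"
    by (subst sum_even_interior) (simp_all add: d0)
  have tc: "(\<Sum>n\<le>w. (if even n then b n else 0) * ((1 / s ^ n) * d n)) = tcoeff s J / s ^ w" if "s \<noteq> 0" for s
    unfolding tcoeff_def d_def sum_divide_distrib
  proof (rule sum.cong[OF refl])
    fix n assume "n \<in> {..w}"
    then have "s ^ w = s ^ (w - n) * s ^ n" by (simp flip: power_add)
    then show "(if even n then b n else 0) * (1 / s ^ n * (of_nat (n choose J) - of_nat (n choose (w - J)))) =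
        (if even n then b n else 0) * s ^ (w - n) * (of_nat (n choose J) - of_nat (n choose (w - J))) / s ^ w"
      using that by simp
  qed
  have t1: "(\<Sum>n\<le>w. (if even n then b n else 0) * d n) = b J"
    using tc[of 1] tcoeff_1[of J] J by simp
  have split: "s ^ w = s ^ J * s ^ (w - J)" for s :: complex using J by (simp flip: power_add)
  show ?thesis
  proof (cases "N = 2")
    case True
    have "(\<Sum>n\<le>w. (if even n then b n else 0) * (c n * d n)) =
        (\<Sum>n\<le>w. (if even n then b n else 0) * ((1 / 2 ^ n) * d n)) - (\<Sum>n\<le>w. (if even n then b n else 0) * d n)"
      unfolding sum_subtractf[symmetric] by (rule sum.cong) (simp_all add: c_def True algebra_simps)
    also have "\<dots> = tcoeff 2 J / 2 ^ w - b J" using tc[of 2] t1 by simp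
    also have "tcoeff 2 J = l * b J - (2 ^ (w - J) + 2 ^ J) * b J"
      using tcoeff_hecke_2[of l J] l J True by simp
    finally show ?thesis
      unfolding sum by (simp add: True c_def powi_k_minus split field_simps)
  next
    case False
    then have N3: "N = 3" using N by simp
    have "(\<Sum>n\<le>w. (if even n then b n else 0) * (c n * d n)) =
        ((\<Sum>n\<le>w. (if even n then b n else 0) * ((1 / 3 ^ n) * d n)) - (\<Sum>n\<le>w. (if even n then b n else 0) * d n)) / 2"
      unfolding sum_subtractf[symmetric] sum_divide_distrib by (rule sum.cong) (simp_all add: c_def N3 field_simps)
    also have "\<dots> = (tcoeff 3 J / 3 ^ w - b J) / 2" using tc[of 3] t1 by simp
    also have "tcoeff 3 J = (l * b J - (3 ^ (w - J) + 3 ^ J) * b J) / 2"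
      using tcoeff_hecke_3[of l J] l J N3 by simp
    finally show ?thesis
      unfolding sum by (simp add: N3 c_def powi_k_minus split field_simps)
  qed
qed

end

lemma of_rat_lie_const:
  assumes "N \<in> {2, 3}"
  shows "(of_rat (lie_const N (root_N N) (Suc n)) :: complex) =
    (if N = 2 then 1 / 2 ^ n - 1 else (1 / 3 ^ n - 1) / 2)"
  using root_N_neq_1[OF assms] by (simp add: lie_const_def of_rat_diff of_rat_divide of_rat_power)

theorem theorem1:
  fixes k :: int and N :: nat and f :: "complex \<Rightarrow> complex" and l :: complex
    and M :: "('a::comm_ring_1, 'h::comm_ring_1) motivic_data"
  assumes "even k" and "N \<in> {2, 3}"
    and "motivic_mzv N M"
    and "cuspidal_hecke_eigenform k f"
    and "hecke_eigenvalue k N f l"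
  shows "eigenvector (transpose_mat (C_matrix M N k)) (period_vector k f)
           (if N = 2 then (l - (1 + 2 powi (k - 1))) / 2 powi (k - 2)
            else (l - (1 + 3 powi (k - 1))) / (4 * 3 powi (k - 2)))"
proof -
  interpret motivic_mzv N M by fact
  have cusp: "cusp_form k f" and nz: "\<exists>z. Im z > 0 \<and> f z \<noteq> 0"
    using assms(4) by (auto simp: cuspidal_hecke_eigenform_def)
  \<comment> \<open>Rules out nonpositive weights, so that evenness gives k >= 2 as the locale
    demands.\<close>
  have "k > 0" using cusp_form_nonpos_weight_eq_0[OF cusp] nz by (metis not_le)
  then have "k \<ge> 2" using \<open>even k\<close> by presburger
  then interpret even_cusp_form k f using cusp \<open>even k\<close> by unfold_locales
  define d where "d = w div 2 - 1"
  define \<mu> where "\<mu> = (if N = 2 then (l - (1 + 2 powi (k - 1))) / 2 powi (k - 2)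
            else (l - (1 + 3 powi (k - 1))) / (4 * 3 powi (k - 2)))"
  define c where "c n = (if N = 2 then 1 / 2 ^ n - 1 else (1 / 3 ^ n - 1) / 2 :: complex)" for n :: nat
  let ?n = "\<lambda>i. w - (2 * i + 2)"
  have dims: "dim_row (C_matrix M N k) = d" "dim_col (C_matrix M N k) = d" "dim_vec (period_vector k f) = d"
    by (simp_all add: C_matrix_def period_vector_def odd_pairs_rev_def length_odd_pairs d_def)
  have entry: "C_matrix M N k $$ (i, j) = (if ?n i = 2 * j + 2 then c (?n i) * c (2 * i + 2) else 0) +
      c (?n i) * (of_nat (?n i choose ?n j) - of_nat (?n i choose (2 * j + 2)))" if "i < d" "j < d" for i j
  proof -
    have i: "i < w div 2 - 1" "j < w div 2 - 1" using that by (auto simp: d_def)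
    have ev: "even (?n i)" "even (?n j)" "?n i \<ge> 2" "?n j \<ge> 2" "?n i + (2 * i + 2) = w" "?n j + (2 * j + 2) = w"
      using i even_w by auto
    have "C_entry M N (Suc (?n i), Suc (2 * i + 2)) (Suc (2 * j + 2), Suc (?n j)) =
      (if Suc (?n i) = Suc (2 * j + 2) then lie_const N (root_N N) (Suc (?n i)) * lie_const N (root_N N) (Suc (2 * i + 2)) else 0) +
      (of_nat ((Suc (?n i) - 1) choose (Suc (?n j) - 1)) - of_nat ((Suc (?n i) - 1) choose (Suc (2 * j + 2) - 1))) *
      lie_const N (root_N N) (Suc (?n i))"
      by (rule C_entry_eq[OF assms(2)]) (use ev in simp_all)
    moreover have "C_matrix M N k $$ (i, j) = of_rat (C_entry M N (Suc (?n i), Suc (2 * i + 2)) (Suc (2 * j + 2), Suc (?n j)))"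
    proof -
      have "length (odd_pairs_rev k) = length (odd_pairs k)" by (simp add: odd_pairs_rev_def)
      then show ?thesis
        using i by (simp add: C_matrix_def length_odd_pairs odd_pairs_nth odd_pairs_rev_nth numeral_3_eq_3)
    qed
    ultimately show ?thesis
      by (simp add: of_rat_add of_rat_mult of_rat_diff of_rat_lie_const[OF assms(2)] c_def mult.commute)
  qed
  have main: "vec_index (transpose_mat (C_matrix M N k) *\<^sub>v period_vector k f) j = \<mu> * vec_index (period_vector k f) j"
    if j: "j < d" for j
  proof -
    define J where "J = ?n j"
    have wd: "w = 2 * d + 2" using j even_w by (auto simp: d_def elim!: evenE)
    have J: "even J" "2 \<le> J" "J + 2 \<le> w" "w - J = 2 * j + 2" using j wd by (auto simp: J_def)
    \<comment> \<open>The row with m1 = n1 for this column, the only one to receive a product of two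
      constants.\<close>
    define i0 where "i0 = d - Suc j"
    have i0: "i0 < d" "?n i0 = 2 * j + 2" "2 * i0 + 2 = J" using j wd by (auto simp: i0_def J_def)
    have ni: "?n i = 2 * j + 2 \<longleftrightarrow> i = i0" if "i < d" for i using that j wd by (auto simp: i0_def)
    let ?D = "\<lambda>n. of_nat (n choose J) - of_nat (n choose (w - J)) :: complex"
    have "vec_index (transpose_mat (C_matrix M N k) *\<^sub>v period_vector k f) j =
        (\<Sum>i<d. C_matrix M N k $$ (i, j) * vec_index (period_vector k f) i)"
      using j by (simp add: scalar_prod_def dims lessThan_atLeast0)
    also have "\<dots> = (\<Sum>i<d. b (?n i) * (c (?n i) * ?D (?n i)) + (if i = i0 then b (?n i) * (c (?n i) * c (2 * i + 2)) else 0))"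
    proof (rule sum.cong[OF refl])
      fix i assume "i \<in> {..<d}"
      then have i: "i < d" by simp
      have "vec_index (period_vector k f) i = b (?n i)" using i by (intro period_vector_nth) (simp add: d_def)
      then show "C_matrix M N k $$ (i, j) * vec_index (period_vector k f) i =
          b (?n i) * (c (?n i) * ?D (?n i)) + (if i = i0 then b (?n i) * (c (?n i) * c (2 * i + 2)) else 0)"
        unfolding entry[OF i j] ni[OF i] J_def[symmetric] J(4) by (simp add: algebra_simps)
    qed
    also have "\<dots> = (\<Sum>i<d. b (?n i) * (c (?n i) * ?D (?n i))) + b (2 * j + 2) * (c (2 * j + 2) * c J)"
      unfolding sum.distrib using i0 by simp
    \<comment> \<open>The row \<open>i0\<close> carries the coefficient at w - J. Antisymmetry
      supplies the sign of the subtracted product in \<open>column_identity\<close>.\<close>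
    also have "b (2 * j + 2) = - b J" using b_reflect[of J] J by simp
    also have "(\<Sum>i<d. b (?n i) * (c (?n i) * ?D (?n i))) + - b J * (c (2 * j + 2) * c J) = \<mu> * b J"
      using column_identity[OF assms(2,5) J(1-3)] unfolding \<mu>_def c_def d_def J(4) by (simp add: mult.commute)
    also have "b J = vec_index (period_vector k f) j"
      unfolding J_def by (rule period_vector_nth[symmetric]) (use j in \<open>simp add: d_def\<close>)
    finally show ?thesis .
  qed
  \<comment> \<open>For d = 0 the vector is trivially zero, and the argument shows that there is no
    such \<open>f\<close>.\<close>
  have "period_vector k f \<noteq> 0\<^sub>v d"
  proof
    assume "period_vector k f = 0\<^sub>v d"
    then have "vec_index (period_vector k f) i = 0" if "i < w div 2 - 1" for i using that by (simp add: d_def)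
    then show False using nz f_eq_0_if_period_vector_eq_0 by blast
  qed
  moreover have "period_vector k f \<in> carrier_vec d" using dims(3) by (rule carrier_vecI)
  moreover have "transpose_mat (C_matrix M N k) *\<^sub>v period_vector k f = \<mu> \<cdot>\<^sub>v period_vector k f"
    by (rule eq_vecI) (use main dims in auto)
  ultimately show ?thesis unfolding eigenvector_def \<mu>_def[symmetric] by (simp add: dims)
qed

end
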